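(* Let $(M,\omega)$ be a connected symplectic manifold with a proper and Hamiltonian action of a connected Lie group $G=G_1\times G_2$. Assume that $G_1,G_2$ are closed connected Lie subgroups of $G$ and that the coadjoint orbits of $G$, $G_1$ and $G_2$ are locally closed. Then the following are equivalent: (i) $M$ is a $G$ multiplicity-free space; (ii) for every $\alpha=\alpha_1+\alpha_2\in\mathfrak g^*=\mathfrak g_1^*\oplus\mathfrak g_2^*$, the reduced space $M_{\alpha_1}$ is a $G_2$ multiplicity-free space; (iii) for every $\alpha=\alpha_1+\alpha_2\in\mathfrak g^*$, the reduced space $M_{\alpha_2}$ is a $G_1$ multiplicity-free space.
   Context: The moment map of the $G$-action is $\mu=\mu_1+\mu_2:M\to\mathfrak g^*=\mathfrak g_1^*\oplus\mathfrak g_2^*$ (that is, $d\mu^X=i_{X^\#}\omega$ for $X\in\mathfrak g$, and $\mu$ is $G$-equivariant for the coadjoint action), with $\mu_i$ the moment map of the $G_i$-action; $\mu_1$ is $G_2$-invariant and $\mu_2$ is $G_1$-invariant. The Poisson bracket on $C^\infty(M)$ is $\{f,g\}=\omega(X_f,X_g)$, $df=i_{X_f}\omega$. $M$ is a $G$ multiplicity-free space if $C^\infty(M)^G$ is commutative for this bracket. For $\{i,j\}=\{1,2\}$ and $\alpha_i\in\mathfrak g_i^*$, the reduced space is the topological quotient $M_{\alpha_i}=\mu_i^{-1}(G_i\alpha_i)/G_i$, where $G_i\alpha_i$ is the coadjoint orbit; its smooth functions are $C^\infty(M_{\alpha_i})=C^\infty(M)^{G_i}|_{\mu_i^{-1}(G_i\alpha_i)}$,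 regarded as functions on the quotient, with the Poisson bracket induced from $C^\infty(M)^{G_i}$. The group $G_j$ acts on $M_{\alpha_i}$, and $M_{\alpha_i}$ is called a $G_j$ multiplicity-free space if the Poisson algebra $C^\infty(M_{\alpha_i})^{G_j}$ of $G_j$-invariant functions is commutative (all brackets vanish). *)

theory Defs
  imports "HOL-Analysis.Analysis" "HOL-Algebra.Group_Action"
begin

section \<open>Smooth manifolds\<close>

text \<open>\<open>C_k k S f\<close> is meant for open \<open>S\<close> in a finite-dimensional normed space.\<close>

fun C_k :: "nat \<Rightarrow> 'a::real_normed_vector set \<Rightarrow> ('a \<Rightarrow> 'b::real_normed_vector) \<Rightarrow> bool" where
  "C_k 0 S f \<longleftrightarrow> continuous_on S f"
| "C_k (Suc k) S f \<longleftrightarrow>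
     (\<forall>x\<in>S. f differentiable (at x)) \<and> (\<forall>v. C_k k S (\<lambda>x. frechet_derivative f (at x) v))"

definition smooth_on :: "'a::real_normed_vector set \<Rightarrow> ('a \<Rightarrow> 'b::real_normed_vector) \<Rightarrow> bool" where
  "smooth_on S f \<longleftrightarrow> (\<forall>k. C_k k S f)"

text \<open>A manifold is a whole type; at every use below that type is Hausdorff and second countable.
  A chart is a domain together with a map that matters only on this domain. The model space is a
  finite-dimensional normed space rather than a \<^class>\<open>euclidean_space\<close>, so that dimension 0 is
  included.\<close>

type_synonym ('m, 'e) atlas = "('m set \<times> ('m \<Rightarrow> 'e)) set"

definition smooth_atlas :: "('m::topological_space, 'e::real_normed_vector) atlas \<Rightarrow> bool" where
  "smooth_atlas A \<longleftrightarrow>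
     (\<exists>B::'e set. finite B \<and> span B = UNIV) \<and>
     (\<Union>(U, \<phi>)\<in>A. U) = UNIV \<and>
     (\<forall>(U, \<phi>)\<in>A. open U \<and> open (\<phi> ` U) \<and> homeomorphism U (\<phi> ` U) \<phi> (inv_into U \<phi>)) \<and>
     (\<forall>(U, \<phi>)\<in>A. \<forall>(V, \<psi>)\<in>A. smooth_on (\<phi> ` (U \<inter> V)) (\<psi> \<circ> inv_into U \<phi>))"

definition C_inf :: "('m::topological_space, 'e::real_normed_vector) atlas \<Rightarrow> ('m \<Rightarrow> real) set" where
  "C_inf A = {f. \<forall>(U, \<phi>)\<in>A. smooth_on (\<phi> ` U) (f \<circ> inv_into U \<phi>)}"

definition smooth_map ::
  "('m::topological_space, 'e::real_normed_vector) atlas \<Rightarrow>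
   ('n::topological_space, 'f::real_normed_vector) atlas \<Rightarrow> ('m \<Rightarrow> 'n) \<Rightarrow> bool" where
  "smooth_map A B F \<longleftrightarrow> continuous_on UNIV F \<and>
     (\<forall>(U, \<phi>)\<in>A. \<forall>(V, \<psi>)\<in>B. smooth_on (\<phi> ` (U \<inter> F -` V)) (\<psi> \<circ> F \<circ> inv_into U \<phi>))"

definition prod_atlas ::
  "('m, 'e) atlas \<Rightarrow> ('n, 'f) atlas \<Rightarrow> ('m \<times> 'n, 'e \<times> 'f) atlas" where
  "prod_atlas A B = (\<lambda>((U, \<phi>), (V, \<psi>)). (U \<times> V, map_prod \<phi> \<psi>)) ` (A \<times> B)"

definition real_atlas :: "(real, real) atlas" where
  "real_atlas = {(UNIV, id)}"

section \<open>Tangent vectors and vector fields\<close>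

text \<open>Tangent vectors at \<open>p\<close> are derivations at \<open>p\<close> of the algebra of smooth functions, with value
  0 on non-smooth arguments so that derivations agreeing on smooth functions are equal. The
  vector space operations on them are pointwise.\<close>

type_synonym 'm tvec = "('m \<Rightarrow> real) \<Rightarrow> real"

definition tangent_space ::
  "('m::topological_space, 'e::real_normed_vector) atlas \<Rightarrow> 'm \<Rightarrow> 'm tvec set" where
  "tangent_space A p = {v.
     (\<forall>f\<in>C_inf A. \<forall>g\<in>C_inf A. \<forall>a b. v (\<lambda>x. a * f x + b * g x) = a * v f + b * v g) \<and>
     (\<forall>f\<in>C_inf A. \<forall>g\<in>C_inf A. v (\<lambda>x. f x * g x) = f p * v g + g p * v f) \<and>
     (\<forall>f. f \<notin> C_inf A \<longrightarrow> v f = 0)}"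

definition linear_functional_on :: "'m tvec set \<Rightarrow> ('m tvec \<Rightarrow> real) \<Rightarrow> bool" where
  "linear_functional_on V \<alpha> \<longleftrightarrow>
     (\<forall>v\<in>V. \<forall>w\<in>V. \<forall>a b. \<alpha> (\<lambda>f. a * v f + b * w f) = a * \<alpha> v + b * \<alpha> w)"

text \<open>The differential of a smooth map into the manifold with atlas \<open>B\<close>.\<close>

definition push_forward ::
  "('n::topological_space, 'f::real_normed_vector) atlas \<Rightarrow> ('m \<Rightarrow> 'n) \<Rightarrow> 'm tvec \<Rightarrow> 'n tvec" where
  "push_forward B F v = (\<lambda>f. if f \<in> C_inf B then v (f \<circ> F) else 0)"

definition vector_field ::
  "('m::topological_space, 'e::real_normed_vector) atlas \<Rightarrow> ('m \<Rightarrow> 'm tvec) \<Rightarrow> bool" where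
  "vector_field A X \<longleftrightarrow>
     (\<forall>p. X p \<in> tangent_space A p) \<and> (\<forall>f\<in>C_inf A. (\<lambda>p. X p f) \<in> C_inf A)"

definition vf_bracket ::
  "('m::topological_space, 'e::real_normed_vector) atlas \<Rightarrow>
   ('m \<Rightarrow> 'm tvec) \<Rightarrow> ('m \<Rightarrow> 'm tvec) \<Rightarrow> ('m \<Rightarrow> 'm tvec)" where
  "vf_bracket A X Y = (\<lambda>p f. if f \<in> C_inf A then X p (\<lambda>q. Y q f) - Y p (\<lambda>q. X q f) else 0)"

section \<open>Symplectic manifolds\<close>

type_synonym 'm two_form = "'m \<Rightarrow> 'm tvec \<Rightarrow> 'm tvec \<Rightarrow> real"

text \<open>The last condition is $d\omega = 0$, by the coordinate-free formula for the exterior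
  derivative (up to the normalisation of $d$).\<close>

definition symplectic_form ::
  "('m::topological_space, 'e::real_normed_vector) atlas \<Rightarrow> 'm two_form \<Rightarrow> bool" where
  "symplectic_form A \<omega> \<longleftrightarrow>
     (\<forall>p. \<forall>v\<in>tangent_space A p. linear_functional_on (tangent_space A p) (\<omega> p v)) \<and>
     (\<forall>p. \<forall>v\<in>tangent_space A p. \<forall>w\<in>tangent_space A p. \<omega> p v w = - \<omega> p w v) \<and>
     (\<forall>p. \<forall>v\<in>tangent_space A p. (\<forall>w\<in>tangent_space A p. \<omega> p v w = 0) \<longrightarrow> v = (\<lambda>_. 0)) \<and>
     (\<forall>X Y. vector_field A X \<longrightarrow> vector_field A Y \<longrightarrow> (\<lambda>p. \<omega> p (X p) (Y p)) \<in> C_inf A) \<and>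
     (\<forall>X Y Z. vector_field A X \<longrightarrow> vector_field A Y \<longrightarrow> vector_field A Z \<longrightarrow>
       (\<forall>p. X p (\<lambda>q. \<omega> q (Y q) (Z q)) + Y p (\<lambda>q. \<omega> q (Z q) (X q)) + Z p (\<lambda>q. \<omega> q (X q) (Y q))
          - \<omega> p (vf_bracket A X Y p) (Z p) - \<omega> p (vf_bracket A Y Z p) (X p)
          - \<omega> p (vf_bracket A Z X p) (Y p) = 0))"

text \<open>$df = i_{X_f}\omega$ and $\{f,g\} = \omega(X_f,X_g)$; note that $df(w) = w(f)$.\<close>

definition ham_field ::
  "('m::topological_space, 'e::real_normed_vector) atlas \<Rightarrow> 'm two_form \<Rightarrow> ('m \<Rightarrow> real) \<Rightarrow> 'm \<Rightarrow> 'm tvec"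
  where
  "ham_field A \<omega> f p =
     (THE v. v \<in> tangent_space A p \<and> (\<forall>w\<in>tangent_space A p. w f = \<omega> p v w))"

definition poisson ::
  "('m::topological_space, 'e::real_normed_vector) atlas \<Rightarrow> 'm two_form \<Rightarrow>
   ('m \<Rightarrow> real) \<Rightarrow> ('m \<Rightarrow> real) \<Rightarrow> 'm \<Rightarrow> real" where
  "poisson A \<omega> f g = (\<lambda>p. \<omega> p (ham_field A \<omega> f p) (ham_field A \<omega> g p))"

section \<open>Lie groups and coadjoint orbits\<close>

definition lie_group ::
  "'g::topological_space monoid \<Rightarrow> ('g, 'e::real_normed_vector) atlas \<Rightarrow> bool" where
  "lie_group G A \<longleftrightarrow> group G \<and> carrier G = UNIV \<and> smooth_atlas A \<and>
     smooth_map (prod_atlas A A) A (\<lambda>(g, h). g \<otimes>\<^bsub>G\<^esub> h) \<and> smooth_map A A (\<lambda>g. inv\<^bsub>G\<^esub> g)"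

text \<open>\<open>G\<close> is the (internal) direct product of its subgroups \<open>G1\<close> and \<open>G2\<close>. For closed subgroups of
  a second countable Lie group the isomorphism is automatically one of Lie groups.\<close>

definition internal_product :: "'g monoid \<Rightarrow> 'g set \<Rightarrow> 'g set \<Rightarrow> bool" where
  "internal_product G G1 G2 \<longleftrightarrow> subgroup G1 G \<and> subgroup G2 G \<and>
     (\<lambda>(g, h). g \<otimes>\<^bsub>G\<^esub> h) \<in> iso (G\<lparr>carrier := G1\<rparr> \<times>\<times> G\<lparr>carrier := G2\<rparr>) G"

definition one_parameter_subgroup ::
  "'g::topological_space monoid \<Rightarrow> ('g, 'e::real_normed_vector) atlas \<Rightarrow> (real \<Rightarrow> 'g) \<Rightarrow> bool" where
  "one_parameter_subgroup G A \<gamma> \<longleftrightarrow>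
     smooth_map real_atlas A \<gamma> \<and> (\<forall>s t. \<gamma> (s + t) = \<gamma> s \<otimes>\<^bsub>G\<^esub> \<gamma> t)"

definition velocity ::
  "('g::topological_space, 'e::real_normed_vector) atlas \<Rightarrow> (real \<Rightarrow> 'g) \<Rightarrow> 'g tvec" where
  "velocity A \<gamma> = (\<lambda>f. if f \<in> C_inf A then deriv (f \<circ> \<gamma>) 0 else 0)"

text \<open>The Lie algebra of a closed subgroup \<open>H\<close>, as the subspace
  $\{X \in T_e G \mid \exp(tX) \in H \mbox{ for all } t\}$ of the tangent space of \<open>G\<close> at the unit;
  for \<open>H = carrier G\<close> it is this whole tangent space.\<close>

definition lie_alg ::
  "'g::topological_space monoid \<Rightarrow> ('g, 'e::real_normed_vector) atlas \<Rightarrow> 'g set \<Rightarrow> 'g tvec set" where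
  "lie_alg G A H = {velocity A \<gamma> | \<gamma>. one_parameter_subgroup G A \<gamma> \<and> range \<gamma> \<subseteq> H}"

text \<open>The dual space, its elements being extended by 0 outside the Lie algebra. With respect to the
  product topology on functions (that is, pointwise convergence) it carries the usual topology of a
  finite-dimensional vector space.\<close>

definition lie_dual ::
  "'g::topological_space monoid \<Rightarrow> ('g, 'e::real_normed_vector) atlas \<Rightarrow> 'g set \<Rightarrow> ('g tvec \<Rightarrow> real) set"
  where
  "lie_dual G A H =
     {\<alpha>. linear_functional_on (lie_alg G A H) \<alpha> \<and> (\<forall>X. X \<notin> lie_alg G A H \<longrightarrow> \<alpha> X = 0)}"

text \<open>For \<open>G = G1 \<times> G2\<close>, the component in the dual of the Lie algebra of \<open>Gi\<close> of a functional on the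
  Lie algebra of \<open>G\<close> is its restriction.\<close>

definition dual_restrict ::
  "'g::topological_space monoid \<Rightarrow> ('g, 'e::real_normed_vector) atlas \<Rightarrow> 'g set \<Rightarrow>
   ('g tvec \<Rightarrow> real) \<Rightarrow> ('g tvec \<Rightarrow> real)" where
  "dual_restrict G A H \<alpha> = (\<lambda>X. if X \<in> lie_alg G A H then \<alpha> X else 0)"

definition Ad ::
  "'g::topological_space monoid \<Rightarrow> ('g, 'e::real_normed_vector) atlas \<Rightarrow> 'g \<Rightarrow> 'g tvec \<Rightarrow> 'g tvec" where
  "Ad G A g X = push_forward A (\<lambda>h. g \<otimes>\<^bsub>G\<^esub> h \<otimes>\<^bsub>G\<^esub> inv\<^bsub>G\<^esub> g) X"

definition coadjoint ::
  "'g::topological_space monoid \<Rightarrow> ('g, 'e::real_normed_vector) atlas \<Rightarrow> 'g set \<Rightarrow> 'g \<Rightarrow>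
   ('g tvec \<Rightarrow> real) \<Rightarrow> ('g tvec \<Rightarrow> real)" where
  "coadjoint G A H g \<alpha> = (\<lambda>X. if X \<in> lie_alg G A H then \<alpha> (Ad G A (inv\<^bsub>G\<^esub> g) X) else 0)"

definition coadjoint_orbit ::
  "'g::topological_space monoid \<Rightarrow> ('g, 'e::real_normed_vector) atlas \<Rightarrow> 'g set \<Rightarrow>
   ('g tvec \<Rightarrow> real) \<Rightarrow> ('g tvec \<Rightarrow> real) set" where
  "coadjoint_orbit G A H \<alpha> = (\<lambda>g. coadjoint G A H g \<alpha>) ` H"

definition locally_closed_in :: "'a topology \<Rightarrow> 'a set \<Rightarrow> bool" where
  "locally_closed_in X S \<longleftrightarrow> (\<exists>U C. openin X U \<and> closedin X C \<and> S = U \<inter> C)"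

definition coadjoint_orbits_locally_closed ::
  "'g::topological_space monoid \<Rightarrow> ('g, 'e::real_normed_vector) atlas \<Rightarrow> 'g set \<Rightarrow> bool" where
  "coadjoint_orbits_locally_closed G A H \<longleftrightarrow>
     (\<forall>\<alpha>\<in>lie_dual G A H.
        locally_closed_in (top_of_set (lie_dual G A H)) (coadjoint_orbit G A H \<alpha>))"

section \<open>Hamiltonian actions\<close>

definition smooth_action ::
  "'g::topological_space monoid \<Rightarrow> ('g, 'e::real_normed_vector) atlas \<Rightarrow>
   ('m::topological_space, 'f::real_normed_vector) atlas \<Rightarrow> ('g \<Rightarrow> 'm \<Rightarrow> 'm) \<Rightarrow> bool" where
  "smooth_action G AG AM act \<longleftrightarrow>
     group_action G UNIV act \<and> smooth_map (prod_atlas AG AM) AM (\<lambda>(g, x). act g x)"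

definition proper_action :: "('g::topological_space \<Rightarrow> 'm::topological_space \<Rightarrow> 'm) \<Rightarrow> bool" where
  "proper_action act \<longleftrightarrow> proper_map euclidean euclidean (\<lambda>(g, x). (x, act g x))"

definition symplectic_action ::
  "'g monoid \<Rightarrow> ('m::topological_space, 'f::real_normed_vector) atlas \<Rightarrow> 'm two_form \<Rightarrow>
   ('g \<Rightarrow> 'm \<Rightarrow> 'm) \<Rightarrow> bool" where
  "symplectic_action G AM \<omega> act \<longleftrightarrow>
     (\<forall>g\<in>carrier G. \<forall>p. \<forall>v\<in>tangent_space AM p. \<forall>w\<in>tangent_space AM p.
        \<omega> (act g p) (push_forward AM (act g) v) (push_forward AM (act g) w) = \<omega> p v w)"

text \<open>$X^\#_p$ is the derivative of $t \mapsto \exp(tX)\cdot p$ at 0.\<close>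

definition fundamental_field ::
  "('m::topological_space, 'f::real_normed_vector) atlas \<Rightarrow> ('g \<Rightarrow> 'm \<Rightarrow> 'm) \<Rightarrow> 'g tvec \<Rightarrow> 'm \<Rightarrow> 'm tvec"
  where
  "fundamental_field AM act X p = push_forward AM (\<lambda>g. act g p) X"

text \<open>The second and third conditions say that $\mu$ is smooth and that
  $d\mu^X = i_{X^\#}\omega$, the last one that $\mu$ is equivariant.\<close>

definition moment_map ::
  "'g::topological_space monoid \<Rightarrow> ('g, 'e::real_normed_vector) atlas \<Rightarrow>
   ('m::topological_space, 'f::real_normed_vector) atlas \<Rightarrow> 'm two_form \<Rightarrow> ('g \<Rightarrow> 'm \<Rightarrow> 'm) \<Rightarrow>
   ('m \<Rightarrow> 'g tvec \<Rightarrow> real) \<Rightarrow> bool" where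
  "moment_map G AG AM \<omega> act \<mu> \<longleftrightarrow>
     (\<forall>p. \<mu> p \<in> lie_dual G AG (carrier G)) \<and>
     (\<forall>X\<in>lie_alg G AG (carrier G). (\<lambda>p. \<mu> p X) \<in> C_inf AM) \<and>
     (\<forall>X\<in>lie_alg G AG (carrier G). \<forall>p. \<forall>w\<in>tangent_space AM p.
        w (\<lambda>q. \<mu> q X) = \<omega> p (fundamental_field AM act X p) w) \<and>
     (\<forall>g\<in>carrier G. \<forall>p. \<mu> (act g p) = coadjoint G AG (carrier G) g (\<mu> p))"

section \<open>Multiplicity-free spaces and reduced spaces\<close>

definition inv_functions ::
  "('m::topological_space, 'f::real_normed_vector) atlas \<Rightarrow> ('g \<Rightarrow> 'm \<Rightarrow> 'm) \<Rightarrow> 'g set \<Rightarrow>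
   ('m \<Rightarrow> real) set" where
  "inv_functions AM act H = {f \<in> C_inf AM. \<forall>g\<in>H. \<forall>x. f (act g x) = f x}"

definition multiplicity_free ::
  "'g monoid \<Rightarrow> ('m::topological_space, 'f::real_normed_vector) atlas \<Rightarrow> 'm two_form \<Rightarrow>
   ('g \<Rightarrow> 'm \<Rightarrow> 'm) \<Rightarrow> bool" where
  "multiplicity_free G AM \<omega> act \<longleftrightarrow>
     (\<forall>f\<in>inv_functions AM act (carrier G). \<forall>g\<in>inv_functions AM act (carrier G).
        poisson AM \<omega> f g = (\<lambda>_. 0))"

text \<open>In what follows \<open>H\<close> is the subgroup by which one reduces, \<open>\<mu>\<close> is the moment map of the whole
  group \<open>G\<close>, and \<open>\<alpha>\<close> lies in the dual of the Lie algebra of \<open>H\<close>.\<close>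

definition moment_level ::
  "'g::topological_space monoid \<Rightarrow> ('g, 'e::real_normed_vector) atlas \<Rightarrow>
   ('m \<Rightarrow> 'g tvec \<Rightarrow> real) \<Rightarrow> 'g set \<Rightarrow> ('g tvec \<Rightarrow> real) \<Rightarrow> 'm set" where
  "moment_level G AG \<mu> H \<alpha> = {x. dual_restrict G AG H (\<mu> x) \<in> coadjoint_orbit G AG H \<alpha>}"

abbreviation sub_orbit :: "'g monoid \<Rightarrow> ('g \<Rightarrow> 'm \<Rightarrow> 'm) \<Rightarrow> 'g set \<Rightarrow> 'm \<Rightarrow> 'm set" where
  "sub_orbit G act H x \<equiv> orbit (G\<lparr>carrier := H\<rparr>) act x"

text \<open>The set of \<open>H\<close>-orbits in the level set, with the quotient topology.\<close>

definition reduced_space ::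
  "'g::topological_space monoid \<Rightarrow> ('g, 'e::real_normed_vector) atlas \<Rightarrow>
   ('g \<Rightarrow> 'm \<Rightarrow> 'm) \<Rightarrow> ('m::topological_space \<Rightarrow> 'g tvec \<Rightarrow> real) \<Rightarrow> 'g set \<Rightarrow> ('g tvec \<Rightarrow> real) \<Rightarrow>
   'm set topology" where
  "reduced_space G AG act \<mu> H \<alpha> = topology (\<lambda>\<U>.
     \<U> \<subseteq> sub_orbit G act H ` moment_level G AG \<mu> H \<alpha> \<and>
     openin (top_of_set (moment_level G AG \<mu> H \<alpha>))
       {x \<in> moment_level G AG \<mu> H \<alpha>. sub_orbit G act H x \<in> \<U>})"

lemma openin_reduced_space:
  "openin (reduced_space G AG act \<mu> H \<alpha>) \<U> \<longleftrightarrow>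
     \<U> \<subseteq> sub_orbit G act H ` moment_level G AG \<mu> H \<alpha> \<and>
     openin (top_of_set (moment_level G AG \<mu> H \<alpha>))
       {x \<in> moment_level G AG \<mu> H \<alpha>. sub_orbit G act H x \<in> \<U>}"
proof -
  define N where "N = moment_level G AG \<mu> H \<alpha>"
  define q where "q = sub_orbit G act H"
  have "istopology (\<lambda>\<U>. \<U> \<subseteq> q ` N \<and> openin (top_of_set N) {x \<in> N. q x \<in> \<U>})"
    unfolding istopology_def
  proof (intro conjI allI impI)
    fix S T
    assume a: "S \<subseteq> q ` N \<and> openin (top_of_set N) {x \<in> N. q x \<in> S}"
      and b: "T \<subseteq> q ` N \<and> openin (top_of_set N) {x \<in> N. q x \<in> T}"
    show "S \<inter> T \<subseteq> q ` N" using a by blast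
    have "{x \<in> N. q x \<in> S \<inter> T} = {x \<in> N. q x \<in> S} \<inter> {x \<in> N. q x \<in> T}" by blast
    then show "openin (top_of_set N) {x \<in> N. q x \<in> S \<inter> T}" using a b by auto
  next
    fix K
    assume a: "\<forall>S\<in>K. S \<subseteq> q ` N \<and> openin (top_of_set N) {x \<in> N. q x \<in> S}"
    show "\<Union>K \<subseteq> q ` N" using a by blast
    have "{x \<in> N. q x \<in> \<Union>K} = (\<Union>S\<in>K. {x \<in> N. q x \<in> S})" by blast
    then show "openin (top_of_set N) {x \<in> N. q x \<in> \<Union>K}" using a by auto
  qed
  then show ?thesis
    unfolding reduced_space_def N_def q_def by simp
qed

lemma topspace_reduced_space:
  "topspace (reduced_space G AG act \<mu> H \<alpha>) = sub_orbit G act H ` moment_level G AG \<mu> H \<alpha>"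
proof (rule antisym)
  show "topspace (reduced_space G AG act \<mu> H \<alpha>) \<subseteq> sub_orbit G act H ` moment_level G AG \<mu> H \<alpha>"
    using openin_topspace[of "reduced_space G AG act \<mu> H \<alpha>"] unfolding openin_reduced_space
    by blast
  have "{x \<in> moment_level G AG \<mu> H \<alpha>. sub_orbit G act H x \<in> sub_orbit G act H ` moment_level G AG \<mu> H \<alpha>}
      = moment_level G AG \<mu> H \<alpha>"
    by blast
  then have "openin (reduced_space G AG act \<mu> H \<alpha>) (sub_orbit G act H ` moment_level G AG \<mu> H \<alpha>)"
    unfolding openin_reduced_space by simp
  then show "sub_orbit G act H ` moment_level G AG \<mu> H \<alpha> \<subseteq> topspace (reduced_space G AG act \<mu> H \<alpha>)"
    by (rule openin_subset)
qed

text \<open>An \<open>H\<close>-invariant smooth function \<open>f\<close> on \<open>M\<close> represents the function \<open>a\<close> on the reduced space.\<close>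

definition represents ::
  "'g::topological_space monoid \<Rightarrow> ('g, 'e::real_normed_vector) atlas \<Rightarrow>
   ('m::topological_space, 'f::real_normed_vector) atlas \<Rightarrow> ('g \<Rightarrow> 'm \<Rightarrow> 'm) \<Rightarrow>
   ('m \<Rightarrow> 'g tvec \<Rightarrow> real) \<Rightarrow> 'g set \<Rightarrow> ('g tvec \<Rightarrow> real) \<Rightarrow> ('m \<Rightarrow> real) \<Rightarrow> ('m set \<Rightarrow> real) \<Rightarrow> bool" where
  "represents G AG AM act \<mu> H \<alpha> f a \<longleftrightarrow>
     f \<in> inv_functions AM act H \<and> (\<forall>x\<in>moment_level G AG \<mu> H \<alpha>. a (sub_orbit G act H x) = f x)"

definition reduced_functions ::
  "'g::topological_space monoid \<Rightarrow> ('g, 'e::real_normed_vector) atlas \<Rightarrow>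
   ('m::topological_space, 'f::real_normed_vector) atlas \<Rightarrow> ('g \<Rightarrow> 'm \<Rightarrow> 'm) \<Rightarrow>
   ('m \<Rightarrow> 'g tvec \<Rightarrow> real) \<Rightarrow> 'g set \<Rightarrow> ('g tvec \<Rightarrow> real) \<Rightarrow> ('m set \<Rightarrow> real) set" where
  "reduced_functions G AG AM act \<mu> H \<alpha> =
     {a \<in> extensional (topspace (reduced_space G AG act \<mu> H \<alpha>)).
        \<exists>f. represents G AG AM act \<mu> H \<alpha> f a}"

text \<open>The induced Poisson bracket: the function represented by \<open>{f, g}\<close> whenever \<open>f\<close> and \<open>g\<close>
  represent the two arguments. It does not depend on the choice of \<open>f\<close> and \<open>g\<close>, because the
  Hamiltonian flow of an \<open>H\<close>-invariant function preserves the level set.\<close>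

definition reduced_bracket ::
  "'g::topological_space monoid \<Rightarrow> ('g, 'e::real_normed_vector) atlas \<Rightarrow>
   ('m::topological_space, 'f::real_normed_vector) atlas \<Rightarrow> 'm two_form \<Rightarrow> ('g \<Rightarrow> 'm \<Rightarrow> 'm) \<Rightarrow>
   ('m \<Rightarrow> 'g tvec \<Rightarrow> real) \<Rightarrow> 'g set \<Rightarrow> ('g tvec \<Rightarrow> real) \<Rightarrow>
   ('m set \<Rightarrow> real) \<Rightarrow> ('m set \<Rightarrow> real) \<Rightarrow> ('m set \<Rightarrow> real)" where
  "reduced_bracket G AG AM \<omega> act \<mu> H \<alpha> a b =
     (THE c. c \<in> extensional (topspace (reduced_space G AG act \<mu> H \<alpha>)) \<and>
        (\<forall>f g. represents G AG AM act \<mu> H \<alpha> f a \<longrightarrow> represents G AG AM act \<mu> H \<alpha> g b \<longrightarrow>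
           represents G AG AM act \<mu> H \<alpha> (poisson AM \<omega> f g) c))"

text \<open>The complementary factor \<open>K\<close> commutes with \<open>H\<close>, so that it acts on the set of \<open>H\<close>-orbits by
  taking images.\<close>

definition reduced_inv_functions ::
  "'g::topological_space monoid \<Rightarrow> ('g, 'e::real_normed_vector) atlas \<Rightarrow>
   ('m::topological_space, 'f::real_normed_vector) atlas \<Rightarrow> ('g \<Rightarrow> 'm \<Rightarrow> 'm) \<Rightarrow>
   ('m \<Rightarrow> 'g tvec \<Rightarrow> real) \<Rightarrow> 'g set \<Rightarrow> ('g tvec \<Rightarrow> real) \<Rightarrow> 'g set \<Rightarrow> ('m set \<Rightarrow> real) set" where
  "reduced_inv_functions G AG AM act \<mu> H \<alpha> K =
     {a \<in> reduced_functions G AG AM act \<mu> H \<alpha>.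
        \<forall>k\<in>K. \<forall>P\<in>topspace (reduced_space G AG act \<mu> H \<alpha>). a (act k ` P) = a P}"

definition reduced_multiplicity_free ::
  "'g::topological_space monoid \<Rightarrow> ('g, 'e::real_normed_vector) atlas \<Rightarrow>
   ('m::topological_space, 'f::real_normed_vector) atlas \<Rightarrow> 'm two_form \<Rightarrow> ('g \<Rightarrow> 'm \<Rightarrow> 'm) \<Rightarrow>
   ('m \<Rightarrow> 'g tvec \<Rightarrow> real) \<Rightarrow> 'g set \<Rightarrow> ('g tvec \<Rightarrow> real) \<Rightarrow> 'g set \<Rightarrow> bool" where
  "reduced_multiplicity_free G AG AM \<omega> act \<mu> H \<alpha> K \<longleftrightarrow>
     (\<forall>a\<in>reduced_inv_functions G AG AM act \<mu> H \<alpha> K.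
      \<forall>b\<in>reduced_inv_functions G AG AM act \<mu> H \<alpha> K.
      \<forall>P\<in>topspace (reduced_space G AG act \<mu> H \<alpha>).
        reduced_bracket G AG AM \<omega> act \<mu> H \<alpha> a b P = 0)"

end

theory Submission
  imports Defs "Jordan_Normal_Form.Determinant"
begin

text \<open>Let \<open>f\<close> and \<open>g\<close> be \<open>G1\<close>-invariant functions whose restrictions to a level set \<open>N\<close> of the first
  component of the moment map are \<open>G2\<close>-invariant. At a point \<open>x\<close> of \<open>N\<close> the bracket \<open>{f, g}\<close> depends
  only on these restrictions: by Noether's theorem the Hamiltonian field of an invariant function
  annihilates the moment map, so that it is tangent to the level sets. Since the action is proper,
  averaging over \<open>G\<close> with a right-invariant functional turns a bump function \<open>\<theta>\<close> at \<open>x\<close> and the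
  product \<open>f \<theta>\<close> into smooth \<open>G\<close>-invariant functions \<open>E\<close> and \<open>A\<close>, and \<open>A = f E\<close> on \<open>N\<close>. Hence
  \<open>f E\<close>, \<open>g E\<close> and \<open>E\<close> Poisson-commute at \<open>x\<close> if \<open>M\<close> is multiplicity-free, and the Leibniz rule gives
  \<open>{f, g}(x) = 0\<close>. Conversely, a \<open>G\<close>-invariant function on \<open>M\<close> descends to a \<open>G2\<close>-invariant function on
  every reduced space, and every point of \<open>M\<close> lies in a level set.\<close>

section \<open>Finite-dimensional normed spaces\<close>

text \<open>A \<open>G2\<close>-invariant function on a reduced space is represented on M by a
  function that is \<open>G\<close>-invariant on N only. Multiplicity-freeness says nothing about
  such a function, and its averages over \<open>G\<close> need not agree with it even on N. The
  second average \<open>E\<close> repairs this: an orbit in N stays in N, f is constant on it, and f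
  leaves the average as a factor. The price is that \<open>E\<close> must be removed from the
  bracket. From {f E, E} = E {f, E} one gets {f, E} = 0 at x, likewise for g, and then {f E, g E} =
  E^2 {f, g} there. Since \<open>act g (act h y) = act (g h) y\<close>, invariance of an average
  calls for right invariance of the functional. Of this functional only linearity, right invariance,
  strict positivity and a sup bound on functions supported in a fixed compact set are used. Hence it
  is built directly from Haar's covering ratios, and no measure appears. The level sets of the
  moment map need not be submanifolds. Tangency of the Hamiltonian field must therefore yield actual
  points of the level set near the direction of the field.\<close>

text \<open>Tychonoff's theorem. It is applied to boxes of coordinate sequences, whose entries from
  \<open>n\<close> on are pinned to 0, and to the box of candidates for the invariant
  functional.\<close>

lemma compact_PiE_UNIV:
  fixes S :: "'a \<Rightarrow> 'b::topological_space set"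
  assumes "\<And>i. compact (S i)"
  shows "compact (PiE UNIV S)"
proof -
  have "compactin (product_topology (\<lambda>i. euclidean) UNIV) (PiE UNIV S)"
    using assms by (simp add: compactin_PiE)
  then show ?thesis by (simp add: euclidean_product_topology)
qed

text \<open>The model space of an atlas is a bare normed space with a finite spanning set. Fixing a
  basis \<open>b\<close> and its coordinate functionals \<open>c\<close> turns linear maps into
  finite sums over \<open>i < n\<close>.\<close>

locale findim =
  fixes b :: "nat \<Rightarrow> 'e::real_normed_vector" and n :: nat and c :: "nat \<Rightarrow> 'e \<Rightarrow> real"
  assumes expand: "(\<Sum>i<n. c i x *\<^sub>R b i) = x"
    and coord_bl: "bounded_linear (c i)"
    and dual: "i < n \<Longrightarrow> j < n \<Longrightarrow> c i (b j) = (if i = j then 1 else 0)"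

text \<open>The substance is boundedness of the coordinates. On the compact l1-sphere of coefficient
  vectors the norm of the resulting vector has a positive lower bound \<open>m\<close>; by scaling,
  \<open>m\<close> times the l1-norm of the coordinates is at most the norm.\<close>

lemma findim_exists:
  fixes B :: "'e::real_normed_vector set"
  assumes "finite B" "span B = UNIV"
  shows "\<exists>(b :: nat \<Rightarrow> 'e) n c. findim b n c"
proof -
  obtain B' where B': "B' \<subseteq> B" "independent B'" "B \<subseteq> span B'"
    using maximal_independent_subset by blast
  have fin: "finite B'" using B' assms finite_subset by blast
  have sp: "span B' = UNIV"
    using B'(3) assms(2) by (metis span_mono span_span top.extremum_unique)
  define n where "n = card B'"
  obtain b where b: "bij_betw b {..<n} B'"
    using ex_bij_betw_nat_finite[OF fin] by (auto simp: n_def atLeast0LessThan)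
  define c where "c i x = (if i < n then representation B' x (b i) else 0)" for i x
  have ex: "(\<Sum>i<n. c i x *\<^sub>R b i) = x" for x
  proof -
    have "(\<Sum>i<n. c i x *\<^sub>R b i) = (\<Sum>i<n. representation B' x (b i) *\<^sub>R b i)"
      by (simp add: c_def)
    also have "\<dots> = (\<Sum>v\<in>B'. representation B' x v *\<^sub>R v)"
      using sum.reindex_bij_betw[OF b, of "\<lambda>v. representation B' x v *\<^sub>R v"] by simp
    also have "\<dots> = x"
      by (rule real_vector.sum_representation_eq) (use B' sp fin in auto)
    finally show ?thesis .
  qed
  have lin: "linear (c i)" for i
    by (cases "i < n")
      (auto intro!: linearI simp: c_def real_vector.representation_add real_vector.representation_scale B' sp)
  have dual: "c i (b j) = (if i = j then 1 else 0)" if "i < n" "j < n" for i j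
  proof -
    have "b j \<in> B'" using b that by (auto simp: bij_betw_def)
    moreover have "b i = b j \<longleftrightarrow> i = j" using b that by (auto simp: bij_betw_def inj_on_def)
    ultimately show ?thesis using that B' by (auto simp: c_def real_vector.representation_basis)
  qed
  define T where "T a = (\<Sum>i<n. a i *\<^sub>R b i)" for a :: "nat \<Rightarrow> real"
  define S where "S = PiE UNIV (\<lambda>i. if i < n then {-1..1::real} else {0}) \<inter> {a. (\<Sum>i<n. \<bar>a i\<bar>) = 1}"
  have contp: "continuous_on A (\<lambda>a::nat \<Rightarrow> real. a i)" for A i
    by (rule continuous_on_subset[OF continuous_on_product_coordinates]) simp
  have "closed {a::nat \<Rightarrow> real. (\<Sum>i<n. \<bar>a i\<bar>) = 1}"
    by (intro closed_Collect_eq continuous_intros contp)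
  then have cS: "compact S"
    unfolding S_def by (intro compact_Int_closed compact_PiE_UNIV) auto
  have contT: "continuous_on S (\<lambda>a. norm (T a))"
    unfolding T_def by (intro continuous_intros contp)
  have Tc: "c j (T a) = a j" if "j < n" for a j
  proof -
    have "c j (T a) = (\<Sum>i<n. a i * c j (b i))"
      unfolding T_def using lin[of j] by (simp add: linear_sum linear_scale)
    also have "\<dots> = (\<Sum>i<n. if j = i then a i else 0)"
      using dual that by (intro sum.cong) auto
    finally show ?thesis using that by simp
  qed
  \<comment> \<open>\<open>S\<close> is empty exactly when \<open>n = 0\<close>, and then every
    positive \<open>m\<close> will do.\<close>
  obtain m where m: "m > 0" "\<And>a. a \<in> S \<Longrightarrow> m \<le> norm (T a)"
  proof (cases "S = {}")
    case True
    then show ?thesis using that[of 1] by auto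
  next
    case False
    obtain a where a: "a \<in> S" "\<And>a'. a' \<in> S \<Longrightarrow> norm (T a) \<le> norm (T a')"
      using continuous_attains_inf[OF cS False contT] by blast
    have "T a \<noteq> 0"
    proof
      assume "T a = 0"
      then have "a j = 0" if "j < n" for j using Tc[OF that, of a] lin[of j] by (simp add: linear_0)
      then show False using a(1) by (auto simp: S_def)
    qed
    then show ?thesis using that[of "norm (T a)"] a by auto
  qed
  have bd: "(\<Sum>i<n. \<bar>c i x\<bar>) * m \<le> norm x" for x
  proof (cases "(\<Sum>i<n. \<bar>c i x\<bar>) = 0")
    case False
    define s where "s = (\<Sum>i<n. \<bar>c i x\<bar>)"
    have "s \<ge> 0" unfolding s_def by (intro sum_nonneg) simp
    then have s: "s > 0" using False unfolding s_def by linarith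
    define a where "a i = c i x / s" for i
    have s1: "(\<Sum>i<n. \<bar>a i\<bar>) = 1"
      using s by (simp add: a_def abs_divide flip: sum_divide_distrib) (simp add: s_def)
    have "\<bar>a i\<bar> \<le> 1" if "i < n" for i
      using member_le_sum[of i "{..<n}" "\<lambda>i. \<bar>a i\<bar>"] s1 that by auto
    then have "-1 \<le> a i \<and> a i \<le> 1" if "i < n" for i
      using that by (simp add: abs_le_iff minus_le_iff)
    moreover have "a i = 0" if "\<not> i < n" for i using that by (simp add: a_def c_def)
    ultimately have "a \<in> S" using s1 by (simp add: S_def PiE_UNIV_domain)
    then have "m \<le> norm (T a)" by (rule m)
    also have "T a = (1 / s) *\<^sub>R (\<Sum>i<n. c i x *\<^sub>R b i)"
      unfolding T_def a_def scaleR_sum_right by simp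
    also have "\<dots> = (1 / s) *\<^sub>R x" using ex by simp
    finally show ?thesis using s by (simp add: field_simps flip: s_def)
  qed auto
  have "bounded_linear (c i)" for i
  proof (rule bounded_linear_intro[where K = "1 / m"])
    show "norm (c i x) \<le> norm x * (1 / m)" for x
    proof (cases "i < n")
      case True
      then have "\<bar>c i x\<bar> * m \<le> (\<Sum>i<n. \<bar>c i x\<bar>) * m"
        using m(1) by (intro mult_right_mono member_le_sum) auto
      then have "\<bar>c i x\<bar> * m \<le> norm x" using bd[of x] by simp
      then show ?thesis using m(1) by (simp add: field_simps)
    qed (use m in \<open>simp add: c_def\<close>)
  qed (use lin[of i] in \<open>simp_all add: linear_add linear_scale\<close>)
  then have "findim b n c"
    using ex dual by (intro findim.intro)
  then show ?thesis by blast
qed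

context findim
begin

lemma coord_le: "\<exists>K>0. \<forall>x. \<forall>i<n. \<bar>c i x\<bar> \<le> K * norm x"
proof -
  have "\<exists>K>0. \<forall>x. norm (c i x) \<le> norm x * K" for i
    using bounded_linear.pos_bounded[OF coord_bl] by auto
  then obtain K where K: "\<And>i. K i > 0" "\<And>i x. norm (c i x) \<le> norm x * K i" by metis
  have "\<bar>c i x\<bar> \<le> (1 + (\<Sum>i<n. K i)) * norm x" if "i < n" for i x
  proof -
    have "K i \<le> (\<Sum>i<n. K i)" using that K(1) by (intro member_le_sum) (auto intro: less_imp_le)
    then have "norm x * K i \<le> (1 + (\<Sum>i<n. K i)) * norm x"
      by (subst mult.commute, intro mult_right_mono) auto
    then show ?thesis using K(2)[of i x] by simp
  qed
  moreover have "1 + (\<Sum>i<n. K i) > 0"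
    using K(1) by (intro add_pos_nonneg sum_nonneg) (auto intro: less_imp_le)
  ultimately show ?thesis by blast
qed

lemma coord_linear: "linear (c i)"
  using coord_bl bounded_linear.linear by blast

lemma linear_imp_bounded_linear:
  fixes f :: "'e \<Rightarrow> 'b::real_normed_vector"
  assumes "linear f"
  shows "bounded_linear f"
proof -
  have *: "f (\<Sum>i<n. c i x *\<^sub>R b i) = (\<Sum>i<n. c i x *\<^sub>R f (b i))" for x
    using assms by (simp add: linear_sum linear_scale)
  have fe: "f = (\<lambda>x. \<Sum>i<n. c i x *\<^sub>R f (b i))"
    using *[unfolded expand] by (rule ext)
  moreover have "bounded_linear (\<lambda>x. \<Sum>i<n. c i x *\<^sub>R f (b i))"
    by (intro bounded_linear_sum bounded_linear_compose[OF bounded_linear_scaleR_left coord_bl])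
  ultimately show ?thesis by (subst fe)
qed

text \<open>A closed ball is a closed subset of the compact image of a coordinate box. Compact
  supports of bumps, uniform continuity in charts and cluster points of Euler polygons all rest on
  this.\<close>

lemma compact_cball: "compact (cball (p::'e) r)"
proof -
  obtain K where K: "K > 0" "\<And>x i. i < n \<Longrightarrow> \<bar>c i x\<bar> \<le> K * norm x" using coord_le by blast
  define T where "T a = p + (\<Sum>i<n. a i *\<^sub>R b i)" for a :: "nat \<Rightarrow> real"
  define S where "S = PiE UNIV (\<lambda>i. if i < n then {-(K * r)..K * r} else {0})"
  have "compact S" unfolding S_def by (intro compact_PiE_UNIV) auto
  moreover have "continuous_on S T"
    unfolding T_def
    by (intro continuous_intros continuous_on_subset[OF continuous_on_product_coordinates]) auto
  ultimately have "compact (T ` S)" by (rule compact_continuous_image[rotated])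
  moreover have "cball p r \<subseteq> T ` S"
  proof
    fix x assume x: "x \<in> cball p r"
    define a where "a i = (if i < n then c i (x - p) else 0)" for i
    have "T a = x" unfolding T_def a_def using expand[of "x - p"] by simp
    moreover have "\<bar>a i\<bar> \<le> K * r" if "i < n" for i
    proof -
      have "\<bar>a i\<bar> \<le> K * norm (x - p)" using K(2)[OF that] that by (simp add: a_def)
      also have "\<dots> \<le> K * r" using x K(1) by (simp add: dist_norm norm_minus_commute)
      finally show ?thesis .
    qed
    then have "a \<in> S"
      by (auto simp: S_def PiE_UNIV_domain a_def abs_le_iff minus_le_iff)
    ultimately show "x \<in> T ` S" by blast
  qed
  ultimately show ?thesis
    using compact_Int_closed[OF _ closed_cball, of "T ` S" p r] by (simp add: inf.absorb2)
qed

end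

section \<open>Calculus of smooth functions\<close>

text \<open>Exchanging a known derivative \<open>f'\<close> for \<open>frechet_derivative f\<close>
  inside \<open>C_k k\<close> is itself a congruence. It is a premise here because
  \<open>C_k_cong\<close> is proved by induction with this very rule; \<open>C_k_SucI'\<close>
  discharges it afterwards.\<close>

lemma C_k_SucI:
  fixes f :: "'a::real_normed_vector \<Rightarrow> 'b::real_normed_vector"
  assumes S: "open S" and f': "\<And>x. x \<in> S \<Longrightarrow> (f has_derivative f' x) (at x)"
    and C: "\<And>v. C_k k S (\<lambda>x. f' x v)"
    and cong: "\<And>g h :: 'a::real_normed_vector \<Rightarrow> 'b::real_normed_vector. (\<And>x. x \<in> S \<Longrightarrow> g x = h x) \<Longrightarrow> C_k k S g \<Longrightarrow> C_k k S h"
  shows "C_k (Suc k) S f"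
proof -
  have "C_k k S (\<lambda>x. frechet_derivative f (at x) v)" for v
    by (rule cong[where g = "\<lambda>x. f' x v"]) (simp_all add: C frechet_derivative_at[OF f', symmetric])
  then show ?thesis using f' by (auto simp: differentiable_def)
qed

lemma C_k_cong:
  assumes "open S" "\<And>x. x \<in> S \<Longrightarrow> f x = g x" "C_k k S f"
  shows "C_k k S g"
  using assms(2,3)
proof (induction k arbitrary: f g)
  case 0
  then show ?case by (simp cong: continuous_on_cong)
next
  case (Suc k)
  have d: "(g has_derivative frechet_derivative f (at x)) (at x)" if "x \<in> S" for x
  proof -
    have "(f has_derivative frechet_derivative f (at x)) (at x)"
      using Suc.prems(2) that by (simp add: frechet_derivative_works)
    then show ?thesis
      by (rule has_derivative_transform_within_open[OF _ assms(1) that]) (simp add: Suc.prems(1))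
  qed
  show ?case
    by (rule C_k_SucI[OF assms(1) d]) (use Suc in auto)
qed

lemmas C_k_SucI' = C_k_SucI[OF _ _ _ C_k_cong]

lemma C_k_subset: "T \<subseteq> S \<Longrightarrow> C_k k S f \<Longrightarrow> C_k k T f"
  by (induction k arbitrary: f) (auto intro: continuous_on_subset)

lemma C_k_SucD: "C_k (Suc k) S f \<Longrightarrow> C_k k S f"
proof (induction k arbitrary: f)
  case 0
  then show ?case
    by (auto intro!: continuous_at_imp_continuous_on differentiable_imp_continuous_within)
next
  case (Suc k)
  have "C_k (Suc k) S (\<lambda>x. frechet_derivative f (at x) v)" for v
    using Suc.prems unfolding C_k.simps(2)[of "Suc k"] by blast
  with Suc show ?case by simp
qed

lemma C_k_continuous: "C_k k S f \<Longrightarrow> continuous_on S f"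
proof (induction k)
  case (Suc k)
  then show ?case using C_k_SucD by blast
qed simp

lemma C_k_differentiable: "C_k (Suc k) S f \<Longrightarrow> x \<in> S \<Longrightarrow> f differentiable (at x)"
  by simp

lemma C_k_deriv: "C_k (Suc k) S f \<Longrightarrow> C_k k S (\<lambda>x. frechet_derivative f (at x) v)"
  by simp

lemma C_k_local:
  assumes "\<And>x. x \<in> S \<Longrightarrow> \<exists>T. open T \<and> x \<in> T \<and> C_k k T f"
  shows "C_k k S f"
  using assms
proof (induction k arbitrary: f)
  case 0
  have "isCont f x" if "x \<in> S" for x
    using 0[OF that] by (auto simp: continuous_on_eq_continuous_at)
  then show ?case by (auto intro: continuous_at_imp_continuous_on)
next
  case (Suc k)
  have "f differentiable (at x)" if "x \<in> S" for x
    using Suc.prems[OF that] by auto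
  moreover have "C_k k S (\<lambda>x. frechet_derivative f (at x) v)" for v
  proof (rule Suc.IH)
    show "\<exists>T. open T \<and> x \<in> T \<and> C_k k T (\<lambda>x. frechet_derivative f (at x) v)" if "x \<in> S" for x
      using Suc.prems[OF that] by auto
  qed
  ultimately show ?case by simp
qed

lemma C_k_const: "C_k k S (\<lambda>x. a)"
  by (induction k arbitrary: a) (auto simp: frechet_derivative_const)

lemma C_k_bounded_linear_compose:
  assumes "open S" "bounded_linear L" "C_k k S f"
  shows "C_k k S (\<lambda>x. L (f x))"
  using assms(3)
proof (induction k arbitrary: f)
  case 0
  then show ?case using assms(2) by (simp add: bounded_linear.continuous_on)
next
  case (Suc k)
  show ?case
  proof (rule C_k_SucI'[OF assms(1)])
    show "((\<lambda>x. L (f x)) has_derivative (\<lambda>v. L (frechet_derivative f (at x) v))) (at x)" if "x \<in> S" for x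
      using Suc.prems that
      by (intro bounded_linear.has_derivative[OF assms(2)]) (simp add: frechet_derivative_works)
    show "C_k k S (\<lambda>x. L (frechet_derivative f (at x) v))" for v
      using Suc by simp
  qed (rule assms(1))
qed

lemma C_k_add:
  assumes "open S" "C_k k S f" "C_k k S g"
  shows "C_k k S (\<lambda>x. f x + g x)"
  using assms(2,3)
proof (induction k arbitrary: f g)
  case 0
  then show ?case by (simp add: continuous_on_add)
next
  case (Suc k)
  show ?case
  proof (rule C_k_SucI'[OF assms(1)])
    show "((\<lambda>x. f x + g x) has_derivative
       (\<lambda>v. frechet_derivative f (at x) v + frechet_derivative g (at x) v)) (at x)" if "x \<in> S" for x
      using Suc.prems that
      by (intro has_derivative_add) (simp_all add: frechet_derivative_works)
    show "C_k k S (\<lambda>x. frechet_derivative f (at x) v + frechet_derivative g (at x) v)" for v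
      using Suc by simp
  qed (rule assms(1))
qed

lemma C_k_scaleR:
  assumes "open S" "C_k k S u" "C_k k S g"
  shows "C_k k S (\<lambda>x. u x *\<^sub>R g x)"
  using assms(2,3)
proof (induction k arbitrary: u g)
  case 0
  then show ?case by (simp add: continuous_on_scaleR)
next
  case (Suc k)
  show ?case
  proof (rule C_k_SucI'[OF assms(1)])
    show "((\<lambda>x. u x *\<^sub>R g x) has_derivative
       (\<lambda>v. u x *\<^sub>R frechet_derivative g (at x) v + frechet_derivative u (at x) v *\<^sub>R g x)) (at x)"
      if "x \<in> S" for x
      using Suc.prems that
      by (intro has_derivative_scaleR) (simp_all add: frechet_derivative_works)
    show "C_k k S (\<lambda>x. u x *\<^sub>R frechet_derivative g (at x) v + frechet_derivative u (at x) v *\<^sub>R g x)" for v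
      using Suc C_k_SucD[OF Suc.prems(1)] C_k_SucD[OF Suc.prems(2)]
      by (intro C_k_add[OF assms(1)] Suc.IH) auto
  qed (rule assms(1))
qed

lemma C_k_mult:
  fixes u g :: "'a::real_normed_vector \<Rightarrow> real"
  shows "open S \<Longrightarrow> C_k k S u \<Longrightarrow> C_k k S g \<Longrightarrow> C_k k S (\<lambda>x. u x * g x)"
  using C_k_scaleR[of S k u g] by simp

lemma C_k_sum:
  assumes "open S" "\<And>i. i \<in> I \<Longrightarrow> C_k k S (f i)"
  shows "C_k k S (\<lambda>x. \<Sum>i\<in>I. f i x)"
  using assms(2)
  by (induction I rule: infinite_finite_induct) (auto intro: C_k_const C_k_add[OF assms(1)])

lemma C_k_inverse:
  fixes u :: "'a::real_normed_vector \<Rightarrow> real"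
  assumes "open S" "C_k k S u" "\<And>x. x \<in> S \<Longrightarrow> u x \<noteq> 0"
  shows "C_k k S (\<lambda>x. inverse (u x))"
  using assms(2)
proof (induction k)
  case 0
  then show ?case using assms by (auto intro!: continuous_intros)
next
  case (Suc k)
  show ?case
  proof (rule C_k_SucI'[OF assms(1)])
    show "((\<lambda>x. inverse (u x)) has_derivative
       (\<lambda>v. - (inverse (u x) * frechet_derivative u (at x) v * inverse (u x)))) (at x)"
      if "x \<in> S" for x
      using Suc.prems that assms(3)
      by (intro Deriv.has_derivative_inverse) (simp_all add: frechet_derivative_works)
    have "C_k k S (\<lambda>x. - 1 * (inverse (u x) * frechet_derivative u (at x) v * inverse (u x)))" for v
      using Suc C_k_SucD[OF Suc.prems]
      by (intro C_k_mult[OF assms(1)] C_k_const) auto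
    then show "C_k k S (\<lambda>x. - (inverse (u x) * frechet_derivative u (at x) v * inverse (u x)))" for v
      by simp
  qed (rule assms(1))
qed

text \<open>The inner derivative is the constant map \<open>L\<close>, so each derivative is again a
  composition with the same affine map, along the fixed direction \<open>L v\<close>. This works in
  every normed space.\<close>

lemma C_k_affine:
  assumes "open S" "open T" "bounded_linear L" "\<And>x. x \<in> T \<Longrightarrow> L x + a \<in> S" "C_k k S f"
  shows "C_k k T (\<lambda>x. f (L x + a))"
  using assms(5)
proof (induction k arbitrary: f)
  case 0
  have "continuous_on T (\<lambda>x. L x + a)"
    by (intro continuous_intros linear_continuous_on assms(3))
  then show ?case
    using 0 assms(4) by (auto intro: continuous_on_compose2)
next
  case (Suc k)
  show ?case
  proof (rule C_k_SucI'[OF assms(2)])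
    show "((\<lambda>x. f (L x + a)) has_derivative (\<lambda>v. frechet_derivative f (at (L x + a)) (L v))) (at x)"
      if "x \<in> T" for x
    proof -
      have "((\<lambda>x. L x + a) has_derivative L) (at x)"
        using bounded_linear_imp_has_derivative[OF assms(3)] has_derivative_add_const by blast
      moreover have "(f has_derivative frechet_derivative f (at (L x + a))) (at (L x + a))"
        using Suc.prems that assms(4) by (simp add: frechet_derivative_works)
      ultimately show ?thesis
        by (rule has_derivative_compose)
    qed
    show "C_k k T (\<lambda>x. frechet_derivative f (at (L x + a)) (L v))" for v
      using Suc.IH[of "\<lambda>x. frechet_derivative f (at x) (L v)"] Suc.prems by simp
  qed (rule assms(2))
qed

text \<open>\<open>C_k\<close> differentiates along fixed directions, but the chain rule evaluates
  the derivative of \<open>f\<close> along a direction that varies with \<open>x\<close>. Expanding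
  this direction in the basis gives products of \<open>C_k\<close> functions with derivatives of
  \<open>f\<close> along the fixed \<open>b i\<close>.\<close>

lemma (in findim) C_k_compose:
  fixes g :: "'a::real_normed_vector \<Rightarrow> 'e"
  assumes "open S" "open T" "C_k k S g" "g ` S \<subseteq> T" "C_k k T f"
  shows "C_k k S (\<lambda>x. f (g x))"
  using assms(3,5)
proof (induction k arbitrary: f)
  case 0
  then show ?case using assms(4) by (auto intro: continuous_on_compose2)
next
  case (Suc k)
  let ?D = "\<lambda>x v. \<Sum>i<n. c i (frechet_derivative g (at x) v) *\<^sub>R frechet_derivative f (at (g x)) (b i)"
  show ?case
  proof (rule C_k_SucI'[OF assms(1)])
    show "((\<lambda>x. f (g x)) has_derivative ?D x) (at x)" if "x \<in> S" for x
    proof -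
      have g: "(g has_derivative frechet_derivative g (at x)) (at x)"
        using Suc.prems that by (simp add: frechet_derivative_works)
      have f: "(f has_derivative frechet_derivative f (at (g x))) (at (g x))"
        using Suc.prems that assms(4) by (auto simp: frechet_derivative_works[symmetric])
      have Dw: "frechet_derivative f (at (g x)) w = (\<Sum>i<n. c i w *\<^sub>R frechet_derivative f (at (g x)) (b i))" for w
      proof -
        have "linear (frechet_derivative f (at (g x)))"
          using f has_derivative_bounded_linear bounded_linear.linear by blast
        then have "frechet_derivative f (at (g x)) (\<Sum>i<n. c i w *\<^sub>R b i)
            = (\<Sum>i<n. c i w *\<^sub>R frechet_derivative f (at (g x)) (b i))"
          by (simp add: linear_sum linear_scale)
        then show ?thesis by (simp only: expand)
      qed
      have "?D x = (\<lambda>v. frechet_derivative f (at (g x)) (frechet_derivative g (at x) v))"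
        by (intro ext Dw[symmetric])
      then show ?thesis using has_derivative_compose[OF g f] by simp
    qed
    show "C_k k S (\<lambda>x. ?D x v)" for v
    proof (intro C_k_sum[OF assms(1)] C_k_scaleR[OF assms(1)])
      show "C_k k S (\<lambda>x. c i (frechet_derivative g (at x) v))" for i
        using Suc.prems by (intro C_k_bounded_linear_compose[OF assms(1) coord_bl]) simp
      show "C_k k S (\<lambda>x. frechet_derivative f (at (g x)) (b i))" for i
        using Suc.prems C_k_SucD[OF Suc.prems(1)] by (intro Suc.IH) auto
    qed
  qed (rule assms(1))
qed

interpretation real_findim: findim "\<lambda>_. 1::real" 1 "\<lambda>_ x. x"
  by (rule findim.intro) (auto simp: bounded_linear_ident)

lemma smooth_onI: "(\<And>k. C_k k S f) \<Longrightarrow> smooth_on S f"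
  by (simp add: smooth_on_def)

lemma smooth_on_imp_continuous_on: "smooth_on S f \<Longrightarrow> continuous_on S f"
  by (metis C_k.simps(1) smooth_on_def)

lemma smooth_on_imp_differentiable: "smooth_on S f \<Longrightarrow> x \<in> S \<Longrightarrow> f differentiable (at x)"
  by (meson C_k_differentiable smooth_on_def)

lemma smooth_on_frechet_derivative:
  "smooth_on S f \<Longrightarrow> smooth_on S (\<lambda>x. frechet_derivative f (at x) v)"
  unfolding smooth_on_def by (intro allI C_k_deriv) blast

lemma smooth_on_has_derivative:
  "smooth_on S f \<Longrightarrow> x \<in> S \<Longrightarrow> (f has_derivative frechet_derivative f (at x)) (at x)"
  using smooth_on_imp_differentiable frechet_derivative_works by blast

lemma smooth_on_cong:
  "open S \<Longrightarrow> (\<And>x. x \<in> S \<Longrightarrow> f x = g x) \<Longrightarrow> smooth_on S f \<Longrightarrow> smooth_on S g"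
  unfolding smooth_on_def using C_k_cong[of S f g] by blast

lemma smooth_on_subset: "T \<subseteq> S \<Longrightarrow> smooth_on S f \<Longrightarrow> smooth_on T f"
  unfolding smooth_on_def using C_k_subset by blast

lemma smooth_on_local:
  assumes "\<And>x. x \<in> S \<Longrightarrow> \<exists>T. open T \<and> x \<in> T \<and> smooth_on T f"
  shows "smooth_on S f"
  unfolding smooth_on_def
proof (intro allI C_k_local)
  fix k x assume "x \<in> S"
  then show "\<exists>T. open T \<and> x \<in> T \<and> C_k k T f"
    using assms unfolding smooth_on_def by blast
qed

lemma smooth_on_const: "smooth_on S (\<lambda>x. a)"
  by (simp add: smooth_on_def C_k_const)

lemma smooth_on_add:
  "open S \<Longrightarrow> smooth_on S f \<Longrightarrow> smooth_on S g \<Longrightarrow> smooth_on S (\<lambda>x. f x + g x)"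
  by (simp add: smooth_on_def C_k_add)

lemma smooth_on_mult:
  fixes u g :: "'a::real_normed_vector \<Rightarrow> real"
  shows "open S \<Longrightarrow> smooth_on S u \<Longrightarrow> smooth_on S g \<Longrightarrow> smooth_on S (\<lambda>x. u x * g x)"
  by (simp add: smooth_on_def C_k_mult)

lemma smooth_on_sum:
  "open S \<Longrightarrow> (\<And>i. i \<in> I \<Longrightarrow> smooth_on S (f i)) \<Longrightarrow> smooth_on S (\<lambda>x. \<Sum>i\<in>I. f i x)"
  by (simp add: smooth_on_def C_k_sum)

lemma smooth_on_inverse:
  fixes u :: "'a::real_normed_vector \<Rightarrow> real"
  shows "open S \<Longrightarrow> smooth_on S u \<Longrightarrow> (\<And>x. x \<in> S \<Longrightarrow> u x \<noteq> 0) \<Longrightarrow> smooth_on S (\<lambda>x. inverse (u x))"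
  by (simp add: smooth_on_def C_k_inverse)

lemma smooth_on_affine:
  "open S \<Longrightarrow> open T \<Longrightarrow> bounded_linear L \<Longrightarrow> (\<And>x. x \<in> T \<Longrightarrow> L x + a \<in> S) \<Longrightarrow> smooth_on S f
    \<Longrightarrow> smooth_on T (\<lambda>x. f (L x + a))"
  by (simp add: smooth_on_def C_k_affine)

lemma smooth_on_bounded_linear: "bounded_linear L \<Longrightarrow> open S \<Longrightarrow> smooth_on S L"
proof (rule smooth_onI)
  fix k assume "bounded_linear L" "open S"
  then show "C_k k S L"
  proof (cases k)
    case (Suc j)
    show ?thesis unfolding Suc
      by (rule C_k_SucI'[OF \<open>open S\<close> bounded_linear_imp_has_derivative[OF \<open>bounded_linear L\<close>]])
        (auto intro: C_k_const \<open>open S\<close>)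
  qed (simp add: linear_continuous_on)
qed

lemma (in findim) smooth_on_compose:
  fixes g :: "'a::real_normed_vector \<Rightarrow> 'e"
  shows "open S \<Longrightarrow> open T \<Longrightarrow> smooth_on S g \<Longrightarrow> g ` S \<subseteq> T \<Longrightarrow> smooth_on T f
    \<Longrightarrow> smooth_on S (\<lambda>x. f (g x))"
  by (simp add: smooth_on_def C_k_compose)

section \<open>The flat exponential and bump functions in coordinates\<close>

definition flat_exp :: "real \<Rightarrow> real" where
  "flat_exp t = (if t > 0 then exp (- inverse t) else 0)"

text \<open>This family is closed under differentiation, which makes \<open>flat_exp\<close> smooth
  by induction: the derivative of \<open>p (1/t) exp (-1/t)\<close> is
  \<open>(p - p') (1/t) / t^2\<close> times the exponential, and \<open>[:0, 0, 1:]\<close> is the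
  square of the variable. For \<open>t <= 0\<close> the formula gives 0 because of the factor
  \<open>flat_exp t\<close>.\<close>

lemma poly_flat_exp_has_derivative:
  "((\<lambda>t. poly p (inverse t) * flat_exp t) has_real_derivative
     poly ((p - pderiv p) * [:0, 0, 1:]) (inverse t) * flat_exp t) (at t)"
proof -
  consider "t > 0" | "t < 0" | "t = 0" by linarith
  then show ?thesis
  proof cases
    case 1
    have "((\<lambda>t. poly p (inverse t) * exp (- inverse t)) has_real_derivative
       poly ((p - pderiv p) * [:0, 0, 1:]) (inverse t) * exp (- inverse t)) (at t)"
      using 1 by (auto intro!: derivative_eq_intros poly_DERIV simp: algebra_simps power2_eq_square)
    then have "((\<lambda>t. poly p (inverse t) * flat_exp t) has_real_derivative
       poly ((p - pderiv p) * [:0, 0, 1:]) (inverse t) * exp (- inverse t)) (at t)"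
      by (rule has_field_derivative_transform_within_open[where S = "{0<..}"])
        (use 1 in \<open>auto simp: flat_exp_def\<close>)
    then show ?thesis using 1 by (simp add: flat_exp_def)
  next
    case 2
    have "((\<lambda>t. poly p (inverse t) * flat_exp t) has_real_derivative 0) (at t)"
      by (rule has_field_derivative_transform_within_open[where S = "{..<0}" and f = "\<lambda>_. 0"])
        (use 2 in \<open>auto simp: flat_exp_def\<close>)
    then show ?thesis using 2 by (simp add: flat_exp_def)
  next
    case 3
    \<comment> \<open>The factor \<open>inverse t\<close> comes from the difference quotient at 0.
      With \<open>s = 1/t\<close> the claim is that polynomials grow more slowly than
      \<open>exp s\<close>.\<close>
    have r: "((\<lambda>t. poly p (inverse t) * inverse t * exp (- inverse t)) \<longlongrightarrow> 0) (at_right 0)"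
    proof -
      have "((\<lambda>s. poly p s * s * exp (- s)) \<longlongrightarrow> 0) at_top"
      proof -
        have "((\<lambda>s. \<Sum>i\<le>degree p. coeff p i * (s ^ Suc i / exp s)) \<longlongrightarrow> (\<Sum>i\<le>degree p. coeff p i * 0)) at_top"
          by (intro tendsto_sum tendsto_mult tendsto_const tendsto_power_div_exp_0)
        moreover have "(\<Sum>i\<le>degree p. coeff p i * (s ^ Suc i / exp s)) = poly p s * s * exp (- s)" for s :: real
          unfolding poly_altdef sum_distrib_right
          by (intro sum.cong) (auto simp: exp_minus field_simps)
        ultimately show ?thesis by simp
      qed
      then show ?thesis
        using filterlim_inverse_at_top_right by (rule filterlim_compose)
    qed
    have l: "((\<lambda>h. poly p (inverse h) * flat_exp h / h) \<longlongrightarrow> 0) (at_left 0)"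
      by (rule tendsto_eventually)
        (auto simp: eventually_at_left[of "-1"] flat_exp_def intro: exI[of _ "-1"])
    have "((\<lambda>h. poly p (inverse h) * flat_exp h / h) \<longlongrightarrow> 0) (at_right 0)"
    proof (rule Lim_transform_eventually[OF r])
      show "\<forall>\<^sub>F x in at_right 0. poly p (inverse x) * inverse x * exp (- inverse x) = poly p (inverse x) * flat_exp x / x"
        by (auto simp: eventually_at_right[of 0 1] flat_exp_def field_simps intro: exI[of _ 1])
    qed
    with l have "((\<lambda>h. poly p (inverse h) * flat_exp h / h) \<longlongrightarrow> 0) (at 0)"
      by (rule filterlim_split_at)
    then show ?thesis
      unfolding has_field_derivative_def 3
      by (simp add: DERIV_def[unfolded has_field_derivative_def] flat_exp_def cong: if_cong)
  qed
qed

lemma smooth_on_flat_exp: "open S \<Longrightarrow> smooth_on S flat_exp"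
proof (rule smooth_onI)
  fix k assume S: "open S"
  have "C_k k S (\<lambda>t. poly p (inverse t) * flat_exp t)" for p
  proof (induction k arbitrary: p)
    case 0
    have "isCont (\<lambda>t. poly p (inverse t) * flat_exp t) t" for t
      using poly_flat_exp_has_derivative DERIV_isCont by blast
    then show ?case by (simp add: continuous_at_imp_continuous_on)
  next
    case (Suc k)
    show ?case
    proof (rule C_k_SucI'[OF S])
      show "((\<lambda>t. poly p (inverse t) * flat_exp t) has_derivative
         (\<lambda>v. poly ((p - pderiv p) * [:0, 0, 1:]) (inverse t) * flat_exp t * v)) (at t)" for t
        using poly_flat_exp_has_derivative[of p t] by (simp only: has_field_derivative_def)
      show "C_k k S (\<lambda>t. poly ((p - pderiv p) * [:0, 0, 1:]) (inverse t) * flat_exp t * v)" for v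
        by (intro C_k_mult[OF S _ C_k_const] Suc.IH)
    qed (rule S)
  qed
  from this[of 1] show "C_k k S flat_exp" by simp
qed

lemma flat_exp_nonneg: "flat_exp t \<ge> 0" by (simp add: flat_exp_def)

lemma flat_exp_pos_iff: "flat_exp t > 0 \<longleftrightarrow> t > 0" by (simp add: flat_exp_def)

context findim
begin

text \<open>The sum of squared coordinates replaces the norm of the model space, which need not be
  differentiable away from 0.\<close>

definition bump :: "'e \<Rightarrow> real \<Rightarrow> 'e \<Rightarrow> real" where
  "bump p r x = flat_exp (r\<^sup>2 - (\<Sum>i<n. (c i (x - p))\<^sup>2))"

lemma coord_smooth: "open S \<Longrightarrow> smooth_on S (\<lambda>x. c i (x - p))"
  using smooth_on_affine[of UNIV S "c i" "- c i p" id] coord_bl[of i] smooth_on_bounded_linear[of id UNIV]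
  by (simp add: bounded_linear_ident id_def linear_diff[OF coord_linear])

lemma bump_smooth: "open S \<Longrightarrow> smooth_on S (bump p r)"
proof -
  assume S: "open S"
  have q: "smooth_on S (\<lambda>x. r\<^sup>2 + (- 1) * (\<Sum>i<n. c i (x - p) * c i (x - p)))"
    by (intro smooth_on_add[OF S] smooth_on_const smooth_on_mult[OF S] smooth_on_sum[OF S] coord_smooth S)
  have "smooth_on S (\<lambda>x. flat_exp (r\<^sup>2 + (- 1) * (\<Sum>i<n. c i (x - p) * c i (x - p))))"
    by (rule real_findim.smooth_on_compose[OF S open_UNIV q _ smooth_on_flat_exp]) auto
  moreover have "bump p r = (\<lambda>x. flat_exp (r\<^sup>2 + (- 1) * (\<Sum>i<n. c i (x - p) * c i (x - p))))"
    by (rule ext) (simp add: bump_def power2_eq_square)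
  ultimately show ?thesis by simp
qed

lemma bump_nonneg: "bump p r x \<ge> 0"
  by (simp add: bump_def flat_exp_nonneg)

lemma bump_pos: "r > 0 \<Longrightarrow> bump p r p > 0"
  by (simp add: bump_def flat_exp_pos_iff linear_0[OF coord_linear])

text \<open>In coordinates the bump lives on a Euclidean ball, and \<open>K\<close> compares it with
  balls of the given norm. One \<open>K\<close> serves all centres and radii, so that
  \<open>bump_in_open\<close> can take \<open>r = s / K\<close>.\<close>

lemma bump_support: "\<exists>K>0. \<forall>p r x. r \<ge> 0 \<longrightarrow> bump p r x \<noteq> 0 \<longrightarrow> norm (x - p) \<le> K * r"
proof -
  define K where "K = 1 + (\<Sum>i<n. norm (b i))"
  have "norm (x - p) \<le> K * r" if r: "r \<ge> 0" and nz: "bump p r x \<noteq> 0" for p r x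
  proof -
    have lt: "(\<Sum>i<n. (c i (x - p))\<^sup>2) < r\<^sup>2"
      using nz by (auto simp: bump_def flat_exp_def split: if_splits)
    have ci: "\<bar>c i (x - p)\<bar> \<le> r" if "i < n" for i
    proof -
      have "(c i (x - p))\<^sup>2 \<le> (\<Sum>i<n. (c i (x - p))\<^sup>2)"
        using that by (intro member_le_sum) auto
      then show ?thesis using lt r abs_le_square_iff[of "c i (x - p)" r] by linarith
    qed
    have "norm (x - p) = norm (\<Sum>i<n. c i (x - p) *\<^sub>R b i)" by (simp only: expand)
    also have "\<dots> \<le> (\<Sum>i<n. \<bar>c i (x - p)\<bar> * norm (b i))"
      by (rule order_trans[OF norm_sum]) simp
    also have "\<dots> \<le> (\<Sum>i<n. r * norm (b i))"
      using ci by (intro sum_mono mult_right_mono) auto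
    also have "\<dots> = r * (\<Sum>i<n. norm (b i))" by (simp add: sum_distrib_left)
    also have "\<dots> \<le> K * r" using r by (simp add: K_def algebra_simps)
    finally show ?thesis .
  qed
  moreover have "K > 0" unfolding K_def by (intro add_pos_nonneg sum_nonneg) auto
  ultimately show ?thesis by blast
qed

lemma bump_in_open:
  assumes "open V" "p \<in> V"
  obtains r s where "r > 0" "cball p s \<subseteq> V" "\<And>x. x \<notin> cball p s \<Longrightarrow> bump p r x = 0"
proof -
  obtain s where s: "s > 0" "cball p s \<subseteq> V" using assms open_contains_cball by blast
  obtain K where K: "K > 0" "\<And>p r x. r \<ge> 0 \<Longrightarrow> bump p r x \<noteq> 0 \<Longrightarrow> norm (x - p) \<le> K * r"
    using bump_support by blast
  have "bump p (s / K) x = 0" if "x \<notin> cball p s" for x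
    using K(2)[of "s / K" p x] K(1) s(1) that by (auto simp: dist_norm norm_minus_commute)
  then show ?thesis using that[of "s / K" s] K s by simp
qed

end

section \<open>Smooth dependence on parameters and Hadamard's lemma\<close>

text \<open>Common ground for two functionals under which one differentiates: the integral over the
  unit interval in Hadamard's lemma, and the invariant functional on functions supported in a fixed
  compact part of the group. \<open>W\<close> singles out the functions on which \<open>I\<close> is
  linear and bounded.\<close>

locale compact_functional =
  fixes K :: "'t::topological_space set" and W :: "('t \<Rightarrow> real) \<Rightarrow> bool"
    and I :: "('t \<Rightarrow> real) \<Rightarrow> real" and M :: real
  assumes K_compact: "compact K"
    and W_lincomb: "W f \<Longrightarrow> W g \<Longrightarrow> W (\<lambda>t. r * f t + s * g t)"
    and I_lincomb: "W f \<Longrightarrow> W g \<Longrightarrow> I (\<lambda>t. r * f t + s * g t) = r * I f + s * I g"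
    and M_nonneg: "M \<ge> 0"
    and I_bound: "W f \<Longrightarrow> (\<And>t. t \<in> K \<Longrightarrow> \<bar>f t\<bar> \<le> B) \<Longrightarrow> \<bar>I f\<bar> \<le> M * B"
begin

text \<open>The parameter \<open>t\<close> carries only a topology. Each derivative in
  \<open>x\<close> is therefore required to be jointly continuous on \<open>K \<times> S\<close> and
  admissible in \<open>t\<close>.\<close>

primrec param_C_k :: "nat \<Rightarrow> 'x::real_normed_vector set \<Rightarrow> ('t \<Rightarrow> 'x \<Rightarrow> real) \<Rightarrow> bool" where
  "param_C_k 0 S F \<longleftrightarrow> continuous_on (K \<times> S) (\<lambda>(t, x). F t x) \<and> (\<forall>x\<in>S. W (\<lambda>t. F t x))"
| "param_C_k (Suc k) S F \<longleftrightarrow>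
     (continuous_on (K \<times> S) (\<lambda>(t, x). F t x) \<and> (\<forall>x\<in>S. W (\<lambda>t. F t x))) \<and>
     (\<forall>t\<in>K. \<forall>x\<in>S. F t differentiable (at x)) \<and>
     (\<forall>v. param_C_k k S (\<lambda>t x. frechet_derivative (F t) (at x) v))"

lemma param_C_k_0: "param_C_k k S F \<Longrightarrow> param_C_k 0 S F"
  by (cases k) auto

lemma W_diff: "W f \<Longrightarrow> W g \<Longrightarrow> W (\<lambda>t. f t - g t)"
  using W_lincomb[of f g 1 "-1"] by simp

lemma I_diff: "W f \<Longrightarrow> W g \<Longrightarrow> I (\<lambda>t. f t - g t) = I f - I g"
  using I_lincomb[of f g 1 "-1"] by simp

text \<open>The bound with \<open>B = 0\<close>. Derivatives of \<open>F t\<close> are controlled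
  for \<open>t\<close> in \<open>K\<close> only, so identities between them are known only
  there.\<close>

lemma I_cong:
  assumes "W f" "W g" "\<And>t. t \<in> K \<Longrightarrow> f t = g t"
  shows "I f = I g"
  using I_bound[OF W_diff[OF assms(1,2)], of 0] I_diff[OF assms(1,2)] assms(3) by simp

text \<open>The tube lemma: compactness of \<open>K\<close> makes continuity at \<open>x0\<close>
  uniform in the parameter.\<close>

lemma uniform_on_K:
  assumes "continuous_on (K \<times> S) (\<lambda>(t, x). F t x :: real)" "open S" "x0 \<in> S" "e > 0"
  shows "\<exists>d>0. ball x0 d \<subseteq> S \<and> (\<forall>x\<in>ball x0 d. \<forall>t\<in>K. \<bar>F t x - F t x0\<bar> \<le> e)"
proof -
  have c: "continuous_on (S \<times> K) (\<lambda>(x, t). F t x)"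
    using continuous_on_compose2[OF assms(1) continuous_on_swap[of "S \<times> K"]]
    by (simp add: case_prod_unfold image_subset_iff)
  obtain X0 where X0: "x0 \<in> X0" "open X0"
    "\<forall>x\<in>X0 \<inter> S. \<forall>t\<in>K. dist (case (x, t) of (x, t) \<Rightarrow> F t x) (case (x0, t) of (x, t) \<Rightarrow> F t x) \<le> e"
    using continuous_on_prod_compactE[OF c K_compact assms(3,4)] by blast
  have "open (X0 \<inter> S)" "x0 \<in> X0 \<inter> S" using X0 assms by auto
  then obtain d where "d > 0" "ball x0 d \<subseteq> X0 \<inter> S" by (meson openE)
  then show ?thesis using X0(3) by (auto simp: dist_real_def intro!: exI[of _ d])
qed

lemma I_continuous:
  assumes "param_C_k 0 S F" "open S"
  shows "continuous_on S (\<lambda>x. I (\<lambda>t. F t x))"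
proof -
  have "isCont (\<lambda>x. I (\<lambda>t. F t x)) x0" if x0: "x0 \<in> S" for x0
    unfolding continuous_at_eps_delta
  proof (intro allI impI)
    fix e :: real assume e: "e > 0"
    then have e': "e / (M + 1) > 0" using M_nonneg by simp
    have c0: "continuous_on (K \<times> S) (\<lambda>(t, x). F t x)" using assms(1) by simp
    obtain d where d: "d > 0" "ball x0 d \<subseteq> S" "\<And>x t. x \<in> ball x0 d \<Longrightarrow> t \<in> K \<Longrightarrow> \<bar>F t x - F t x0\<bar> \<le> e / (M + 1)"
      using uniform_on_K[OF c0 assms(2) x0 e'] by blast
    have "dist (I (\<lambda>t. F t x)) (I (\<lambda>t. F t x0)) < e" if "dist x x0 < d" for x
    proof -
      have x: "x \<in> ball x0 d" using that by (simp add: dist_commute)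
      then have W: "W (\<lambda>t. F t x)" "W (\<lambda>t. F t x0)" using assms(1) d(2) x0 by auto
      have "\<bar>I (\<lambda>t. F t x - F t x0)\<bar> \<le> M * (e / (M + 1))"
        by (rule I_bound[OF W_diff[OF W] d(3)[OF x]])
      also have "\<dots> < e" using e M_nonneg by (simp add: field_simps)
      finally show ?thesis using I_diff[OF W] by (simp add: dist_real_def)
    qed
    then show "\<exists>d>0. \<forall>x. dist x x0 < d \<longrightarrow> dist (I (\<lambda>t. F t x)) (I (\<lambda>t. F t x0)) < e"
      using d(1) by blast
  qed
  then show ?thesis by (simp add: continuous_at_imp_continuous_on)
qed

end

locale param_functional = compact_functional K W I M + findim b n c
  for K :: "'t::topological_space set" and W I M and b :: "nat \<Rightarrow> 'x::real_normed_vector" and n c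
begin

text \<open>The mean value inequality bounds the remainder of \<open>F t\<close> at
  \<open>x0\<close> by the variation of its derivative. This is uniform in \<open>t\<close> along
  the finitely many directions \<open>b i\<close>, hence along all directions, and \<open>I\<close>
  enlarges a uniform bound at most by the factor \<open>M\<close>.\<close>

lemma I_has_derivative:
  fixes F :: "'t \<Rightarrow> 'x \<Rightarrow> real"
  assumes param_C_k: "param_C_k (Suc k) S F" and S: "open S" and x0: "x0 \<in> S"
  shows "((\<lambda>x. I (\<lambda>t. F t x)) has_derivative (\<lambda>v. I (\<lambda>t. frechet_derivative (F t) (at x0) v))) (at x0)"
proof -
  define D where "D t x = frechet_derivative (F t) (at x)" for t x
  have D: "(F t has_derivative D t x) (at x)" if "t \<in> K" "x \<in> S" for t x
    using param_C_k that by (simp add: D_def frechet_derivative_works[symmetric])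
  have linD: "linear (D t x)" if "t \<in> K" "x \<in> S" for t x
    using D[OF that] has_derivative_linear by blast
  have PCD: "param_C_k 0 S (\<lambda>t x. D t x v)" for v
    unfolding D_def by (rule param_C_k_0[of k]) (use param_C_k in simp)
  have WD: "W (\<lambda>t. D t x v)" if "x \<in> S" for x v
    using PCD[of v] that by auto
  have WF: "W (\<lambda>t. F t x)" if "x \<in> S" for x
    using param_C_k that by auto
  have lin: "linear (\<lambda>v. I (\<lambda>t. D t x0 v))"
  proof (rule linearI)
    fix v w r
    have "I (\<lambda>t. D t x0 (v + w)) = I (\<lambda>t. 1 * D t x0 v + 1 * D t x0 w)"
      using linD x0 by (intro I_cong W_lincomb WD) (auto simp: linear_add)
    also have "\<dots> = 1 * I (\<lambda>t. D t x0 v) + 1 * I (\<lambda>t. D t x0 w)"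
      by (intro I_lincomb WD x0)
    finally show "I (\<lambda>t. D t x0 (v + w)) = I (\<lambda>t. D t x0 v) + I (\<lambda>t. D t x0 w)" by simp
    have "I (\<lambda>t. D t x0 (r *\<^sub>R v)) = I (\<lambda>t. r * D t x0 v + 0 * D t x0 v)"
      using linD x0 by (intro I_cong W_lincomb WD) (auto simp: linear_scale)
    also have "\<dots> = r * I (\<lambda>t. D t x0 v) + 0 * I (\<lambda>t. D t x0 v)"
      by (intro I_lincomb WD x0)
    finally show "I (\<lambda>t. D t x0 (r *\<^sub>R v)) = r *\<^sub>R I (\<lambda>t. D t x0 v)" by simp
  qed
  obtain L where L: "L > 0" "\<And>x i. i < n \<Longrightarrow> \<bar>c i x\<bar> \<le> L * norm x" using coord_le by blast
  have rem: "\<exists>d>0. \<forall>y. norm (y - x0) < d \<longrightarrow>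
      norm (I (\<lambda>t. F t y) - I (\<lambda>t. F t x0) - I (\<lambda>t. D t x0 (y - x0))) \<le> e * norm (y - x0)"
    if e: "e > 0" for e
  proof -
    \<comment> \<open>\<open>e1\<close> pays for the factor \<open>M\<close> of the functional,
      \<open>e2\<close> for \<open>n\<close> coordinates of size at most \<open>L\<close> times the
      norm. The summands 1 keep the denominators positive.\<close>
    define e1 where "e1 = e / (M + 1)"
    define e2 where "e2 = e1 / (L * (n + 1))"
    have e1: "e1 > 0" "M * e1 \<le> e" using e M_nonneg by (auto simp: e1_def field_simps)
    then have e2: "e2 > 0" using L by (auto simp: e2_def)
    have "e2 * (L * (n + 1)) = e1" using L(1) by (simp add: e2_def)
    moreover have "e2 * L > 0" using L(1) e2 by simp
    ultimately have e12: "n * L * e2 \<le> e1" by (simp add: algebra_simps)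
    have "\<exists>d>0. ball x0 d \<subseteq> S \<and> (\<forall>x\<in>ball x0 d. \<forall>t\<in>K. \<bar>D t x (b i) - D t x0 (b i)\<bar> \<le> e2)" for i
      using uniform_on_K[OF _ S x0 e2, of "\<lambda>t x. D t x (b i)"] PCD[of "b i"] by auto
    then obtain d where d: "\<And>i. d i > 0" "\<And>i. ball x0 (d i) \<subseteq> S"
      "\<And>i x t. x \<in> ball x0 (d i) \<Longrightarrow> t \<in> K \<Longrightarrow> \<bar>D t x (b i) - D t x0 (b i)\<bar> \<le> e2"
      by metis
    \<comment> \<open>The index \<open>n\<close> is included so that the minimum is over a nonempty
      set even in dimension 0.\<close>
    define \<delta> where "\<delta> = Min (d ` {..n})"
    have \<delta>: "\<delta> > 0" unfolding \<delta>_def using d(1) by (subst Min_gr_iff) auto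
    have \<delta>d: "\<delta> \<le> d i" if "i \<le> n" for i unfolding \<delta>_def using that by auto
    have bS: "ball x0 \<delta> \<subseteq> S" using \<delta>d[of 0] d(2)[of 0] by auto
    have Dd: "\<bar>D t x v - D t x0 v\<bar> \<le> e1 * norm v" if t: "t \<in> K" and x: "x \<in> ball x0 \<delta>" for t x v
    proof -
      have ex: "D t y v = (\<Sum>i<n. c i v * D t y (b i))" if "y \<in> S" for y
      proof -
        have "D t y (\<Sum>i<n. c i v *\<^sub>R b i) = (\<Sum>i<n. c i v * D t y (b i))"
          using linD[OF t that] by (simp add: linear_sum linear_scale)
        then show ?thesis by (simp only: expand)
      qed
      have "D t x v - D t x0 v = (\<Sum>i<n. c i v * (D t x (b i) - D t x0 (b i)))"
        using ex[of x] ex[of x0] x bS x0 by (auto simp: sum_subtractf right_diff_distrib)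
      also have "\<bar>\<dots>\<bar> \<le> (\<Sum>i<n. \<bar>c i v * (D t x (b i) - D t x0 (b i))\<bar>)" by (rule sum_abs)
      also have "\<dots> \<le> (\<Sum>i<n. L * norm v * e2)"
      proof (rule sum_mono)
        fix i assume i: "i \<in> {..<n}"
        then have "x \<in> ball x0 (d i)" using x \<delta>d[of i] by auto
        then show "\<bar>c i v * (D t x (b i) - D t x0 (b i))\<bar> \<le> L * norm v * e2"
          unfolding abs_mult using L i d(3)[of x i t] t by (intro mult_mono) auto
      qed
      also have "\<dots> = (n * L * e2) * norm v" by simp
      also have "\<dots> \<le> e1 * norm v" using e12 by (intro mult_right_mono) auto
      finally show ?thesis .
    qed
    have R: "\<bar>F t y - F t x0 - D t x0 (y - x0)\<bar> \<le> e1 * norm (y - x0)"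
      if t: "t \<in> K" and y: "y \<in> ball x0 \<delta>" for t y
    proof -
      define G where "G x = F t x - D t x0 x" for x
      have "norm (G y - G x0) \<le> e1 * norm (y - x0)"
      proof (rule differentiable_bound[where S = "ball x0 \<delta>" and f' = "\<lambda>x v. D t x v - D t x0 v"])
        show "(G has_derivative (\<lambda>v. D t x v - D t x0 v)) (at x within ball x0 \<delta>)" if "x \<in> ball x0 \<delta>" for x
        proof -
          have "bounded_linear (D t x0)" using D[OF t x0] has_derivative_bounded_linear by blast
          then show ?thesis
            unfolding G_def using that bS t
            by (intro has_derivative_diff has_derivative_at_withinI[OF D] bounded_linear_imp_has_derivative) auto
        qed
        show "onorm (\<lambda>v. D t x v - D t x0 v) \<le> e1" if "x \<in> ball x0 \<delta>" for x
          by (rule onorm_bound) (use Dd[OF t that] e1 in \<open>simp_all add: mult.commute\<close>)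
      qed (use y \<delta> in auto)
      moreover have "D t x0 (y - x0) = D t x0 y - D t x0 x0"
        using linD[OF t x0] by (simp add: linear_diff)
      ultimately show ?thesis by (simp add: G_def algebra_simps)
    qed
    have "norm (I (\<lambda>t. F t y) - I (\<lambda>t. F t x0) - I (\<lambda>t. D t x0 (y - x0))) \<le> e * norm (y - x0)"
      if "norm (y - x0) < \<delta>" for y
    proof -
      have y: "y \<in> ball x0 \<delta>" using that by (simp add: dist_norm norm_minus_commute)
      have W: "W (\<lambda>t. F t y)" "W (\<lambda>t. F t x0)" "W (\<lambda>t. D t x0 (y - x0))"
        using y bS x0 WF WD by auto
      have "\<bar>I (\<lambda>t. (F t y - F t x0) - D t x0 (y - x0))\<bar> \<le> M * (e1 * norm (y - x0))"
        by (rule I_bound) (auto intro!: W_diff W R y)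
      also have "\<dots> \<le> e * norm (y - x0)"
        using e1(2) by (simp add: mult_right_mono flip: mult.assoc)
      finally show ?thesis
        using W by (simp add: I_diff W_diff)
    qed
    then show ?thesis using \<delta> by blast
  qed
  show ?thesis
    unfolding has_derivative_at_alt
    using linear_imp_bounded_linear[OF lin] rem unfolding D_def by blast
qed

lemma C_k_functional:
  fixes F :: "'t \<Rightarrow> 'x \<Rightarrow> real"
  assumes "param_C_k k S F" "open S"
  shows "C_k k S (\<lambda>x. I (\<lambda>t. F t x))"
  using assms(1)
proof (induction k arbitrary: F)
  case 0
  then show ?case using I_continuous[OF _ assms(2)] by simp
next
  case (Suc k)
  show ?case
    by (rule C_k_SucI'[OF assms(2) I_has_derivative[OF Suc.prems assms(2)]])
      (use Suc assms(2) in auto)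
qed

end

lemma compact_functional_integral:
  "compact_functional {0..1::real} (continuous_on {0..1}) (integral {0..1}) 1"
proof
  fix f g :: "real \<Rightarrow> real" and r s B :: real
  assume f: "continuous_on {0..1} f"
  {
    assume g: "continuous_on {0..1} g"
    show "continuous_on {0..1} (\<lambda>t. r * f t + s * g t)"
      using f g by (intro continuous_intros)
    show "integral {0..1} (\<lambda>t. r * f t + s * g t) = r * integral {0..1} f + s * integral {0..1} g"
      using f g by (subst integral_add) (auto intro!: integrable_continuous_interval continuous_intros)
  }
  {
    assume "\<And>t. t \<in> {0..1} \<Longrightarrow> \<bar>f t\<bar> \<le> B"
    then show "\<bar>integral {0..1} f\<bar> \<le> 1 * B"
      using integral_bound[of 0 1 f B] f by simp
  }
qed auto

context findim
begin

text \<open>Hadamard's lemma; \<open>g i x\<close> is the average of the \<open>i\<close>-th partial derivative of \<open>h\<close> over the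
  segment from \<open>p\<close> to \<open>x\<close>.\<close>

lemma Hadamard:
  fixes h :: "'e \<Rightarrow> real"
  assumes h: "smooth_on (ball p s) h" and s: "s > 0"
  obtains g where "\<And>i. smooth_on (ball p s) (g i)"
    and "\<And>i. g i p = frechet_derivative h (at p) (b i)"
    and "\<And>x. x \<in> ball p s \<Longrightarrow> h x = h p + (\<Sum>i<n. c i (x - p) * g i x)"
proof -
  interpret param_functional "{0..1::real}" "continuous_on {0..1}" "integral {0..1}" 1 b n c
    by (intro param_functional.intro compact_functional_integral findim_axioms)
  define S where "S = ball p s"
  have S: "open S" by (simp add: S_def)
  have seg: "t *\<^sub>R (x - p) + p \<in> S" if "t \<in> {0..1}" "x \<in> S" for t x
  proof -
    have "norm (t *\<^sub>R (x - p)) \<le> 1 * norm (x - p)"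
      unfolding norm_scaleR using that by (intro mult_right_mono) auto
    then show ?thesis using that by (simp add: S_def dist_norm norm_minus_commute)
  qed
  have PC0: "param_C_k 0 S F"
    if h: "continuous_on S h" and F: "\<And>t x. t \<in> {0..1} \<Longrightarrow> x \<in> S \<Longrightarrow> F t x = t ^ j * h (t *\<^sub>R (x - p) + p)"
    for j F and h :: "'e \<Rightarrow> real"
  proof -
    have "continuous_on ({0..1} \<times> S) (\<lambda>z. fst z ^ j * h (fst z *\<^sub>R (snd z - p) + p))"
      by (intro continuous_intros continuous_on_compose2[OF h]) (auto intro: seg)
    then have c: "continuous_on ({0..1} \<times> S) (\<lambda>(t, x). F t x)"
      by (rule continuous_on_eq) (auto simp: F)
    have "continuous_on {0..1} (\<lambda>t. F t x)" if "x \<in> S" for x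
      using continuous_on_compose2[OF c, of "{0..1}" "\<lambda>t. (t, x)"] that
      by (simp add: continuous_on_Pair image_subset_iff)
    then show ?thesis using c by simp
  qed
  \<comment> \<open>Each derivative in \<open>x\<close> of a function of
    \<open>t (x - p) + p\<close> produces one more factor \<open>t\<close>. The exponent
    \<open>j\<close> keeps the induction going; the case \<open>j = 0\<close> is used.\<close>
  have PCh: "param_C_k k S F" if "C_k k S h" "\<And>t x. t \<in> {0..1} \<Longrightarrow> x \<in> S \<Longrightarrow> F t x = t ^ j * h (t *\<^sub>R (x - p) + p)"
    for k j F and h :: "'e \<Rightarrow> real"
    using that
  proof (induction k arbitrary: j F h)
    case (0 j F h)
    then show ?case by (intro PC0) auto
  next
    case (Suc k j F h)
    have 0: "param_C_k 0 S F" by (rule PC0[OF C_k_continuous[OF Suc.prems(1)] Suc.prems(2)])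
    have d: "(F t has_derivative (\<lambda>v. t ^ Suc j * frechet_derivative h (at (t *\<^sub>R (x - p) + p)) v)) (at x)"
      if t: "t \<in> {0..1}" and x: "x \<in> S" for t x
    proof -
      have dh: "(h has_derivative frechet_derivative h (at (t *\<^sub>R (x - p) + p))) (at (t *\<^sub>R (x - p) + p))"
        using Suc.prems(1) seg[OF that] by (auto simp: frechet_derivative_works[symmetric])
      have "((\<lambda>x. t *\<^sub>R (x - p) + p) has_derivative (\<lambda>v. t *\<^sub>R v)) (at x)"
        by (auto intro!: derivative_eq_intros)
      from has_derivative_compose[OF this dh]
      have "((\<lambda>x. t ^ j * h (t *\<^sub>R (x - p) + p)) has_derivative
         (\<lambda>v. t ^ j * frechet_derivative h (at (t *\<^sub>R (x - p) + p)) (t *\<^sub>R v))) (at x)"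
        by (rule has_derivative_mult_right)
      also have "(\<lambda>v. t ^ j * frechet_derivative h (at (t *\<^sub>R (x - p) + p)) (t *\<^sub>R v))
          = (\<lambda>v. t ^ Suc j * frechet_derivative h (at (t *\<^sub>R (x - p) + p)) v)"
        using has_derivative_linear[OF dh] by (auto simp: linear_scale)
      finally show ?thesis
        by (rule has_derivative_transform_within_open[OF _ S x]) (use t Suc.prems(2) in auto)
    qed
    have "param_C_k k S (\<lambda>t x. frechet_derivative (F t) (at x) v)" for v
    proof (rule Suc.IH)
      show "C_k k S (\<lambda>x. frechet_derivative h (at x) v)" using Suc.prems(1) by simp
      show "frechet_derivative (F t) (at x) v = t ^ Suc j * frechet_derivative h (at (t *\<^sub>R (x - p) + p)) v"
        if "t \<in> {0..1}" "x \<in> S" for t x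
        by (simp add: frechet_derivative_at[OF d[OF that], symmetric])
    qed
    moreover have "F t differentiable (at x)" if "t \<in> {0..1}" "x \<in> S" for t x
      using d[OF that] unfolding differentiable_def by blast
    ultimately show ?case using 0 by simp
  qed
  define g where "g i x = integral {0..1} (\<lambda>t. frechet_derivative h (at (t *\<^sub>R (x - p) + p)) (b i))" for i x
  have "smooth_on S (g i)" for i
  proof (rule smooth_onI)
    fix k
    have "C_k (Suc k) S h" using h by (simp add: S_def smooth_on_def)
    then have "param_C_k k S (\<lambda>t x. frechet_derivative h (at (t *\<^sub>R (x - p) + p)) (b i))"
      using PCh[of k "\<lambda>x. frechet_derivative h (at x) (b i)"
          "\<lambda>t x. frechet_derivative h (at (t *\<^sub>R (x - p) + p)) (b i)" 0] by simp
    then show "C_k k S (g i)" unfolding g_def by (rule C_k_functional[OF _ S])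
  qed
  moreover have "g i p = frechet_derivative h (at p) (b i)" for i
    by (simp add: g_def)
  moreover have "h x = h p + (\<Sum>i<n. c i (x - p) * g i x)" if x: "x \<in> S" for x
  proof -
    define D where "D t v = frechet_derivative h (at (t *\<^sub>R (x - p) + p)) v" for t v
    have dh: "(h has_derivative D t) (at (t *\<^sub>R (x - p) + p))" if "t \<in> {0..1}" for t
      unfolding D_def using smooth_on_has_derivative[OF h] seg[OF that x] by (simp add: S_def)
    have "((\<lambda>t. h (t *\<^sub>R (x - p) + p)) has_vector_derivative D t (x - p)) (at t within {0..1})"
      if t: "t \<in> {0..1}" for t
    proof -
      have "((\<lambda>t. t *\<^sub>R (x - p) + p) has_derivative (\<lambda>r. r *\<^sub>R (x - p))) (at t)"
        by (auto intro!: derivative_eq_intros)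
      from has_derivative_compose[OF this dh[OF t]]
      show ?thesis
        using has_derivative_linear[OF dh[OF t]]
        by (auto simp: has_vector_derivative_def linear_scale intro: has_derivative_at_withinI)
    qed
    then have i1: "((\<lambda>t. D t (x - p)) has_integral (h (1 *\<^sub>R (x - p) + p) - h (0 *\<^sub>R (x - p) + p))) {0..1}"
      by (intro fundamental_theorem_of_calculus) auto
    have Dint: "(\<lambda>t. D t (b i)) integrable_on {0..1}" for i
    proof -
      have cS: "continuous_on S (\<lambda>x. frechet_derivative h (at x) (b i))"
        using smooth_on_imp_continuous_on[OF smooth_on_frechet_derivative[OF h]] by (simp add: S_def)
      have "continuous_on {0..1} (\<lambda>t. frechet_derivative h (at (t *\<^sub>R (x - p) + p)) (b i))"
      proof (rule continuous_on_compose2[OF cS])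
        show "continuous_on {0..1} (\<lambda>t. t *\<^sub>R (x - p) + p)" by (intro continuous_intros)
      qed (use seg[OF _ x] in auto)
      then show ?thesis
        unfolding D_def by (rule integrable_continuous_interval)
    qed
    have eq: "D t (x - p) = (\<Sum>i<n. c i (x - p) * D t (b i))" if "t \<in> {0..1}" for t
    proof -
      have "D t (\<Sum>i<n. c i (x - p) *\<^sub>R b i) = (\<Sum>i<n. c i (x - p) * D t (b i))"
        using has_derivative_linear[OF dh[OF that]] by (simp add: linear_sum linear_scale)
      then show ?thesis by (simp only: expand)
    qed
    have "((\<lambda>t. \<Sum>i<n. c i (x - p) * D t (b i)) has_integral (\<Sum>i<n. c i (x - p) * g i x)) {0..1}"
      unfolding g_def D_def[symmetric]
      by (intro has_integral_sum has_integral_mult_right integrable_integral Dint) auto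
    then have "((\<lambda>t. D t (x - p)) has_integral (\<Sum>i<n. c i (x - p) * g i x)) {0..1}"
      by (rule has_integral_eq[rotated]) (simp add: eq)
    from has_integral_unique[OF i1 this] show ?thesis by simp
  qed
  ultimately show ?thesis using that unfolding S_def by blast
qed

end

section \<open>Smooth functions and tangent vectors in charts\<close>

locale manifold = findim b n c
  for b :: "nat \<Rightarrow> 'e::real_normed_vector" and n c +
  fixes A :: "('m::t2_space, 'e) atlas"
  assumes atlas: "smooth_atlas A"
begin

lemma chart_exists: obtains U \<phi> where "(U, \<phi>) \<in> A" "p \<in> U"
proof -
  have "p \<in> (\<Union>(U, \<phi>)\<in>A. U)" using atlas by (simp add: smooth_atlas_def)
  then show ?thesis using that by auto
qed

lemma chart_homeo:
  assumes "(U, \<phi>) \<in> A"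
  shows "open U" "open (\<phi> ` U)" "homeomorphism U (\<phi> ` U) \<phi> (inv_into U \<phi>)"
  using assms atlas by (auto simp: smooth_atlas_def)

lemma chart_inj: "(U, \<phi>) \<in> A \<Longrightarrow> inj_on \<phi> U"
  by (rule inj_on_inverseI, erule homeomorphism_apply1[OF chart_homeo(3)])

lemma chart_inv: "(U, \<phi>) \<in> A \<Longrightarrow> p \<in> U \<Longrightarrow> inv_into U \<phi> (\<phi> p) = p"
  by (simp add: chart_inj)

lemma chart_continuous: "(U, \<phi>) \<in> A \<Longrightarrow> continuous_on U \<phi>"
  using chart_homeo(3) homeomorphism_cont1 by blast

lemma chart_inv_continuous: "(U, \<phi>) \<in> A \<Longrightarrow> continuous_on (\<phi> ` U) (inv_into U \<phi>)"
  using chart_homeo(3) homeomorphism_cont2 by blast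

lemma chart_open_image:
  assumes U: "(U, \<phi>) \<in> A" and V: "open V" "V \<subseteq> U"
  shows "open (\<phi> ` V)"
proof -
  have "\<phi> ` V = inv_into U \<phi> -` V \<inter> \<phi> ` U"
    using V(2) chart_inv[OF U] by (auto simp: image_iff)
  then show ?thesis
    using continuous_open_preimage[OF chart_inv_continuous[OF U] chart_homeo(2)[OF U] V(1)]
    by (simp add: Int_commute)
qed

lemma transition_smooth:
  "(U, \<phi>) \<in> A \<Longrightarrow> (V, \<psi>) \<in> A \<Longrightarrow> smooth_on (\<phi> ` (U \<inter> V)) (\<psi> \<circ> inv_into U \<phi>)"
  using atlas unfolding smooth_atlas_def by blast

lemma C_infD: "f \<in> C_inf A \<Longrightarrow> (U, \<phi>) \<in> A \<Longrightarrow> smooth_on (\<phi> ` U) (f \<circ> inv_into U \<phi>)"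
  unfolding C_inf_def by blast

text \<open>Transition maps carry smoothness near a point from one chart over to every
  other.\<close>

lemma C_inf_localI:
  assumes "\<And>p. \<exists>U \<phi> V. (U, \<phi>) \<in> A \<and> open V \<and> p \<in> V \<and> V \<subseteq> U \<and> smooth_on (\<phi> ` V) (f \<circ> inv_into U \<phi>)"
  shows "f \<in> C_inf A"
proof -
  have "smooth_on (\<psi> ` W) (f \<circ> inv_into W \<psi>)" if W: "(W, \<psi>) \<in> A" for W \<psi>
  proof (rule smooth_on_local)
    fix y assume "y \<in> \<psi> ` W"
    then obtain q where q: "q \<in> W" "y = \<psi> q" by blast
    obtain U \<phi> V where V: "(U, \<phi>) \<in> A" "open V" "q \<in> V" "V \<subseteq> U" "smooth_on (\<phi> ` V) (f \<circ> inv_into U \<phi>)"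
      using assms by metis
    let ?T = "\<psi> ` (V \<inter> W)"
    have T: "open ?T" using V chart_homeo[OF W] by (intro chart_open_image[OF W]) auto
    have g: "smooth_on ?T (\<phi> \<circ> inv_into W \<psi>)"
      by (rule smooth_on_subset[OF _ transition_smooth[OF W V(1)]]) (use V in auto)
    have "smooth_on ?T (\<lambda>x. (f \<circ> inv_into U \<phi>) ((\<phi> \<circ> inv_into W \<psi>) x))"
      by (rule smooth_on_compose[OF T chart_open_image[OF V(1,2,4)] g _ V(5)])
        (use chart_inv[OF W] in auto)
    then have "smooth_on ?T (f \<circ> inv_into W \<psi>)"
      by (rule smooth_on_cong[OF T, rotated])
        (use chart_inv[OF W] chart_inv[OF V(1)] V(4) in auto)
    then show "\<exists>T. open T \<and> y \<in> T \<and> smooth_on T (f \<circ> inv_into W \<psi>)"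
      using T q V by blast
  qed
  then show ?thesis unfolding C_inf_def by blast
qed

lemma C_inf_continuous: "f \<in> C_inf A \<Longrightarrow> continuous_on S f"
proof -
  assume f: "f \<in> C_inf A"
  have "isCont f p" for p
  proof -
    obtain U \<phi> where U: "(U, \<phi>) \<in> A" "p \<in> U" by (rule chart_exists)
    have "continuous_on U (\<lambda>q. (f \<circ> inv_into U \<phi>) (\<phi> q))"
      by (rule continuous_on_compose2[OF smooth_on_imp_continuous_on[OF C_infD[OF f U(1)]] chart_continuous[OF U(1)]])
        simp
    then have "continuous_on U f"
      by (rule continuous_on_eq) (simp add: chart_inv[OF U(1)])
    then show ?thesis using U chart_homeo(1) continuous_on_eq_continuous_at by blast
  qed
  then show ?thesis by (simp add: continuous_at_imp_continuous_on)
qed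

lemma C_inf_const: "(\<lambda>p. r) \<in> C_inf A"
  by (auto simp: C_inf_def comp_def smooth_on_const)

lemma C_inf_add: "f \<in> C_inf A \<Longrightarrow> g \<in> C_inf A \<Longrightarrow> (\<lambda>p. f p + g p) \<in> C_inf A"
  using chart_homeo(2) by (auto simp: C_inf_def comp_def intro!: smooth_on_add)

lemma C_inf_mult: "f \<in> C_inf A \<Longrightarrow> g \<in> C_inf A \<Longrightarrow> (\<lambda>p. f p * g p) \<in> C_inf A"
  using chart_homeo(2) by (auto simp: C_inf_def comp_def intro!: smooth_on_mult)

lemma C_inf_lincomb:
  "f \<in> C_inf A \<Longrightarrow> g \<in> C_inf A \<Longrightarrow> (\<lambda>p. r * f p + s * g p) \<in> C_inf A"
  by (intro C_inf_add C_inf_mult C_inf_const)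

lemma C_inf_sum: "(\<And>i. i \<in> I \<Longrightarrow> f i \<in> C_inf A) \<Longrightarrow> (\<lambda>p. \<Sum>i\<in>I. f i p) \<in> C_inf A"
  by (induction I rule: infinite_finite_induct) (auto intro: C_inf_const C_inf_add)

text \<open>Made for Cramer's rule: numerator and determinant are smooth on the whole manifold, but
  the quotient makes sense only where the determinant is nonzero.\<close>

lemma C_inf_divide_local:
  assumes "\<And>p. \<exists>V h D. open V \<and> p \<in> V \<and> h \<in> C_inf A \<and> D \<in> C_inf A \<and> (\<forall>q\<in>V. D q \<noteq> 0 \<and> f q = h q / D q)"
  shows "f \<in> C_inf A"
proof (rule C_inf_localI)
  fix p
  obtain V h D where V: "open V" "p \<in> V" "h \<in> C_inf A" "D \<in> C_inf A" "\<And>q. q \<in> V \<Longrightarrow> D q \<noteq> 0 \<and> f q = h q / D q"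
    using assms by metis
  obtain U \<phi> where U: "(U, \<phi>) \<in> A" "p \<in> U" by (rule chart_exists)
  define T where "T = \<phi> ` (U \<inter> V)"
  have T: "open T" unfolding T_def using V chart_homeo[OF U(1)] by (intro chart_open_image[OF U(1)]) auto
  have sub: "T \<subseteq> \<phi> ` U" by (auto simp: T_def)
  have "smooth_on T (\<lambda>x. (h \<circ> inv_into U \<phi>) x * inverse ((D \<circ> inv_into U \<phi>) x))"
    by (intro smooth_on_mult[OF T] smooth_on_inverse[OF T] smooth_on_subset[OF sub] C_infD[OF _ U(1)] V)
      (use V(5) chart_inv[OF U(1)] in \<open>auto simp: T_def\<close>)
  then have "smooth_on T (f \<circ> inv_into U \<phi>)"
    by (rule smooth_on_cong[OF T, rotated]) (use V(5) chart_inv[OF U(1)] in \<open>auto simp: T_def divide_inverse\<close>)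
  then show "\<exists>U \<phi> V. (U, \<phi>) \<in> A \<and> open V \<and> p \<in> V \<and> V \<subseteq> U \<and> smooth_on (\<phi> ` V) (f \<circ> inv_into U \<phi>)"
    using U V chart_homeo(1)[OF U(1)] unfolding T_def
    by (intro exI[of _ U] exI[of _ \<phi>] exI[of _ "U \<inter> V"]) auto
qed

text \<open>Extension by zero. The compact set \<open>K\<close> is closed because the manifold is
  Hausdorff, so a point outside \<open>V\<close> has a chart neighbourhood that avoids
  \<open>K\<close>, and there the extension vanishes.\<close>

lemma C_inf_extend:
  assumes U: "(U, \<phi>) \<in> A" and V: "open V" "V \<subseteq> U" and K: "compact K" "K \<subseteq> V"
    and u: "smooth_on (\<phi> ` V) u" "\<And>q. q \<in> V \<Longrightarrow> q \<notin> K \<Longrightarrow> u (\<phi> q) = 0"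
  shows "(\<lambda>q. if q \<in> V then u (\<phi> q) else 0) \<in> C_inf A"
proof (rule C_inf_localI)
  fix p
  let ?f = "\<lambda>q. if q \<in> V then u (\<phi> q) else 0"
  show "\<exists>U \<phi> V. (U, \<phi>) \<in> A \<and> open V \<and> p \<in> V \<and> V \<subseteq> U \<and> smooth_on (\<phi> ` V) (?f \<circ> inv_into U \<phi>)"
  proof (cases "p \<in> V")
    case True
    have "smooth_on (\<phi> ` V) (?f \<circ> inv_into U \<phi>)"
    proof (rule smooth_on_cong[OF chart_open_image[OF U V] _ u(1)])
      fix x assume "x \<in> \<phi> ` V"
      then obtain q where q: "q \<in> V" "x = \<phi> q" by blast
      then have "inv_into U \<phi> x = q" using chart_inv[OF U] V(2) by blast
      then show "u x = (?f \<circ> inv_into U \<phi>) x" using q by simp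
    qed
    then show ?thesis using U V True by blast
  next
    case False
    obtain W \<psi> where W: "(W, \<psi>) \<in> A" "p \<in> W" by (rule chart_exists)
    have "closed K" using K(1) by (rule compact_imp_closed)
    then have o: "open (W - K)" using chart_homeo(1)[OF W(1)] by blast
    have oi: "open (\<psi> ` (W - K))" by (rule chart_open_image[OF W(1) o]) auto
    have "smooth_on (\<psi> ` (W - K)) (?f \<circ> inv_into W \<psi>)"
    proof (rule smooth_on_cong[OF oi _ smooth_on_const[of _ 0]])
      fix x assume "x \<in> \<psi> ` (W - K)"
      then obtain q where q: "q \<in> W" "q \<notin> K" "x = \<psi> q" by blast
      then have "inv_into W \<psi> x = q" using chart_inv[OF W(1)] by blast
      then show "0 = (?f \<circ> inv_into W \<psi>) x" using q u(2) by simp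
    qed
    then show ?thesis using W o False K(2) by blast
  qed
qed

lemma bump_function:
  assumes "open V" "p \<in> V"
  obtains \<theta> K where "\<theta> \<in> C_inf A" "\<And>q. \<theta> q \<ge> 0" "\<theta> p > 0" "compact K" "K \<subseteq> V" "\<And>q. q \<notin> K \<Longrightarrow> \<theta> q = 0"
proof -
  obtain U \<phi> where U: "(U, \<phi>) \<in> A" "p \<in> U" by (rule chart_exists)
  define W where "W = U \<inter> V"
  have W: "open W" "W \<subseteq> U" "p \<in> W" using assms U chart_homeo(1)[OF U(1)] by (auto simp: W_def)
  have oW: "open (\<phi> ` W)" by (rule chart_open_image[OF U(1) W(1,2)])
  obtain r s where rs: "r > 0" "cball (\<phi> p) s \<subseteq> \<phi> ` W" "\<And>x. x \<notin> cball (\<phi> p) s \<Longrightarrow> bump (\<phi> p) r x = 0"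
    using bump_in_open[OF oW, of "\<phi> p"] W by blast
  define K where "K = inv_into U \<phi> ` cball (\<phi> p) s"
  have K: "compact K" unfolding K_def
    by (rule compact_continuous_image[OF continuous_on_subset[OF chart_inv_continuous[OF U(1)]] compact_cball])
      (use rs(2) W(2) in blast)
  have KW: "K \<subseteq> W"
  proof
    fix y assume "y \<in> K"
    then obtain x where x: "x \<in> cball (\<phi> p) s" "y = inv_into U \<phi> x" by (auto simp: K_def)
    then obtain q where "q \<in> W" "x = \<phi> q" using rs by blast
    then show "y \<in> W" using x chart_inv[OF U(1)] W by auto
  qed
  define \<theta> where "\<theta> q = (if q \<in> W then bump (\<phi> p) r (\<phi> q) else 0)" for q
  have z: "bump (\<phi> p) r (\<phi> q) = 0" if "q \<in> W" "q \<notin> K" for q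
  proof (rule rs(3))
    show "\<phi> q \<notin> cball (\<phi> p) s"
      using that chart_inv[OF U(1)] W unfolding K_def by (metis image_eqI in_mono)
  qed
  have "\<theta> \<in> C_inf A" unfolding \<theta>_def
    by (rule C_inf_extend[OF U(1) W(1,2) K KW bump_smooth[OF oW] z])
  moreover have "\<theta> p > 0" using W bump_pos[OF rs(1)] by (simp add: \<theta>_def)
  moreover have "K \<subseteq> V" using KW by (auto simp: W_def)
  ultimately show ?thesis
    using that K z by (auto simp: \<theta>_def bump_nonneg)
qed

section \<open>Tangent vectors as derivations, and their expansion in a chart\<close>

lemma tangentI:
  assumes "\<And>f g r s. f \<in> C_inf A \<Longrightarrow> g \<in> C_inf A \<Longrightarrow> v (\<lambda>x. r * f x + s * g x) = r * v f + s * v g"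
    and "\<And>f g. f \<in> C_inf A \<Longrightarrow> g \<in> C_inf A \<Longrightarrow> v (\<lambda>x. f x * g x) = f p * v g + g p * v f"
    and "\<And>f. f \<notin> C_inf A \<Longrightarrow> v f = 0"
  shows "v \<in> tangent_space A p"
  unfolding tangent_space_def using assms by blast

lemma tangentD_lin:
  "v \<in> tangent_space A p \<Longrightarrow> f \<in> C_inf A \<Longrightarrow> g \<in> C_inf A \<Longrightarrow> v (\<lambda>x. r * f x + s * g x) = r * v f + s * v g"
  unfolding tangent_space_def by blast

lemma tangentD_add:
  "v \<in> tangent_space A p \<Longrightarrow> f \<in> C_inf A \<Longrightarrow> g \<in> C_inf A \<Longrightarrow> v (\<lambda>x. f x + g x) = v f + v g"
  using tangentD_lin[of v p f g 1 1] by (simp only: mult_1)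

lemma tangentD_mult:
  "v \<in> tangent_space A p \<Longrightarrow> f \<in> C_inf A \<Longrightarrow> g \<in> C_inf A \<Longrightarrow> v (\<lambda>x. f x * g x) = f p * v g + g p * v f"
  unfolding tangent_space_def by blast

lemma tangentD_const: "v \<in> tangent_space A p \<Longrightarrow> v (\<lambda>x. r) = 0"
proof -
  assume v: "v \<in> tangent_space A p"
  have "v (\<lambda>x. 1) = 0" using tangentD_mult[OF v C_inf_const C_inf_const, of 1 1] by simp
  then show ?thesis using tangentD_lin[OF v C_inf_const C_inf_const, of r 1 0 1] by simp
qed

lemma tangentD_nonsmooth: "v \<in> tangent_space A p \<Longrightarrow> f \<notin> C_inf A \<Longrightarrow> v f = 0"
  unfolding tangent_space_def by blast

lemma tangentD_sum:
  assumes "v \<in> tangent_space A p" "\<And>i. i \<in> I \<Longrightarrow> f i \<in> C_inf A"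
  shows "v (\<lambda>x. \<Sum>i\<in>I. f i x) = (\<Sum>i\<in>I. v (f i))"
  using assms(2)
proof (induction I rule: infinite_finite_induct)
  case (insert i I)
  have "v (\<lambda>x. f i x + (\<Sum>i\<in>I. f i x)) = v (f i) + v (\<lambda>x. \<Sum>i\<in>I. f i x)"
    by (intro tangentD_add[OF assms(1)] C_inf_sum) (use insert in auto)
  then show ?case using insert by simp
qed (simp_all add: tangentD_const[OF assms(1)])

lemma tangent_lincomb:
  assumes "v \<in> tangent_space A p" "w \<in> tangent_space A p"
  shows "(\<lambda>f. r * v f + s * w f) \<in> tangent_space A p"
proof (rule tangentI)
  fix f g t u assume fg: "f \<in> C_inf A" "g \<in> C_inf A"
  show "r * v (\<lambda>x. t * f x + u * g x) + s * w (\<lambda>x. t * f x + u * g x)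
      = t * (r * v f + s * w f) + u * (r * v g + s * w g)"
    unfolding tangentD_lin[OF assms(1) fg] tangentD_lin[OF assms(2) fg] by (simp add: algebra_simps)
  show "r * v (\<lambda>x. f x * g x) + s * w (\<lambda>x. f x * g x) = f p * (r * v g + s * w g) + g p * (r * v f + s * w f)"
    unfolding tangentD_mult[OF assms(1) fg] tangentD_mult[OF assms(2) fg] by (simp add: algebra_simps)
qed (simp add: tangentD_nonsmooth[OF assms(1)] tangentD_nonsmooth[OF assms(2)])

lemma tangent_zero: "(\<lambda>_. 0) \<in> tangent_space A p"
  by (rule tangentI) simp_all

lemma tangent_sum:
  "(\<And>i. i \<in> I \<Longrightarrow> v i \<in> tangent_space A p) \<Longrightarrow> (\<lambda>f. \<Sum>i\<in>I. r i * v i f) \<in> tangent_space A p"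
proof (induction I rule: infinite_finite_induct)
  case (insert i I)
  then show ?case using tangent_lincomb[of "v i" p "\<lambda>f. \<Sum>i\<in>I. r i * v i f" "r i" 1] by simp
qed (simp_all add: tangent_zero)

lemma linear_functional_sum:
  assumes \<alpha>: "linear_functional_on (tangent_space A p) \<alpha>" and v: "\<And>i. i \<in> I \<Longrightarrow> v i \<in> tangent_space A p"
  shows "\<alpha> (\<lambda>f. \<Sum>i\<in>I. r i * v i f) = (\<Sum>i\<in>I. r i * \<alpha> (v i))"
proof -
  have lin: "\<alpha> (\<lambda>f. s * v f + t * w f) = s * \<alpha> v + t * \<alpha> w"
    if "v \<in> tangent_space A p" "w \<in> tangent_space A p" for v w s t
    using \<alpha> that unfolding linear_functional_on_def by blast
  have 0: "\<alpha> (\<lambda>_. 0) = 0"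
    using lin[OF tangent_zero tangent_zero, of 0 0] by simp
  show ?thesis
    using v
  proof (induction I rule: infinite_finite_induct)
    case (insert i I)
    have "\<alpha> (\<lambda>f. r i * v i f + 1 * (\<Sum>i\<in>I. r i * v i f)) = r i * \<alpha> (v i) + 1 * \<alpha> (\<lambda>f. \<Sum>i\<in>I. r i * v i f)"
      by (rule lin) (use insert in \<open>auto intro!: tangent_sum\<close>)
    then show ?case using insert by simp
  qed (simp_all add: 0)
qed

definition chart_deriv :: "'m set \<Rightarrow> ('m \<Rightarrow> 'e) \<Rightarrow> 'm \<Rightarrow> ('m \<Rightarrow> real) \<Rightarrow> 'e \<Rightarrow> real" where
  "chart_deriv U \<phi> q f = frechet_derivative (f \<circ> inv_into U \<phi>) (at (\<phi> q))"

lemma chart_deriv: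
  assumes "(U, \<phi>) \<in> A" "q \<in> U" "f \<in> C_inf A"
  shows "((f \<circ> inv_into U \<phi>) has_derivative chart_deriv U \<phi> q f) (at (\<phi> q))"
  unfolding chart_deriv_def by (rule smooth_on_has_derivative[OF C_infD[OF assms(3,1)]]) (use assms in simp)

lemma chart_deriv_lin:
  assumes "(U, \<phi>) \<in> A" "q \<in> U" "f \<in> C_inf A" "g \<in> C_inf A"
  shows "chart_deriv U \<phi> q (\<lambda>x. r * f x + s * g x) v = r * chart_deriv U \<phi> q f v + s * chart_deriv U \<phi> q g v"
proof -
  have "((\<lambda>x. r * (f \<circ> inv_into U \<phi>) x + s * (g \<circ> inv_into U \<phi>) x) has_derivative
    (\<lambda>v. r * chart_deriv U \<phi> q f v + s * chart_deriv U \<phi> q g v)) (at (\<phi> q))"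
    by (intro has_derivative_add has_derivative_mult_right chart_deriv assms)
  from fun_cong[OF frechet_derivative_at[OF this], of v] show ?thesis
    unfolding chart_deriv_def[of U \<phi> q "\<lambda>x. r * f x + s * g x"] by (simp add: comp_def)
qed

lemma chart_deriv_mult:
  assumes "(U, \<phi>) \<in> A" "q \<in> U" "f \<in> C_inf A" "g \<in> C_inf A"
  shows "chart_deriv U \<phi> q (\<lambda>x. f x * g x) v = f q * chart_deriv U \<phi> q g v + g q * chart_deriv U \<phi> q f v"
proof -
  have "((\<lambda>x. (f \<circ> inv_into U \<phi>) x * (g \<circ> inv_into U \<phi>) x) has_derivative
    (\<lambda>v. (f \<circ> inv_into U \<phi>) (\<phi> q) * chart_deriv U \<phi> q g v + chart_deriv U \<phi> q f v * (g \<circ> inv_into U \<phi>) (\<phi> q))) (at (\<phi> q))"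
    by (intro has_derivative_mult chart_deriv assms)
  from fun_cong[OF frechet_derivative_at[OF this], of v] show ?thesis
    using chart_inv[OF assms(1,2)]
    unfolding chart_deriv_def[of U \<phi> q "\<lambda>x. f x * g x"] by (simp add: comp_def mult.commute)
qed

text \<open>Coordinate fields damped by a cutoff \<open>\<theta>\<close>, which makes them vector
  fields on the whole manifold. The smoothness clause of \<open>symplectic_form\<close> can be
  applied to these; where \<open>\<theta>\<close> is nonzero they still form a basis.\<close>

definition frame :: "'m set \<Rightarrow> ('m \<Rightarrow> 'e) \<Rightarrow> ('m \<Rightarrow> real) \<Rightarrow> nat \<Rightarrow> 'm \<Rightarrow> 'm tvec" where
  "frame U \<phi> \<theta> i q f = (if q \<in> U \<and> f \<in> C_inf A then \<theta> q * chart_deriv U \<phi> q f (b i) else 0)"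

lemma frame_tangent: "(U, \<phi>) \<in> A \<Longrightarrow> frame U \<phi> \<theta> i q \<in> tangent_space A q"
  by (rule tangentI)
    (auto simp: frame_def chart_deriv_lin chart_deriv_mult C_inf_mult C_inf_lincomb algebra_simps)

lemma frame_vector_field:
  assumes U: "(U, \<phi>) \<in> A" and \<theta>: "\<theta> \<in> C_inf A" "compact K" "K \<subseteq> U" "\<And>q. q \<notin> K \<Longrightarrow> \<theta> q = 0"
  shows "vector_field A (frame U \<phi> \<theta> i)"
  unfolding vector_field_def
proof (intro conjI allI ballI frame_tangent[OF U])
  fix f assume f: "f \<in> C_inf A"
  let ?u = "\<lambda>x. (\<theta> \<circ> inv_into U \<phi>) x * frechet_derivative (f \<circ> inv_into U \<phi>) (at x) (b i)"
  have "(\<lambda>q. if q \<in> U then ?u (\<phi> q) else 0) \<in> C_inf A"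
  proof (rule C_inf_extend[OF U chart_homeo(1)[OF U] _ \<theta>(2,3)])
    show "smooth_on (\<phi> ` U) ?u"
      by (intro smooth_on_mult chart_homeo(2)[OF U] C_infD[OF _ U] \<theta> smooth_on_frechet_derivative f)
  qed (use \<theta>(4) chart_inv[OF U] in auto)
  moreover have "(\<lambda>q. frame U \<phi> \<theta> i q f) = (\<lambda>q. if q \<in> U then ?u (\<phi> q) else 0)"
    by (auto simp: frame_def f chart_deriv_def chart_inv[OF U])
  ultimately show "(\<lambda>q. frame U \<phi> \<theta> i q f) \<in> C_inf A" by simp
qed

text \<open>Coordinates centred at \<open>p\<close>, cut off and extended by zero. As the coordinate
  vanishes at \<open>p\<close>, the derivative of the cutoff drops out of the product rule there,
  and dividing by \<open>\<theta> p\<close> restores the value \<open>c i v\<close>. These functions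
  separate the coefficients in \<open>frame_independent\<close>.\<close>

lemma local_coordinate:
  assumes U: "(U, \<phi>) \<in> A" and p: "p \<in> U"
  obtains x where "\<And>i. x i \<in> C_inf A" "\<And>i. x i p = 0"
    "\<And>i v. i < n \<Longrightarrow> chart_deriv U \<phi> p (x i) v = c i v"
proof -
  obtain \<theta> K where \<theta>: "\<theta> \<in> C_inf A" "\<And>q. \<theta> q \<ge> 0" "\<theta> p > 0" "compact K" "K \<subseteq> U" "\<And>q. q \<notin> K \<Longrightarrow> \<theta> q = 0"
    by (rule bump_function[OF chart_homeo(1)[OF U] p]) blast
  let ?u = "\<lambda>i x. inverse (\<theta> p) * (c i (x - \<phi> p) * (\<theta> \<circ> inv_into U \<phi>) x)"
  define x where "x i q = (if q \<in> U then ?u i (\<phi> q) else 0)" for i q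
  have xC: "x i \<in> C_inf A" for i
    unfolding x_def[abs_def]
  proof (rule C_inf_extend[OF U chart_homeo(1)[OF U] subset_refl \<theta>(4,5), where u = "?u i"])
    show "smooth_on (\<phi> ` U) (?u i)"
      by (intro smooth_on_mult chart_homeo(2)[OF U] smooth_on_const coord_smooth C_infD[OF \<theta>(1) U])
    show "?u i (\<phi> q) = 0" if "q \<in> U" "q \<notin> K" for q
      using \<theta>(6)[OF that(2)] chart_inv[OF U that(1)] by simp
  qed
  have d: "chart_deriv U \<phi> p (x i) v = c i v" if "i < n" for i v
  proof -
    have "((\<lambda>x. c i (x - \<phi> p)) has_derivative c i) (at (\<phi> p))"
    proof -
      have "((\<lambda>x. x - \<phi> p) has_derivative (\<lambda>v. v)) (at (\<phi> p))"
        by (auto intro!: derivative_eq_intros)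
      from bounded_linear.has_derivative[OF coord_bl this] show ?thesis by simp
    qed
    from has_derivative_mult[OF this chart_deriv[OF U p \<theta>(1)]]
    have "(?u i has_derivative (\<lambda>v. inverse (\<theta> p) * (c i v * \<theta> p))) (at (\<phi> p))"
      by (intro has_derivative_mult_right) (simp add: chart_inv[OF U p] linear_0[OF coord_linear])
    then have "((x i \<circ> inv_into U \<phi>) has_derivative (\<lambda>v. inverse (\<theta> p) * (c i v * \<theta> p))) (at (\<phi> p))"
    proof (rule has_derivative_transform_within_open[OF _ chart_homeo(2)[OF U]])
      show "\<phi> p \<in> \<phi> ` U" using p by blast
      fix y assume "y \<in> \<phi> ` U"
      then show "?u i y = (x i \<circ> inv_into U \<phi>) y"
        unfolding comp_def x_def by (simp add: inv_into_into f_inv_into_f)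
    qed
    then have "chart_deriv U \<phi> p (x i) = (\<lambda>v. inverse (\<theta> p) * (c i v * \<theta> p))"
      unfolding chart_deriv_def by (rule frechet_derivative_at[symmetric])
    then show ?thesis using \<theta>(3) by simp
  qed
  have z: "x i p = 0" for i by (simp add: x_def linear_0[OF coord_linear])
  show ?thesis by (rule that[OF xC z d])
qed

text \<open>By Hadamard's lemma \<open>f - f p\<close> is a sum of coordinates times smooth
  functions. A derivation at \<open>p\<close> sees only the coordinates, since they vanish at
  \<open>p\<close>, and their cofactors have the partial derivatives of \<open>f\<close> as values
  there.\<close>

lemma tangent_expand:
  assumes U: "(U, \<phi>) \<in> A" and p: "p \<in> U" and v: "v \<in> tangent_space A p"
  obtains a where "\<And>f. f \<in> C_inf A \<Longrightarrow> v f = (\<Sum>i<n. a i * chart_deriv U \<phi> p f (b i))"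
proof -
  obtain s where s: "s > 0" "ball (\<phi> p) s \<subseteq> \<phi> ` U"
    using chart_homeo(2)[OF U] p by (meson image_eqI openE)
  define V where "V = inv_into U \<phi> ` ball (\<phi> p) s"
  have Veq: "V = U \<inter> \<phi> -` ball (\<phi> p) s"
  proof
    show "V \<subseteq> U \<inter> \<phi> -` ball (\<phi> p) s"
      using s(2) by (auto simp: V_def inv_into_into f_inv_into_f subset_iff)
    show "U \<inter> \<phi> -` ball (\<phi> p) s \<subseteq> V"
      using chart_inv[OF U] by (auto simp: V_def intro!: image_eqI)
  qed
  have V: "open V" "V \<subseteq> U" "p \<in> V"
    unfolding Veq using continuous_open_preimage[OF chart_continuous[OF U] chart_homeo(1)[OF U], of "ball (\<phi> p) s"] p s
    by auto
  have imV: "\<phi> ` V = ball (\<phi> p) s"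
    unfolding V_def image_image using s(2) by (force simp: f_inv_into_f subset_iff)
  obtain \<theta>0 K where \<theta>0: "\<theta>0 \<in> C_inf A" "\<And>q. \<theta>0 q \<ge> 0" "\<theta>0 p > 0" "compact K" "K \<subseteq> V" "\<And>q. q \<notin> K \<Longrightarrow> \<theta>0 q = 0"
    by (rule bump_function[OF V(1,3)]) blast
  define \<theta> where "\<theta> q = inverse (\<theta>0 p) * \<theta>0 q" for q
  have \<theta>: "\<theta> \<in> C_inf A" "\<theta> p = 1" "\<And>q. q \<notin> K \<Longrightarrow> \<theta> q = 0"
    using \<theta>0 C_inf_mult[OF C_inf_const \<theta>0(1), of "inverse (\<theta>0 p)"] by (auto simp: \<theta>_def[abs_def])
  have \<theta>s: "smooth_on (\<phi> ` V) (\<theta> \<circ> inv_into U \<phi>)"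
    by (rule smooth_on_subset[OF _ C_infD[OF \<theta>(1) U]]) (use V in auto)
  define ext where "ext u q = (if q \<in> V then u (\<phi> q) * (\<theta> \<circ> inv_into U \<phi>) (\<phi> q) else 0)" for u :: "'e \<Rightarrow> real" and q
  have extC: "ext u \<in> C_inf A" if "smooth_on (\<phi> ` V) u" for u
    unfolding ext_def
    by (rule C_inf_extend[OF U V(1,2) \<theta>0(4,5), where u = "\<lambda>x. u x * (\<theta> \<circ> inv_into U \<phi>) x"])
      (use that \<theta>(3) V(2) chart_inv[OF U] in \<open>auto intro!: smooth_on_mult \<theta>s[unfolded comp_def] chart_open_image[OF U V(1,2)]\<close>)
  have exteq: "ext u q = u (\<phi> q) * \<theta> q" if "q \<in> V" for u q
    using that V chart_inv[OF U, of q] by (auto simp: ext_def)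
  have o: "open (\<phi> ` V)" by (rule chart_open_image[OF U V(1,2)])
  define a where "a i = v (ext (\<lambda>x. c i (x - \<phi> p)))" for i
  have "v f = (\<Sum>i<n. a i * chart_deriv U \<phi> p f (b i))" if f: "f \<in> C_inf A" for f
  proof -
    have sm: "smooth_on (ball (\<phi> p) s) (f \<circ> inv_into U \<phi>)"
      by (rule smooth_on_subset[OF s(2) C_infD[OF f U]])
    obtain g where g: "\<And>i. smooth_on (ball (\<phi> p) s) (g i)"
      "\<And>i. g i (\<phi> p) = frechet_derivative (f \<circ> inv_into U \<phi>) (at (\<phi> p)) (b i)"
      "\<And>x. x \<in> ball (\<phi> p) s \<Longrightarrow> (f \<circ> inv_into U \<phi>) x = (f \<circ> inv_into U \<phi>) (\<phi> p) + (\<Sum>i<n. c i (x - \<phi> p) * g i x)"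
      by (rule Hadamard[OF sm s(1)]) blast
    let ?X = "\<lambda>i. ext (\<lambda>x. c i (x - \<phi> p))"
    have X: "?X i \<in> C_inf A" for i by (intro extC coord_smooth o)
    have G: "ext (g i) \<in> C_inf A" for i by (rule extC) (simp add: imV g(1))
    have \<theta>2: "(\<lambda>q. \<theta> q * \<theta> q) \<in> C_inf A" by (intro C_inf_mult \<theta>)
    \<comment> \<open>The cutoff occurs twice because both factors of each Hadamard term are
      extended separately. When \<open>v\<close> is applied, the terms with
      \<open>v (\<theta> * \<theta>)\<close> cancel and \<open>\<theta> p = 1\<close> leaves
      \<open>v f\<close>.\<close>
    have eq: "f q * (\<theta> q * \<theta> q) = f p * (\<theta> q * \<theta> q) + 1 * (\<Sum>i<n. ?X i q * ext (g i) q)" for q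
    proof (cases "q \<in> V")
      case True
      then have "\<phi> q \<in> ball (\<phi> p) s" using imV by blast
      from g(3)[OF this] have "f q = f p + (\<Sum>i<n. c i (\<phi> q - \<phi> p) * g i (\<phi> q))"
        using True V chart_inv[OF U] p by (simp add: subset_iff)
      then show ?thesis
        by (simp add: exteq[OF True] algebra_simps sum_distrib_left sum_distrib_right)
    next
      case False
      then have "\<theta> q = 0" using \<theta>(3) \<theta>0(5) by blast
      then show ?thesis using False by (simp add: ext_def)
    qed
    have "v (\<lambda>q. f q * (\<theta> q * \<theta> q)) = f p * v (\<lambda>q. \<theta> q * \<theta> q) + v f"
      using tangentD_mult[OF v f \<theta>2] \<theta>(2) by simp
    moreover have "v (\<lambda>q. f q * (\<theta> q * \<theta> q)) = f p * v (\<lambda>q. \<theta> q * \<theta> q) + 1 * v (\<lambda>q. \<Sum>i<n. ?X i q * ext (g i) q)"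
      unfolding eq by (intro tangentD_lin[OF v] \<theta>2 C_inf_sum C_inf_mult X G)
    moreover have "v (\<lambda>q. \<Sum>i<n. ?X i q * ext (g i) q) = (\<Sum>i<n. v (\<lambda>q. ?X i q * ext (g i) q))"
      by (intro tangentD_sum[OF v] C_inf_mult X G)
    moreover have "v (\<lambda>q. ?X i q * ext (g i) q) = a i * chart_deriv U \<phi> p f (b i)" for i
      unfolding tangentD_mult[OF v X G] a_def
      by (simp add: exteq[OF V(3)] \<theta>(2) g(2) chart_deriv_def linear_0[OF coord_linear])
    ultimately show ?thesis by simp
  qed
  then show ?thesis by (rule that)
qed

end

section \<open>Hamiltonian vector fields\<close>

text \<open>Division-free linear algebra over a ring \<open>R\<close> of functions: \<open>D\<close>
  is the determinant and \<open>K\<close> the adjugate, both polynomial in the entries. They remain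
  smooth on the whole manifold, also where the matrix degenerates.\<close>

lemma adjugate_functions:
  fixes R :: "('m \<Rightarrow> real) set" and F :: "nat \<Rightarrow> nat \<Rightarrow> 'm \<Rightarrow> real"
  assumes const: "\<And>r. (\<lambda>_. r) \<in> R"
    and add: "\<And>f g. f \<in> R \<Longrightarrow> g \<in> R \<Longrightarrow> (\<lambda>q. f q + g q) \<in> R"
    and mult: "\<And>f g. f \<in> R \<Longrightarrow> g \<in> R \<Longrightarrow> (\<lambda>q. f q * g q) \<in> R"
    and F: "\<And>i j. i < n \<Longrightarrow> j < n \<Longrightarrow> F i j \<in> R"
  obtains D K where "D \<in> R" and "\<And>i j. i < n \<Longrightarrow> j < n \<Longrightarrow> K i j \<in> R"
    and "\<And>q i k. i < n \<Longrightarrow> k < n \<Longrightarrow> (\<Sum>j<n. F i j q * K j k q) = (if i = k then D q else 0)"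
    and "\<And>q. D q = 0 \<Longrightarrow> \<exists>v. (\<exists>i<n. v i \<noteq> 0) \<and> (\<forall>i<n. (\<Sum>j<n. F i j q * v j) = 0)"
proof -
  have sum: "(\<lambda>q. \<Sum>i\<in>I. f i q) \<in> R" if "\<And>i. i \<in> I \<Longrightarrow> f i \<in> R" for f :: "'a \<Rightarrow> _" and I
    using that by (induction I rule: infinite_finite_induct) (auto intro: const add)
  have prod: "(\<lambda>q. \<Prod>i\<in>I. f i q) \<in> R" if "\<And>i. i \<in> I \<Longrightarrow> f i \<in> R" for f :: "'b \<Rightarrow> _" and I
    using that by (induction I rule: infinite_finite_induct) (auto intro: const mult)
  have det: "(\<lambda>q. Determinant.det (Matrix.mat m m (\<lambda>(i, j). H i j q))) \<in> R"
    if H: "\<And>i j. i < m \<Longrightarrow> j < m \<Longrightarrow> H i j \<in> R" for m and H :: "nat \<Rightarrow> nat \<Rightarrow> 'm \<Rightarrow> real"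
  proof -
    have "(\<lambda>q. \<Sum>p\<in>{p. p permutes {0..<m}}. signof p * (\<Prod>i\<in>{0..<m}. H i (p i) q)) \<in> R"
    proof (intro sum mult const prod)
      fix p i assume p: "p \<in> {p. p permutes {0..<m}}" and i: "i \<in> {0..<m}"
      then have "p i < m" using permutes_in_image[of p "{0..<m}" i] by auto
      then show "H i (p i) \<in> R" using H i by simp
    qed
    moreover have "Determinant.det (Matrix.mat m m (\<lambda>(i, j). H i j q))
        = (\<Sum>p\<in>{p. p permutes {0..<m}}. signof p * (\<Prod>i\<in>{0..<m}. H i (p i) q))" for q
    proof -
      have "p i < m" if "p permutes {0..<m}" "i < m" for p i
        using permutes_in_image[OF that(1), of i] that(2) by auto
      then show ?thesis
        unfolding Determinant.det_def by (auto intro!: sum.cong prod.cong)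
    qed
    ultimately show ?thesis by simp
  qed
  define N where "N q = Matrix.mat n n (\<lambda>(i, j). F i j q)" for q
  have N: "N q \<in> carrier_mat n n" for q by (simp add: N_def)
  define D where "D q = Determinant.det (N q)" for q
  define K where "K i j q = adj_mat (N q) $$ (i, j)" for i j q
  have D: "D \<in> R" unfolding D_def[abs_def] N_def by (rule det) (rule F)
  have KR: "K i j \<in> R" if "i < n" "j < n" for i j
  proof -
    have "K i j = (\<lambda>q. (- 1) ^ (j + i) * Determinant.det (Matrix.mat (n - 1) (n - 1)
       (\<lambda>(i', j'). F (insert_index j i') (insert_index i j') q)))"
    proof
      fix q
      have "mat_delete (N q) j i = Matrix.mat (n - 1) (n - 1) (\<lambda>(i', j'). F (insert_index j i') (insert_index i j') q)"
        by (rule eq_matI) (auto simp: mat_delete_def N_def insert_index_def)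
      then show "K i j q = (- 1) ^ (j + i) * Determinant.det (Matrix.mat (n - 1) (n - 1)
          (\<lambda>(i', j'). F (insert_index j i') (insert_index i j') q))"
        using that N[of q] by (simp add: K_def adj_mat_def cofactor_def)
    qed
    also have "\<dots> \<in> R"
      by (intro mult const det F) (use that in \<open>auto simp: insert_index_def\<close>)
    finally show ?thesis .
  qed
  have prod_eq: "(\<Sum>j<n. F i j q * K j k q) = (if i = k then D q else 0)" if "i < n" "k < n" for q i k
  proof -
    have a: "adj_mat (N q) \<in> carrier_mat n n" "N q * adj_mat (N q) = D q \<cdot>\<^sub>m 1\<^sub>m n"
      using adj_mat[OF N[of q]] by (simp_all add: D_def)
    have "(\<Sum>j<n. F i j q * K j k q) = (N q * adj_mat (N q)) $$ (i, k)"
      using that a(1) N[of q] by (simp add: scalar_prod_def K_def N_def atLeast0LessThan)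
    then show ?thesis using that unfolding a(2) by simp
  qed
  have ker: "\<exists>v. (\<exists>i<n. v i \<noteq> 0) \<and> (\<forall>i<n. (\<Sum>j<n. F i j q * v j) = 0)" if D0: "D q = 0" for q
  proof -
    obtain w where w: "w \<in> carrier_vec n" "w \<noteq> 0\<^sub>v n" "N q *\<^sub>v w = 0\<^sub>v n"
      using D0 det_0_iff_vec_prod_zero[OF N[of q]] unfolding D_def by blast
    have "\<exists>i<n. w $ i \<noteq> 0"
      using w(1,2) by (metis carrier_vecD eq_vecI index_zero_vec(1) index_zero_vec(2))
    moreover have "(\<Sum>j<n. F i j q * w $ j) = 0" if "i < n" for i
    proof -
      have "(N q *\<^sub>v w) $ i = (\<Sum>j<n. F i j q * w $ j)"
        using that w(1) by (simp add: N_def scalar_prod_def atLeast0LessThan)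
      then show ?thesis using w(3) that by simp
    qed
    ultimately show ?thesis by blast
  qed
  show ?thesis by (rule that[OF D KR prod_eq ker])
qed

locale symplectic = manifold b n c A
  for b :: "nat \<Rightarrow> 'e::real_normed_vector" and n c and A :: "('m::t2_space, 'e) atlas" +
  fixes \<omega> :: "'m two_form"
  assumes symp: "symplectic_form A \<omega>"
begin

lemma omega_linear: "v \<in> tangent_space A p \<Longrightarrow> linear_functional_on (tangent_space A p) (\<omega> p v)"
  using symp unfolding symplectic_form_def by blast

lemma omega_skew: "v \<in> tangent_space A p \<Longrightarrow> w \<in> tangent_space A p \<Longrightarrow> \<omega> p v w = - \<omega> p w v"
  using symp unfolding symplectic_form_def by blast

lemma omega_nondegenerate:
  "v \<in> tangent_space A p \<Longrightarrow> (\<And>w. w \<in> tangent_space A p \<Longrightarrow> \<omega> p v w = 0) \<Longrightarrow> v = (\<lambda>_. 0)"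
  using symp unfolding symplectic_form_def by blast

lemma omega_smooth:
  "vector_field A X \<Longrightarrow> vector_field A Y \<Longrightarrow> (\<lambda>p. \<omega> p (X p) (Y p)) \<in> C_inf A"
  using symp unfolding symplectic_form_def by blast

lemma omega_sum_right:
  assumes "v \<in> tangent_space A p" "\<And>i. i \<in> I \<Longrightarrow> w i \<in> tangent_space A p"
  shows "\<omega> p v (\<lambda>f. \<Sum>i\<in>I. r i * w i f) = (\<Sum>i\<in>I. r i * \<omega> p v (w i))"
  by (rule linear_functional_sum[OF omega_linear[OF assms(1)] assms(2)])

lemma omega_sum_left:
  assumes v: "v \<in> tangent_space A p" and w: "\<And>i. i \<in> I \<Longrightarrow> w i \<in> tangent_space A p"
  shows "\<omega> p (\<lambda>f. \<Sum>i\<in>I. r i * w i f) v = (\<Sum>i\<in>I. r i * \<omega> p (w i) v)"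
proof -
  have "\<omega> p (\<lambda>f. \<Sum>i\<in>I. r i * w i f) v = - (\<Sum>i\<in>I. r i * \<omega> p v (w i))"
    using omega_skew[OF tangent_sum[of I w p r, OF w] v] omega_sum_right[of v p I w r, OF v w] by simp
  also have "\<dots> = (\<Sum>i\<in>I. r i * \<omega> p (w i) v)"
    unfolding sum_negf[symmetric] using omega_skew[OF v w] by (intro sum.cong) auto
  finally show ?thesis .
qed

lemma ham_field_unique:
  assumes v: "v \<in> tangent_space A p" and f: "\<And>w. w \<in> tangent_space A p \<Longrightarrow> w f = \<omega> p v w"
  shows "ham_field A \<omega> f p = v"
  unfolding ham_field_def
proof (rule the_equality)
  show "v \<in> tangent_space A p \<and> (\<forall>w\<in>tangent_space A p. w f = \<omega> p v w)" using v f by blast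
  fix u assume u: "u \<in> tangent_space A p \<and> (\<forall>w\<in>tangent_space A p. w f = \<omega> p u w)"
  let ?d = "\<lambda>g. 1 * u g + (- 1) * v g"
  have d: "?d \<in> tangent_space A p" using u v by (intro tangent_lincomb) auto
  have "?d = (\<lambda>_. 0)"
  proof (rule omega_nondegenerate[OF d])
    fix w assume w: "w \<in> tangent_space A p"
    have "\<omega> p w ?d = 1 * \<omega> p w u + (- 1) * \<omega> p w v"
      using omega_linear[OF w] u v unfolding linear_functional_on_def by blast
    then show "\<omega> p ?d w = 0"
      using omega_skew[OF d w] omega_skew[OF w] u v f[OF w] w by auto
  qed
  then show "u = v" by (auto simp: fun_eq_iff)
qed

lemma frame_expand:
  assumes U: "(U, \<phi>) \<in> A" "q \<in> U" and \<theta>: "\<theta> q \<noteq> 0" and v: "v \<in> tangent_space A q"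
  obtains a where "v = (\<lambda>f. \<Sum>i<n. a i * frame U \<phi> \<theta> i q f)"
proof -
  obtain a where a: "\<And>f. f \<in> C_inf A \<Longrightarrow> v f = (\<Sum>i<n. a i * chart_deriv U \<phi> q f (b i))"
    by (rule tangent_expand[OF U v]) blast
  have "v f = (\<Sum>i<n. a i / \<theta> q * frame U \<phi> \<theta> i q f)" for f
    using a[of f] tangentD_nonsmooth[OF v, of f] U \<theta> by (cases "f \<in> C_inf A") (simp_all add: frame_def)
  then show ?thesis using that[of "\<lambda>i. a i / \<theta> q"] by blast
qed

lemma frame_independent:
  assumes U: "(U, \<phi>) \<in> A" "q \<in> U" and \<theta>: "\<theta> q \<noteq> 0"
    and 0: "(\<lambda>f. \<Sum>i<n. a i * frame U \<phi> \<theta> i q f) = (\<lambda>_. 0)" and k: "k < n"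
  shows "a k = 0"
proof -
  obtain x where x: "\<And>i. x i \<in> C_inf A" "\<And>i. x i q = 0"
    "\<And>i v. i < n \<Longrightarrow> chart_deriv U \<phi> q (x i) v = c i v"
    by (rule local_coordinate[OF U]) blast
  have "0 = (\<Sum>i<n. a i * frame U \<phi> \<theta> i q (x k))" using fun_cong[OF 0, of "x k"] by simp
  also have "\<dots> = (\<Sum>i<n. if i = k then a i * \<theta> q else 0)"
    by (intro sum.cong) (use U x k dual in \<open>auto simp: frame_def\<close>)
  also have "\<dots> = a k * \<theta> q" using k by simp
  finally show ?thesis using \<theta> by simp
qed

text \<open>Cramer's rule for \<open>i_v \<omega> = df\<close> in a damped frame. One choice of
  \<open>D\<close> and \<open>K\<close> works at all points with
  \<open>\<theta> q \<noteq> 0\<close> and for all \<open>f\<close>; pointwise existence of the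
  Hamiltonian vector would not show that it depends smoothly on the point.\<close>

lemma ham_field_local:
  obtains U \<phi> \<theta> D K where "(U, \<phi>) \<in> A" "p \<in> U" "\<theta> \<in> C_inf A" "\<theta> p \<noteq> 0" "\<And>q. \<theta> q \<noteq> 0 \<Longrightarrow> q \<in> U"
    "\<And>i. vector_field A (frame U \<phi> \<theta> i)" "D \<in> C_inf A"
    "\<And>i j. i < n \<Longrightarrow> j < n \<Longrightarrow> K i j \<in> C_inf A"
    "\<And>q. \<theta> q \<noteq> 0 \<Longrightarrow> D q \<noteq> 0"
    "\<And>q f w. \<theta> q \<noteq> 0 \<Longrightarrow> f \<in> C_inf A \<Longrightarrow> w \<in> tangent_space A q \<Longrightarrow>
       w f = \<omega> q (\<lambda>g. \<Sum>j<n. (\<Sum>k<n. K j k q * frame U \<phi> \<theta> k q f) / D q * frame U \<phi> \<theta> j q g) w"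
proof -
  obtain U \<phi> where U: "(U, \<phi>) \<in> A" "p \<in> U" by (rule chart_exists)
  obtain \<theta> T where \<theta>: "\<theta> \<in> C_inf A" "\<And>q. \<theta> q \<ge> 0" "\<theta> p > 0" "compact T" "T \<subseteq> U" "\<And>q. q \<notin> T \<Longrightarrow> \<theta> q = 0"
    by (rule bump_function[OF chart_homeo(1)[OF U(1)] U(2)]) blast
  have \<theta>U: "q \<in> U" if "\<theta> q \<noteq> 0" for q using \<theta>(5,6) that by blast
  let ?E = "frame U \<phi> \<theta>"
  have vf: "vector_field A (?E i)" for i by (rule frame_vector_field[OF U(1) \<theta>(1,4,5,6)])
  have tan: "?E i q \<in> tangent_space A q" for i q by (rule frame_tangent[OF U(1)])
  \<comment> \<open>The indices are swapped: for \<open>v = \<Sum> a j E j\<close> the equations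
    \<open>\<omega> v (E i) = E i f\<close> then read as the matrix \<open>F\<close> applied to
    \<open>a\<close>.\<close>
  define F where "F i j q = \<omega> q (?E j q) (?E i q)" for i j q
  have FC: "F i j \<in> C_inf A" for i j unfolding F_def[abs_def] by (rule omega_smooth[OF vf vf])
  obtain D K where DK: "D \<in> C_inf A" "\<And>i j. i < n \<Longrightarrow> j < n \<Longrightarrow> K i j \<in> C_inf A"
    "\<And>q i k. i < n \<Longrightarrow> k < n \<Longrightarrow> (\<Sum>j<n. F i j q * K j k q) = (if i = k then D q else 0)"
    "\<And>q. D q = 0 \<Longrightarrow> \<exists>v. (\<exists>i<n. v i \<noteq> 0) \<and> (\<forall>i<n. (\<Sum>j<n. F i j q * v j) = 0)"
  proof (rule adjugate_functions[of "C_inf A" n F, OF C_inf_const C_inf_add C_inf_mult FC])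
    fix D K
    assume DK: "D \<in> C_inf A" "\<And>i j. i < n \<Longrightarrow> j < n \<Longrightarrow> K i j \<in> C_inf A"
      "\<And>q i k. i < n \<Longrightarrow> k < n \<Longrightarrow> (\<Sum>j<n. F i j q * K j k q) = (if i = k then D q else 0)"
      "\<And>q. D q = 0 \<Longrightarrow> \<exists>v. (\<exists>i<n. v i \<noteq> 0) \<and> (\<forall>i<n. (\<Sum>j<n. F i j q * v j) = 0)"
    show thesis by (rule that[OF DK])
  qed
  \<comment> \<open>A kernel vector of \<open>F\<close> gives a combination of the frame that pairs
    to 0 with every tangent vector. Nondegeneracy makes this combination zero, against the
    independence of the frame.\<close>
  have D0: "D q \<noteq> 0" if q: "\<theta> q \<noteq> 0" for q
  proof
    assume "D q = 0"
    then obtain v where v: "\<exists>i<n. v i \<noteq> 0" "\<And>i. i < n \<Longrightarrow> (\<Sum>j<n. F i j q * v j) = 0" using DK(4) by blast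
    let ?v = "\<lambda>f. \<Sum>j<n. v j * ?E j q f"
    have vT: "?v \<in> tangent_space A q" by (rule tangent_sum) (rule tan)
    have "?v = (\<lambda>_. 0)"
    proof (rule omega_nondegenerate[OF vT])
      fix w assume w: "w \<in> tangent_space A q"
      obtain a where a: "w = (\<lambda>f. \<Sum>i<n. a i * ?E i q f)"
        by (rule frame_expand[where \<theta> = \<theta>, OF U(1) \<theta>U[OF q] q w]) blast
      have "\<omega> q ?v (?E i q) = 0" if "i < n" for i
        using v(2)[OF that] by (simp add: omega_sum_left[OF tan tan] F_def mult.commute)
      then show "\<omega> q ?v w = 0" unfolding a omega_sum_right[OF vT tan] by simp
    qed
    then show False using frame_independent[where \<theta> = \<theta>, OF U(1) \<theta>U[OF q] q] v(1) by blast
  qed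
  have ham: "w f = \<omega> q (\<lambda>g. \<Sum>j<n. (\<Sum>k<n. K j k q * ?E k q f) / D q * ?E j q g) w"
    if q: "\<theta> q \<noteq> 0" and f: "f \<in> C_inf A" and w: "w \<in> tangent_space A q" for q f w
  proof -
    let ?c = "\<lambda>j. (\<Sum>k<n. K j k q * ?E k q f) / D q"
    let ?v = "\<lambda>g. \<Sum>j<n. ?c j * ?E j q g"
    have vT: "?v \<in> tangent_space A q" by (rule tangent_sum) (rule tan)
    obtain a where a: "w = (\<lambda>f. \<Sum>i<n. a i * ?E i q f)"
      by (rule frame_expand[where \<theta> = \<theta>, OF U(1) \<theta>U[OF q] q w]) blast
    have "\<omega> q ?v (?E i q) = ?E i q f" if i: "i < n" for i
    proof -
      have "\<omega> q ?v (?E i q) = (\<Sum>j<n. ?c j * F i j q)"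
        unfolding F_def by (rule omega_sum_left[OF tan tan])
      also have "\<dots> = (\<Sum>j<n. \<Sum>k<n. F i j q * K j k q * ?E k q f) / D q"
        by (simp add: sum_distrib_left sum_distrib_right sum_divide_distrib mult_ac)
      also have "\<dots> = (\<Sum>k<n. (\<Sum>j<n. F i j q * K j k q) * ?E k q f) / D q"
        by (subst sum.swap) (simp add: sum_distrib_right)
      also have "\<dots> = (\<Sum>k<n. if k = i then D q * ?E k q f else 0) / D q"
        using DK(3)[OF i] by (intro arg_cong2[where f = "(/)"] sum.cong) auto
      also have "\<dots> = ?E i q f" using i D0[OF q] by simp
      finally show ?thesis .
    qed
    then show ?thesis unfolding a omega_sum_right[OF vT tan] by simp
  qed
  show ?thesis using \<theta>(3) by (intro that[OF U \<theta>(1) _ \<theta>U vf DK(1,2) D0 ham]) auto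
qed

lemma ham_field_props:
  assumes "f \<in> C_inf A"
  shows "ham_field A \<omega> f p \<in> tangent_space A p"
    and "w \<in> tangent_space A p \<Longrightarrow> w f = \<omega> p (ham_field A \<omega> f p) w"
proof -
  obtain v where v: "v \<in> tangent_space A p" "\<And>w. w \<in> tangent_space A p \<Longrightarrow> w f = \<omega> p v w"
  proof (rule ham_field_local[of p])
    fix U \<phi> \<theta> D K
    assume U: "(U, \<phi>) \<in> A" and \<theta>: "\<theta> p \<noteq> 0"
      and h: "\<And>q f w. \<theta> q \<noteq> 0 \<Longrightarrow> f \<in> C_inf A \<Longrightarrow> w \<in> tangent_space A q \<Longrightarrow>
       w f = \<omega> q (\<lambda>g. \<Sum>j<n. (\<Sum>k<n. K j k q * frame U \<phi> \<theta> k q f) / D q * frame U \<phi> \<theta> j q g) w"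
    show thesis
      by (rule that[OF tangent_sum[OF frame_tangent[OF U]] h[OF \<theta> assms]])
  qed
  have eq: "ham_field A \<omega> f p = v" using v by (rule ham_field_unique)
  show "ham_field A \<omega> f p \<in> tangent_space A p" using v eq by simp
  show "w \<in> tangent_space A p \<Longrightarrow> w f = \<omega> p (ham_field A \<omega> f p) w" using v eq by simp
qed

text \<open>This is \<open>df\<close> evaluated on the Hamiltonian vector of \<open>g\<close>. The
  bracket is thereby a tangent vector acting on its first argument, so linearity and the Leibniz
  rule come from the definition of a derivation.\<close>

lemma poisson_eq:
  "f \<in> C_inf A \<Longrightarrow> g \<in> C_inf A \<Longrightarrow> poisson A \<omega> f g p = ham_field A \<omega> g p f"
  unfolding poisson_def using ham_field_props by metis

lemma poisson_skew:
  "f \<in> C_inf A \<Longrightarrow> g \<in> C_inf A \<Longrightarrow> poisson A \<omega> f g p = - poisson A \<omega> g f p"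
  unfolding poisson_def by (rule omega_skew) (rule ham_field_props, assumption)+

lemma poisson_mult_left:
  assumes "f \<in> C_inf A" "h \<in> C_inf A" "g \<in> C_inf A"
  shows "poisson A \<omega> (\<lambda>x. f x * h x) g p = f p * poisson A \<omega> h g p + h p * poisson A \<omega> f g p"
  using assms C_inf_mult[OF assms(1,2)] tangentD_mult[OF ham_field_props(1)[OF assms(3)] assms(1,2)]
  by (simp add: poisson_eq)

lemma poisson_C_inf:
  assumes f: "f \<in> C_inf A" and g: "g \<in> C_inf A"
  shows "poisson A \<omega> f g \<in> C_inf A"
proof (rule C_inf_divide_local)
  fix p
  show "\<exists>V h D. open V \<and> p \<in> V \<and> h \<in> C_inf A \<and> D \<in> C_inf A \<and> (\<forall>q\<in>V. D q \<noteq> 0 \<and> poisson A \<omega> f g q = h q / D q)"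
  proof (rule ham_field_local[of p])
    fix U \<phi> \<theta> D K
    assume U: "(U, \<phi>) \<in> A" and \<theta>: "\<theta> \<in> C_inf A" "\<theta> p \<noteq> 0" and vf: "\<And>i. vector_field A (frame U \<phi> \<theta> i)"
      and D: "D \<in> C_inf A" "\<And>q. \<theta> q \<noteq> 0 \<Longrightarrow> D q \<noteq> 0"
      and K: "\<And>i j. i < n \<Longrightarrow> j < n \<Longrightarrow> K i j \<in> C_inf A"
      and h: "\<And>q f w. \<theta> q \<noteq> 0 \<Longrightarrow> f \<in> C_inf A \<Longrightarrow> w \<in> tangent_space A q \<Longrightarrow>
       w f = \<omega> q (\<lambda>g. \<Sum>j<n. (\<Sum>k<n. K j k q * frame U \<phi> \<theta> k q f) / D q * frame U \<phi> \<theta> j q g) w"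
    let ?E = "frame U \<phi> \<theta>"
    let ?h = "\<lambda>q. \<Sum>j<n. (\<Sum>k<n. K j k q * ?E k q g) * ?E j q f"
    have E: "(\<lambda>q. ?E i q f) \<in> C_inf A" if "f \<in> C_inf A" for i f
      using vf that unfolding vector_field_def by blast
    have "?h \<in> C_inf A" by (intro C_inf_sum C_inf_mult K E f g) auto
    moreover have "open {q. \<theta> q \<noteq> 0}"
      using C_inf_continuous[OF \<theta>(1)] by (intro open_Collect_neq continuous_intros)
    moreover have "poisson A \<omega> f g q = ?h q / D q" if q: "\<theta> q \<noteq> 0" for q
    proof -
      have "ham_field A \<omega> g q = (\<lambda>f. \<Sum>j<n. (\<Sum>k<n. K j k q * ?E k q g) / D q * ?E j q f)"
        by (rule ham_field_unique[OF tangent_sum[OF frame_tangent[OF U]] h[OF q g]])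
      moreover have "(\<Sum>j<n. r j / d * s j) = (\<Sum>j<n. r j * s j) / d" for r s :: "nat \<Rightarrow> real" and d
        by (simp add: sum_divide_distrib)
      ultimately show ?thesis unfolding poisson_eq[OF f g] by simp
    qed
    ultimately show ?thesis using \<theta>(2) D by (intro exI[of _ "{q. \<theta> q \<noteq> 0}"] exI[of _ ?h] exI[of _ D]) auto
  qed
qed

text \<open>The Hamiltonian field as a continuous vector-valued function \<open>Y\<close> in a
  chart, the form in which Euler polygons can follow it.\<close>

lemma ham_field_chart:
  assumes g: "g \<in> C_inf A"
  obtains U \<phi> V Y where "(U, \<phi>) \<in> A" "open V" "p \<in> V" "V \<subseteq> U" "continuous_on (\<phi> ` V) Y"
    "\<And>q f. q \<in> V \<Longrightarrow> f \<in> C_inf A \<Longrightarrow> ham_field A \<omega> g q f = chart_deriv U \<phi> q f (Y (\<phi> q))"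
proof (rule ham_field_local[of p])
  fix U \<phi> \<theta> D K
  assume U: "(U, \<phi>) \<in> A" and \<theta>: "\<theta> \<in> C_inf A" "\<theta> p \<noteq> 0" "\<And>q. \<theta> q \<noteq> 0 \<Longrightarrow> q \<in> U"
    and vf: "\<And>i. vector_field A (frame U \<phi> \<theta> i)"
    and D: "D \<in> C_inf A" "\<And>q. \<theta> q \<noteq> 0 \<Longrightarrow> D q \<noteq> 0"
    and K: "\<And>i j. i < n \<Longrightarrow> j < n \<Longrightarrow> K i j \<in> C_inf A"
    and h: "\<And>q f w. \<theta> q \<noteq> 0 \<Longrightarrow> f \<in> C_inf A \<Longrightarrow> w \<in> tangent_space A q \<Longrightarrow>
     w f = \<omega> q (\<lambda>g. \<Sum>j<n. (\<Sum>k<n. K j k q * frame U \<phi> \<theta> k q f) / D q * frame U \<phi> \<theta> j q g) w"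
  let ?E = "frame U \<phi> \<theta>"
  define V where "V = {q. \<theta> q \<noteq> 0}"
  define k where "k j q = (\<Sum>k<n. K j k q * ?E k q g) / D q * \<theta> q" for j q
  define Y where "Y x = (\<Sum>j<n. k j (inv_into U \<phi> x) *\<^sub>R b j)" for x
  have V: "open V" unfolding V_def
    using C_inf_continuous[OF \<theta>(1)] by (intro open_Collect_neq continuous_intros)
  have VU: "V \<subseteq> U" using \<theta>(3) by (auto simp: V_def)
  have E: "(\<lambda>q. ?E i q f) \<in> C_inf A" if "f \<in> C_inf A" for i f
    using vf that unfolding vector_field_def by blast
  have kc: "continuous_on V (k j)" if "j < n" for j
    unfolding k_def[abs_def]
    by (intro continuous_intros C_inf_continuous \<theta> D K E g) (use that D in \<open>auto simp: V_def\<close>)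
  have inv: "inv_into U \<phi> (\<phi> q) = q" if "q \<in> V" for q
    using chart_inv[OF U] that VU by blast
  have ic: "continuous_on (\<phi> ` V) (inv_into U \<phi>)"
    by (rule continuous_on_subset[OF chart_inv_continuous[OF U]]) (use VU in blast)
  have "continuous_on (\<phi> ` V) (\<lambda>x. k j (inv_into U \<phi> x))" if "j < n" for j
    by (rule continuous_on_compose2[OF kc[OF that] ic]) (auto simp: inv)
  then have Y: "continuous_on (\<phi> ` V) Y"
    unfolding Y_def[abs_def] by (intro continuous_intros) auto
  have eq: "ham_field A \<omega> g q f = chart_deriv U \<phi> q f (Y (\<phi> q))" if q: "q \<in> V" and f: "f \<in> C_inf A" for q f
  proof -
    have q': "\<theta> q \<noteq> 0" "q \<in> U" using q VU by (auto simp: V_def)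
    have "ham_field A \<omega> g q = (\<lambda>f. \<Sum>j<n. (\<Sum>k<n. K j k q * ?E k q g) / D q * ?E j q f)"
      by (rule ham_field_unique[OF tangent_sum[OF frame_tangent[OF U]] h[OF q'(1) g]])
    then have "ham_field A \<omega> g q f = (\<Sum>j<n. k j q * chart_deriv U \<phi> q f (b j))"
      using q' f unfolding k_def by (simp add: frame_def[of U \<phi> \<theta> _ q f] mult_ac)
    also have "\<dots> = chart_deriv U \<phi> q f (Y (\<phi> q))"
      using has_derivative_linear[OF chart_deriv[OF U q'(2) f]] inv[OF q]
      by (simp add: Y_def linear_sum linear_scale)
    finally show ?thesis .
  qed
  show thesis by (rule that[OF U V _ VU Y eq]) (use \<theta>(2) in \<open>simp_all add: V_def\<close>)
qed

end

section \<open>Vector fields tangent to level sets\<close>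

primrec euler :: "('e::real_normed_vector \<Rightarrow> 'e) \<Rightarrow> 'e \<Rightarrow> real \<Rightarrow> nat \<Rightarrow> 'e" where
  "euler Y x h 0 = x"
| "euler Y x h (Suc k) = euler Y x h k + h *\<^sub>R Y (euler Y x h k)"

text \<open>Both bounds go through one induction: the first keeps the current vertex in the ball,
  and only there are the speed bound \<open>B\<close> and the oscillation bound
  \<open>\<epsilon>\<close> available for the next step.\<close>

lemma euler_bounds:
  assumes B: "\<And>y. y \<in> cball x d \<Longrightarrow> norm (Y y) \<le> B" and \<epsilon>: "\<And>y. y \<in> cball x d \<Longrightarrow> norm (Y y - Y x) \<le> \<epsilon>"
    and h: "h \<ge> 0" and B0: "B \<ge> 0" and k: "real k * h * B \<le> d"
  shows "norm (euler Y x h k - x) \<le> real k * h * B"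
    and "norm (euler Y x h k - (x + (real k * h) *\<^sub>R Y x)) \<le> real k * h * \<epsilon>"
proof -
  have "norm (euler Y x h k - x) \<le> real k * h * B \<and>
      norm (euler Y x h k - (x + (real k * h) *\<^sub>R Y x)) \<le> real k * h * \<epsilon>"
    using k
  proof (induction k)
    case (Suc k)
    let ?z = "euler Y x h k"
    have "real k * h * B \<le> real (Suc k) * h * B"
      using h B0 by (intro mult_right_mono) auto
    then have "real k * h * B \<le> d" using Suc.prems by linarith
    note IH = Suc.IH[OF this]
    then have "norm (?z - x) \<le> d" using \<open>real k * h * B \<le> d\<close> by linarith
    then have z: "?z \<in> cball x d" by (simp add: dist_norm norm_minus_commute)
    have "norm (euler Y x h (Suc k) - x) = norm ((?z - x) + h *\<^sub>R Y ?z)" by (simp add: algebra_simps)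
    also have "\<dots> \<le> norm (?z - x) + norm (h *\<^sub>R Y ?z)" by (rule norm_triangle_ineq)
    also have "\<dots> \<le> real k * h * B + h * B"
      using IH B[OF z] h by (intro add_mono) (auto intro: mult_left_mono)
    finally have 1: "norm (euler Y x h (Suc k) - x) \<le> real (Suc k) * h * B" by (simp add: algebra_simps)
    have "norm (euler Y x h (Suc k) - (x + (real (Suc k) * h) *\<^sub>R Y x))
        = norm ((?z - (x + (real k * h) *\<^sub>R Y x)) + h *\<^sub>R (Y ?z - Y x))"
      by (simp add: algebra_simps)
    also have "\<dots> \<le> norm (?z - (x + (real k * h) *\<^sub>R Y x)) + norm (h *\<^sub>R (Y ?z - Y x))"
      by (rule norm_triangle_ineq)
    also have "\<dots> \<le> real k * h * \<epsilon> + h * \<epsilon>"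
      using IH \<epsilon>[OF z] h by (intro add_mono) (auto intro: mult_left_mono)
    finally show ?case using 1 by (simp add: algebra_simps)
  qed simp
  then show "norm (euler Y x h k - x) \<le> real k * h * B"
    and "norm (euler Y x h k - (x + (real k * h) *\<^sub>R Y x)) \<le> real k * h * \<epsilon>" by auto
qed

context findim
begin

text \<open>The derivative of \<open>m\<close> along \<open>Y y\<close> vanishes at
  \<open>y\<close>. Over a step of length \<open>h\<close> the change of \<open>m\<close> is thus
  governed by the variation of its derivative, which is uniformly continuous on the compact ball.
  The error is small compared with \<open>h\<close>, uniformly in \<open>y\<close>.\<close>

lemma uniform_first_order:
  fixes m :: "'e \<Rightarrow> real"
  assumes S: "open S" "cball x d \<subseteq> S" and m: "smooth_on S m"
    and B: "\<And>y. y \<in> cball x d \<Longrightarrow> norm (Y y) \<le> B" "B > 0"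
    and Y: "\<And>y. y \<in> S \<Longrightarrow> frechet_derivative m (at y) (Y y) = 0" and \<epsilon>: "\<epsilon> > 0"
  shows "\<exists>\<delta>>0. \<forall>y h. 0 \<le> h \<longrightarrow> h \<le> \<delta> \<longrightarrow> y \<in> cball x d \<longrightarrow> y + h *\<^sub>R Y y \<in> cball x d \<longrightarrow>
     \<bar>m (y + h *\<^sub>R Y y) - m y\<bar> \<le> \<epsilon> * h"
proof -
  define D where "D y = frechet_derivative m (at y)" for y
  have D: "(m has_derivative D y) (at y)" if "y \<in> S" for y
    unfolding D_def by (rule smooth_on_has_derivative[OF m that])
  obtain L where L: "L > 0" "\<And>v i. i < n \<Longrightarrow> \<bar>c i v\<bar> \<le> L * norm v" using coord_le by blast
  \<comment> \<open>Summing over \<open>n\<close> coordinates costs \<open>n * L\<close>, and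
    evaluation at a vector of norm at most \<open>B\<close> costs \<open>B\<close>; together the
    derivative along \<open>Y y\<close> varies by at most \<open>\<epsilon>\<close>.\<close>
  define e where "e = \<epsilon> / (L * B * (real n + 1))"
  have e: "e > 0" using \<epsilon> L B by (simp add: e_def)
  have "\<exists>\<delta>>0. \<forall>y\<in>cball x d. \<forall>z\<in>cball x d. dist z y < \<delta> \<longrightarrow> dist (D z (b i)) (D y (b i)) < e" for i
  proof -
    have "continuous_on (cball x d) (\<lambda>y. D y (b i))"
      unfolding D_def
      by (rule continuous_on_subset[OF smooth_on_imp_continuous_on[OF smooth_on_frechet_derivative[OF m]] S(2)])
    then have "uniformly_continuous_on (cball x d) (\<lambda>y. D y (b i))"
      by (rule compact_uniformly_continuous[OF _ compact_cball])
    then show ?thesis using e unfolding uniformly_continuous_on_def by blast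
  qed
  then have "\<forall>i. \<exists>\<delta>>0. \<forall>y\<in>cball x d. \<forall>z\<in>cball x d. dist z y < \<delta> \<longrightarrow> dist (D z (b i)) (D y (b i)) < e" by blast
  from choice[OF this] obtain \<delta>i where \<delta>i: "\<And>i. \<delta>i i > 0"
    "\<And>i y z. y \<in> cball x d \<Longrightarrow> z \<in> cball x d \<Longrightarrow> dist z y < \<delta>i i \<Longrightarrow> dist (D z (b i)) (D y (b i)) < e"
    by blast
  define \<delta>0 where "\<delta>0 = Min (\<delta>i ` {..n})"
  have \<delta>0: "\<delta>0 > 0" "\<And>i. i \<le> n \<Longrightarrow> \<delta>0 \<le> \<delta>i i" unfolding \<delta>0_def using \<delta>i(1) by auto
  have Dd: "\<bar>D z v - D y v\<bar> \<le> (\<epsilon> / B) * norm v" if yz: "y \<in> cball x d" "z \<in> cball x d" "dist z y < \<delta>0" for y z v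
  proof -
    have ex: "D w v = (\<Sum>i<n. c i v * D w (b i))" if "w \<in> cball x d" for w
    proof -
      have "D w (\<Sum>i<n. c i v *\<^sub>R b i) = (\<Sum>i<n. c i v * D w (b i))"
        using has_derivative_linear[OF D[of w]] that S(2) by (auto simp: linear_sum linear_scale)
      then show ?thesis by (simp only: expand)
    qed
    have "D z v - D y v = (\<Sum>i<n. c i v * (D z (b i) - D y (b i)))"
      by (simp add: ex[OF yz(1)] ex[OF yz(2)] sum_subtractf right_diff_distrib)
    also have "\<bar>\<dots>\<bar> \<le> (\<Sum>i<n. \<bar>c i v * (D z (b i) - D y (b i))\<bar>)" by (rule sum_abs)
    also have "\<dots> \<le> (\<Sum>i<n. (L * norm v) * e)"
    proof (rule sum_mono)
      fix i assume i: "i \<in> {..<n}"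
      then have "dist z y < \<delta>i i" using \<delta>0(2)[of i] yz(3) by auto
      then have "\<bar>D z (b i) - D y (b i)\<bar> \<le> e" using \<delta>i(2)[OF yz(1,2)] by (simp add: dist_real_def less_imp_le)
      then show "\<bar>c i v * (D z (b i) - D y (b i))\<bar> \<le> (L * norm v) * e"
        unfolding abs_mult using L i by (intro mult_mono) auto
    qed
    also have "\<dots> = (real n * L * e) * norm v" by simp
    also have "\<dots> \<le> (\<epsilon> / B) * norm v"
    proof (rule mult_right_mono)
      have "e * L * (real n + 1) = \<epsilon> / B" using L B by (simp add: e_def)
      moreover have "e * L > 0" using e L by simp
      ultimately show "real n * L * e \<le> \<epsilon> / B" by (simp add: algebra_simps)
    qed simp
    finally show ?thesis .
  qed
  have "\<bar>m (y + h *\<^sub>R Y y) - m y\<bar> \<le> \<epsilon> * h"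
    if h: "0 \<le> h" "h \<le> \<delta>0 / (2 * B)" and y: "y \<in> cball x d" "y + h *\<^sub>R Y y \<in> cball x d" for y h
  proof -
    define q where "q s = m (y + s *\<^sub>R Y y)" for s
    have seg: "y + s *\<^sub>R Y y \<in> cball x d" if "s \<in> {0..h}" for s
    proof (cases "h = 0")
      case False
      have "convex (cball x d)" by simp
      from convexD[OF this y, of "1 - s / h" "s / h"] False that h
      have "(1 - s / h) *\<^sub>R y + (s / h) *\<^sub>R (y + h *\<^sub>R Y y) \<in> cball x d" by (auto simp: field_simps)
      also have "(1 - s / h) *\<^sub>R y + (s / h) *\<^sub>R (y + h *\<^sub>R Y y) = y + s *\<^sub>R Y y"
        using False by (simp add: algebra_simps)
      finally show ?thesis .
    qed (use that y in simp)
    have qd: "(q has_derivative (\<lambda>r. D (y + s *\<^sub>R Y y) (r *\<^sub>R Y y))) (at s within {0..h})" if "s \<in> {0..h}" for s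
    proof -
      have "((\<lambda>s. y + s *\<^sub>R Y y) has_derivative (\<lambda>r. r *\<^sub>R Y y)) (at s)"
        by (auto intro!: derivative_eq_intros)
      moreover have "y + s *\<^sub>R Y y \<in> S" using seg[OF that] S(2) by blast
      ultimately have "((\<lambda>s. m (y + s *\<^sub>R Y y)) has_derivative (\<lambda>r. D (y + s *\<^sub>R Y y) (r *\<^sub>R Y y))) (at s)"
        by (rule has_derivative_compose[OF _ D])
      then show ?thesis unfolding q_def[abs_def] by (rule has_derivative_at_withinI)
    qed
    have bd: "onorm (\<lambda>r. D (y + s *\<^sub>R Y y) (r *\<^sub>R Y y)) \<le> \<epsilon>" if s: "s \<in> {0..h}" for s
    proof (rule onorm_bound)
      fix r
      have zS: "y + s *\<^sub>R Y y \<in> S" using seg[OF s] S(2) by blast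
      have "dist (y + s *\<^sub>R Y y) y = s * norm (Y y)" using s by (simp add: dist_norm)
      also have "\<dots> \<le> (\<delta>0 / (2 * B)) * B" using s h B y(1) by (intro mult_mono) auto
      also have "\<dots> < \<delta>0" using \<delta>0(1) B(2) by simp
      finally have "\<bar>D (y + s *\<^sub>R Y y) (Y y) - D y (Y y)\<bar> \<le> (\<epsilon> / B) * norm (Y y)"
        by (rule Dd[OF y(1) seg[OF s]])
      also have "\<dots> \<le> (\<epsilon> / B) * B" using \<epsilon> B y(1) by (intro mult_left_mono) auto
      also have "\<dots> = \<epsilon>" using B by simp
      finally have "\<bar>D (y + s *\<^sub>R Y y) (Y y)\<bar> \<le> \<epsilon>"
        using Y[of y] y(1) S(2) by (auto simp: D_def)
      moreover have "D (y + s *\<^sub>R Y y) (r *\<^sub>R Y y) = r * D (y + s *\<^sub>R Y y) (Y y)"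
        using has_derivative_linear[OF D[OF zS]] by (simp add: linear_scale)
      ultimately show "norm (D (y + s *\<^sub>R Y y) (r *\<^sub>R Y y)) \<le> \<epsilon> * norm r"
        by (simp add: abs_mult mult.commute[of \<epsilon>] mult_left_mono)
    qed (use \<epsilon> in simp)
    have "norm (q h - q 0) \<le> \<epsilon> * norm (h - 0)"
      by (rule differentiable_bound[OF _ qd bd]) (use h in auto)
    then show ?thesis using h by (simp add: q_def)
  qed
  moreover have "\<delta>0 / (2 * B) > 0" using \<delta>0 B by simp
  ultimately show ?thesis by blast
qed

text \<open>Euler polygons with \<open>N + 1\<close> steps of size \<open>t / (N + 1)\<close> change
  each \<open>m\<close> by \<open>o (1 / N)\<close> per step, hence by \<open>o (1)\<close> in
  total. A cluster point of their end points lies on the level set and is still within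
  \<open>t * \<epsilon>\<close> of the tangent line.\<close>

lemma level_set_near_tangent:
  fixes Y :: "'e \<Rightarrow> 'e" and MM :: "('e \<Rightarrow> real) set"
  assumes S: "open S" "x \<in> S" and Y: "continuous_on S Y"
    and m: "\<And>m. m \<in> MM \<Longrightarrow> smooth_on S m"
    and mY: "\<And>m y. m \<in> MM \<Longrightarrow> y \<in> S \<Longrightarrow> frechet_derivative m (at y) (Y y) = 0"
    and \<epsilon>: "\<epsilon> > 0"
  shows "\<exists>t1>0. \<forall>t. 0 < t \<longrightarrow> t \<le> t1 \<longrightarrow>
     (\<exists>p\<in>S. (\<forall>m\<in>MM. m p = m x) \<and> norm (p - (x + t *\<^sub>R Y x)) \<le> t * \<epsilon>)"
proof -
  obtain d0 where d0: "d0 > 0" "cball x d0 \<subseteq> S" using S open_contains_cball by blast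
  have "isCont Y x" using S Y continuous_on_eq_continuous_at by blast
  then obtain d1 where d1: "d1 > 0" "\<And>y. dist y x < d1 \<Longrightarrow> dist (Y y) (Y x) < \<epsilon>"
    using \<epsilon> unfolding continuous_at_eps_delta by blast
  define d where "d = min d0 (d1 / 2)"
  have d: "d > 0" "cball x d \<subseteq> S" using d0 d1 by (auto simp: d_def)
  have dY: "norm (Y y - Y x) \<le> \<epsilon>" if "y \<in> cball x d" for y
  proof -
    have "dist (Y y) (Y x) < \<epsilon>"
      by (rule d1(2)) (use that d1(1) in \<open>auto simp: d_def dist_commute\<close>)
    then show ?thesis by (simp add: dist_norm)
  qed
  define B where "B = norm (Y x) + \<epsilon>"
  have B: "B > 0" using \<epsilon> by (simp add: B_def add_nonneg_pos)
  have BY: "norm (Y y) \<le> B" if "y \<in> cball x d" for y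
    using dY[OF that] norm_triangle_sub[of "Y y" "Y x"] by (simp add: B_def)
  have "\<exists>p\<in>S. (\<forall>m\<in>MM. m p = m x) \<and> norm (p - (x + t *\<^sub>R Y x)) \<le> t * \<epsilon>" if t: "0 < t" "t \<le> d / B" for t
  proof -
    define h where "h N = t / real (Suc N)" for N
    have h: "h N > 0" "real (Suc N) * h N = t" for N using t by (simp_all add: h_def)
    define z where "z N = euler Y x (h N)" for N
    \<comment> \<open>A polygon of total time \<open>t\<close> has length at most
      \<open>t * B\<close>, so \<open>t \<le> d / B\<close> keeps every vertex in the ball on which
      the estimates hold.\<close>
    have tB: "t * B \<le> d" using t B by (simp add: field_simps)
    have khB: "real k * h N * B \<le> d" if "k \<le> Suc N" for k N
    proof -
      have "real k * h N * B \<le> real (Suc N) * h N * B"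
        using that h(1)[of N] B by (intro mult_right_mono) auto
      then show ?thesis using h(2)[of N] tB by simp
    qed
    have zin: "z N k \<in> cball x d" if "k \<le> Suc N" for k N
      using euler_bounds(1)[where x = x and d = d and Y = Y and B = B and \<epsilon> = \<epsilon> and h = "h N" and k = k, OF BY dY less_imp_le[OF h(1)] less_imp_le[OF B] khB[OF that]] khB[OF that]
      by (simp add: z_def dist_norm norm_minus_commute)
    have zend: "norm (z N (Suc N) - (x + t *\<^sub>R Y x)) \<le> t * \<epsilon>" for N
      using euler_bounds(2)[where x = x and d = d and Y = Y and B = B and \<epsilon> = \<epsilon> and h = "h N" and k = "Suc N", OF BY dY less_imp_le[OF h(1)] less_imp_le[OF B] khB[OF order_refl]]
      unfolding h(2) z_def .
    have mlim: "(\<lambda>N. m (z N (Suc N))) \<longlonglongrightarrow> m x" if mM: "m \<in> MM" for m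
      unfolding LIMSEQ_iff
    proof (intro allI impI)
      fix r :: real assume r: "r > 0"
      \<comment> \<open>The errors of all steps add up to \<open>e * t = r / 2\<close>.\<close>
      define e where "e = r / (2 * t)"
      have e: "e > 0" using r t by (simp add: e_def)
      obtain \<delta> where \<delta>: "\<delta> > 0" "\<And>y h. 0 \<le> h \<Longrightarrow> h \<le> \<delta> \<Longrightarrow> y \<in> cball x d \<Longrightarrow> y + h *\<^sub>R Y y \<in> cball x d \<Longrightarrow>
          \<bar>m (y + h *\<^sub>R Y y) - m y\<bar> \<le> e * h"
        using uniform_first_order[OF S(1) d(2) m[OF mM] BY B mY[OF mM] e] by blast
      obtain N0 where N0: "t / \<delta> \<le> real N0" using real_arch_simple by blast
      have "norm (m (z N (Suc N)) - m x) < r" if N: "N \<ge> N0" for N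
      proof -
        have "t / \<delta> \<le> real (Suc N)" using N0 N by linarith
        then have h\<delta>: "h N \<le> \<delta>" using \<delta>(1) by (simp add: h_def field_simps)
        have "\<bar>m (z N k) - m x\<bar> \<le> real k * (e * h N)" if "k \<le> Suc N" for k
          using that
        proof (induction k)
          case (Suc k)
          have "\<bar>m (z N (Suc k)) - m (z N k)\<bar> \<le> e * h N"
            using \<delta>(2)[OF less_imp_le[OF h(1)] h\<delta> zin[of k N]] zin[of "Suc k" N] Suc.prems by (simp add: z_def)
          then show ?case using Suc by (simp add: algebra_simps)
        qed (simp add: z_def)
        from this[of "Suc N"] have "\<bar>m (z N (Suc N)) - m x\<bar> \<le> e * (real (Suc N) * h N)"
          by (simp only: order_refl mult_ac)
        also have "\<dots> = r / 2" unfolding h(2) using t by (simp add: e_def)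
        finally have "\<bar>m (z N (Suc N)) - m x\<bar> \<le> r / 2" .
        then show ?thesis using r unfolding real_norm_def by linarith
      qed
      then show "\<exists>N0. \<forall>N\<ge>N0. norm (m (z N (Suc N)) - m x) < r" by blast
    qed
    \<comment> \<open>One cluster point serves all of \<open>MM\<close>: along the subsequence each
      \<open>m\<close> tends both to \<open>m p\<close> and to \<open>m x\<close>.\<close>
    have "seq_compact (cball x d)" using compact_cball compact_imp_seq_compact by blast
    then obtain p \<sigma> where p: "p \<in> cball x d" "strict_mono \<sigma>" "((\<lambda>N. z N (Suc N)) \<circ> \<sigma>) \<longlonglongrightarrow> p"
      by (rule seq_compactE[of _ "\<lambda>N. z N (Suc N)"]) (use zin in auto)
    have "m p = m x" if mM: "m \<in> MM" for m
    proof -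
      have "isCont m p"
        using smooth_on_imp_continuous_on[OF m[OF mM]] S(1) p(1) d(2) continuous_on_eq_continuous_at by blast
      then have "(\<lambda>N. m (((\<lambda>N. z N (Suc N)) \<circ> \<sigma>) N)) \<longlonglongrightarrow> m p"
        using p(3) by (rule isCont_tendsto_compose)
      moreover have "(\<lambda>N. m (((\<lambda>N. z N (Suc N)) \<circ> \<sigma>) N)) \<longlonglongrightarrow> m x"
        using LIMSEQ_subseq_LIMSEQ[OF mlim[OF mM] p(2)] unfolding comp_def .
      ultimately show ?thesis by (rule LIMSEQ_unique)
    qed
    moreover have "norm (p - (x + t *\<^sub>R Y x)) \<le> t * \<epsilon>"
    proof (rule Lim_bounded)
      show "(\<lambda>N. norm (((\<lambda>N. z N (Suc N)) \<circ> \<sigma>) N - (x + t *\<^sub>R Y x))) \<longlonglongrightarrow> norm (p - (x + t *\<^sub>R Y x))"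
        by (intro tendsto_intros p(3))
      show "\<forall>N\<ge>0. norm (((\<lambda>N. z N (Suc N)) \<circ> \<sigma>) N - (x + t *\<^sub>R Y x)) \<le> t * \<epsilon>"
        using zend by simp
    qed
    ultimately show ?thesis using p(1) d(2) by blast
  qed
  moreover have "d / B > 0" using d B by simp
  ultimately show ?thesis by blast
qed

text \<open>If \<open>Y\<close> is tangent to the level sets of the functions in \<open>MM\<close>, then the integral curve of \<open>Y\<close>
  from \<open>x\<close> stays in the level set of \<open>x\<close>. Limits of Euler polygons replace this curve, so that
  no existence theorem for ordinary differential equations is needed.\<close>

lemma derivative_zero_on_level_set:
  fixes Y :: "'e \<Rightarrow> 'e" and f :: "'e \<Rightarrow> real" and MM :: "('e \<Rightarrow> real) set"
  assumes S: "open S" "x \<in> S" and Y: "continuous_on S Y"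
    and m: "\<And>m. m \<in> MM \<Longrightarrow> smooth_on S m"
    and mY: "\<And>m y. m \<in> MM \<Longrightarrow> y \<in> S \<Longrightarrow> frechet_derivative m (at y) (Y y) = 0"
    and f: "(f has_derivative D) (at x)"
    and f0: "\<And>y. y \<in> S \<Longrightarrow> (\<And>m. m \<in> MM \<Longrightarrow> m y = m x) \<Longrightarrow> f y = f x"
  shows "D (Y x) = 0"
proof -
  obtain C where C: "C > 0" "\<And>v. norm (D v) \<le> norm v * C"
    using bounded_linear.pos_bounded[OF has_derivative_bounded_linear[OF f]] by blast
  have linD: "linear D" using has_derivative_linear[OF f] .
  have "\<bar>D (Y x)\<bar> \<le> \<epsilon> * (C + norm (Y x) + 1)" if \<epsilon>: "0 < \<epsilon>" "\<epsilon> < 1" for \<epsilon>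
  proof -
    obtain t1 where t1: "t1 > 0" "\<And>t. 0 < t \<Longrightarrow> t \<le> t1 \<Longrightarrow>
       \<exists>p\<in>S. (\<forall>m\<in>MM. m p = m x) \<and> norm (p - (x + t *\<^sub>R Y x)) \<le> t * \<epsilon>"
      using level_set_near_tangent[OF S Y m mY \<epsilon>(1)] by blast
    obtain d where d: "d > 0" "\<And>y. norm (y - x) < d \<Longrightarrow> norm (f y - f x - D (y - x)) \<le> \<epsilon> * norm (y - x)"
      using f \<epsilon>(1) unfolding has_derivative_at_alt by blast
    \<comment> \<open>The second bound makes \<open>t * (norm (Y x) + 1) \<le> d / 2\<close>.
      Because \<open>\<epsilon> < 1\<close>, this puts \<open>p\<close> within distance
      \<open>d\<close> of \<open>x\<close>, where the first-order expansion of \<open>f\<close> is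
      valid.\<close>
    define t where "t = min t1 (d / (2 * (norm (Y x) + 1)))"
    have N: "norm (Y x) + 1 > 0" by (simp add: add_nonneg_pos)
    have t: "t > 0" "t \<le> t1" using t1 d N by (auto simp: t_def)
    have "t \<le> d / (2 * (norm (Y x) + 1))" by (simp add: t_def)
    then have td: "t * (norm (Y x) + 1) \<le> d / 2" using N by (simp add: field_simps)
    obtain p where p: "p \<in> S" "\<And>m. m \<in> MM \<Longrightarrow> m p = m x" "norm (p - (x + t *\<^sub>R Y x)) \<le> t * \<epsilon>"
      using t1(2)[OF t] by blast
    let ?w = "p - (x + t *\<^sub>R Y x)"
    have px: "p - x = t *\<^sub>R Y x + ?w" by simp
    have "norm (p - x) \<le> norm (t *\<^sub>R Y x) + norm ?w" unfolding px by (rule norm_triangle_ineq)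
    also have "\<dots> \<le> t * norm (Y x) + t * \<epsilon>" using t p(3) by simp
    also have "\<dots> \<le> t * (norm (Y x) + 1)" using t \<epsilon> by (simp add: algebra_simps)
    finally have npx: "norm (p - x) \<le> t * (norm (Y x) + 1)" .
    then have "norm (p - x) < d" using td d(1) by linarith
    then have "\<bar>D (p - x)\<bar> \<le> \<epsilon> * norm (p - x)" using d(2)[of p] f0[OF p(1,2)] by simp
    also have "\<dots> \<le> \<epsilon> * (t * (norm (Y x) + 1))" using npx \<epsilon> by (intro mult_left_mono) auto
    finally have 1: "\<bar>D (p - x)\<bar> \<le> t * (\<epsilon> * (norm (Y x) + 1))" by (simp add: mult_ac)
    have "D (p - x) = t * D (Y x) + D ?w"
      unfolding px linear_add[OF linD] linear_scale[OF linD] by simp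
    moreover have "\<bar>D ?w\<bar> \<le> (t * \<epsilon>) * C"
      using order_trans[OF C(2)[of ?w] mult_right_mono[OF p(3)]] C(1) by simp
    ultimately have "\<bar>t * D (Y x)\<bar> \<le> t * (\<epsilon> * (norm (Y x) + 1)) + (t * \<epsilon>) * C"
      using 1 by linarith
    also have "\<dots> = t * (\<epsilon> * (C + norm (Y x) + 1))" by (simp add: algebra_simps)
    finally show ?thesis using t(1) by (simp add: abs_mult)
  qed
  note * = this
  have "\<bar>D (Y x)\<bar> \<le> 0"
  proof (rule field_le_epsilon)
    fix e :: real assume e: "e > 0"
    define Q where "Q = C + norm (Y x) + 1"
    have Q: "Q > 0" using C(1) by (simp add: Q_def add_pos_nonneg)
    define \<epsilon> where "\<epsilon> = min (1 / 2) (e / Q)"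
    have "\<bar>D (Y x)\<bar> \<le> \<epsilon> * Q" using *[of \<epsilon>] e Q by (simp add: \<epsilon>_def Q_def)
    also have "\<dots> \<le> (e / Q) * Q" using Q by (intro mult_right_mono) (auto simp: \<epsilon>_def)
    finally show "\<bar>D (Y x)\<bar> \<le> 0 + e" using Q by simp
  qed
  then show ?thesis by simp
qed

end

section \<open>An invariant functional on a group\<close>

definition Cc :: "('g::topological_space \<Rightarrow> real) set" where
  "Cc = {f. continuous_on UNIV f \<and> (\<exists>K. compact K \<and> (\<forall>x. x \<notin> K \<longrightarrow> f x = 0))}"

definition Cc_nonneg :: "('g::topological_space \<Rightarrow> real) set" where
  "Cc_nonneg = {f \<in> Cc. \<forall>x. 0 \<le> f x}"

lemma Cc_lincomb: "f \<in> Cc \<Longrightarrow> g \<in> Cc \<Longrightarrow> (\<lambda>x. r * f x + s * g x) \<in> Cc"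
proof -
  assume f: "f \<in> Cc" and g: "g \<in> Cc"
  obtain K L where "compact K" "\<And>x. x \<notin> K \<Longrightarrow> f x = 0" "compact L" "\<And>x. x \<notin> L \<Longrightarrow> g x = 0"
    using f g unfolding Cc_def by blast
  then have "compact (K \<union> L)" "\<forall>x. x \<notin> K \<union> L \<longrightarrow> r * f x + s * g x = 0" by auto
  moreover have "continuous_on UNIV (\<lambda>x. r * f x + s * g x)"
    using f g unfolding Cc_def by (auto intro!: continuous_intros)
  ultimately show ?thesis unfolding Cc_def by blast
qed

lemma Cc_max_0: "f \<in> Cc \<Longrightarrow> (\<lambda>x. max (f x) 0) \<in> Cc_nonneg"
proof -
  assume f: "f \<in> Cc"
  then obtain K where K: "compact K" "\<And>x. x \<notin> K \<Longrightarrow> f x = 0" unfolding Cc_def by blast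
  then have "compact K" "\<forall>x. x \<notin> K \<longrightarrow> max (f x) 0 = 0" by auto
  moreover have "continuous_on UNIV (\<lambda>x. max (f x) 0)"
    using f unfolding Cc_def by (auto intro!: continuous_intros)
  ultimately show ?thesis unfolding Cc_nonneg_def Cc_def by auto
qed

lemma Cc_nonneg_zero: "(\<lambda>_. 0) \<in> Cc_nonneg"
  unfolding Cc_nonneg_def Cc_def by (auto intro!: exI[of _ "{}"])

lemma Cc_nonneg_add: "f \<in> Cc_nonneg \<Longrightarrow> g \<in> Cc_nonneg \<Longrightarrow> (\<lambda>x. f x + g x) \<in> Cc_nonneg"
  using Cc_lincomb[of f g 1 1] unfolding Cc_nonneg_def by simp

lemma Cc_nonneg_scale: "f \<in> Cc_nonneg \<Longrightarrow> r \<ge> 0 \<Longrightarrow> (\<lambda>x. r * f x) \<in> Cc_nonneg"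
  using Cc_lincomb[of f f r 0] unfolding Cc_nonneg_def by simp

lemma Cc_nonnegD: "f \<in> Cc_nonneg \<Longrightarrow> 0 \<le> f x" "f \<in> Cc_nonneg \<Longrightarrow> continuous_on UNIV f"
  "f \<in> Cc_nonneg \<Longrightarrow> f \<in> Cc"
  unfolding Cc_nonneg_def Cc_def by auto

lemma Cc_bounded:
  assumes "f \<in> Cc" obtains B where "B > 0" "\<And>x. \<bar>f x\<bar> \<le> B"
proof -
  obtain K where K: "compact K" "\<And>x. x \<notin> K \<Longrightarrow> f x = 0" using assms unfolding Cc_def by blast
  have "continuous_on K f" using assms continuous_on_subset unfolding Cc_def by blast
  then have "bounded (f ` K)" using K(1) compact_continuous_image compact_imp_bounded by blast
  then obtain B where B: "B > 0" "\<And>y. y \<in> f ` K \<Longrightarrow> norm y \<le> B" unfolding bounded_pos by blast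
  have "\<bar>f x\<bar> \<le> B" for x using K(2)[of x] B by (cases "x \<in> K") auto
  then show ?thesis using that B(1) by blast
qed

text \<open>The form in which local compactness enters: every neighbourhood of the unit supports a
  nonzero nonnegative function of compact support. On a Lie group, smooth bumps in a chart provide
  it.\<close>

locale bump_group = group G for G :: "'g::t2_space monoid" (structure) +
  assumes carrier_UNIV: "carrier G = UNIV"
    and mult_continuous: "continuous_on UNIV (\<lambda>(g, h). g \<otimes> h)"
    and inv_continuous: "continuous_on UNIV (\<lambda>g. inv g)"
    and bump_at_one: "open V \<Longrightarrow> \<one> \<in> V \<Longrightarrow> \<exists>\<phi>\<in>Cc_nonneg. \<phi> \<one> > 0 \<and> (\<forall>g. g \<notin> V \<longrightarrow> \<phi> g = 0)"
begin

lemma closed_simps [simp]: "x \<in> carrier G" by (simp add: carrier_UNIV)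

lemma mult_assoc: "x \<otimes> y \<otimes> z = x \<otimes> (y \<otimes> z)" by (simp add: m_assoc)

lemma inv_mult_cancel [simp]: "inv x \<otimes> (x \<otimes> y) = y" "x \<otimes> (inv x \<otimes> y) = y"
  by (simp_all flip: mult_assoc)

lemma continuous_mult:
  "continuous_on S f \<Longrightarrow> continuous_on S g \<Longrightarrow> continuous_on S (\<lambda>x. f x \<otimes> g x)"
  using continuous_on_compose2[OF mult_continuous, of S "\<lambda>x. (f x, g x)"]
  by (simp add: continuous_on_Pair)

lemma continuous_inv: "continuous_on S f \<Longrightarrow> continuous_on S (\<lambda>x. inv (f x))"
  using continuous_on_compose2[OF inv_continuous, of S f] by simp

lemma Cc_translate: "f \<in> Cc \<Longrightarrow> (\<lambda>g. f (g \<otimes> h)) \<in> Cc"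
proof -
  assume f: "f \<in> Cc"
  then obtain K where K: "compact K" "\<And>x. x \<notin> K \<Longrightarrow> f x = 0" unfolding Cc_def by blast
  have "compact ((\<lambda>g. g \<otimes> inv h) ` K)"
    by (intro compact_continuous_image continuous_mult continuous_intros K)
  moreover have "f (g \<otimes> h) = 0" if "g \<notin> (\<lambda>g. g \<otimes> inv h) ` K" for g
  proof (rule K(2), rule notI)
    assume "g \<otimes> h \<in> K"
    then have "(g \<otimes> h) \<otimes> inv h \<in> (\<lambda>g. g \<otimes> inv h) ` K" by blast
    then show False using that by (simp add: mult_assoc)
  qed
  moreover have "continuous_on UNIV (\<lambda>g. f (g \<otimes> h))"
    by (rule continuous_on_compose2[of UNIV f]) (use f in \<open>auto simp: Cc_def intro!: continuous_mult continuous_intros\<close>)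
  ultimately show ?thesis unfolding Cc_def by blast
qed

lemma Cc_nonneg_translate: "f \<in> Cc_nonneg \<Longrightarrow> (\<lambda>g. f (g \<otimes> h)) \<in> Cc_nonneg"
  using Cc_translate unfolding Cc_nonneg_def by blast

section \<open>Haar's covering ratios\<close>

definition covers :: "('g \<Rightarrow> real) \<Rightarrow> ('g \<Rightarrow> real) \<Rightarrow> (real \<times> 'g) list \<Rightarrow> bool" where
  "covers f \<phi> xs \<longleftrightarrow> (\<forall>x\<in>set xs. 0 \<le> fst x) \<and> (\<forall>g. f g \<le> (\<Sum>x\<leftarrow>xs. fst x * \<phi> (g \<otimes> snd x)))"

abbreviation weight :: "(real \<times> 'g) list \<Rightarrow> real" where
  "weight xs \<equiv> sum_list (map fst xs)"

text \<open>Haar's covering number (f : phi) in Weil's version for functions. It measures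
  \<open>f\<close> in units of right translates of \<open>\<phi>\<close>, and the quotients of two
  such numbers approximate an invariant integral as the support of \<open>\<phi>\<close>
  shrinks.\<close>

definition ratio :: "('g \<Rightarrow> real) \<Rightarrow> ('g \<Rightarrow> real) \<Rightarrow> real" where
  "ratio f \<phi> = Inf (weight ` {xs. covers f \<phi> xs})"

lemma weight_nonneg: "covers f \<phi> xs \<Longrightarrow> 0 \<le> weight xs"
  unfolding covers_def by (intro sum_list_nonneg) auto

text \<open>Finitely many translates of the open set where \<open>\<phi>\<close> exceeds half of
  \<open>\<phi> g0\<close> cover \<open>K\<close>. Each gets the weight \<open>1 / a\<close>, so
  that one of the terms already reaches 1.\<close>

lemma cover_compact:
  assumes K: "compact K" and \<phi>: "\<phi> \<in> Cc_nonneg" "\<phi> g0 > 0"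
  obtains xs where "\<And>x. x \<in> set xs \<Longrightarrow> 0 \<le> fst x" "\<And>g. g \<in> K \<Longrightarrow> 1 \<le> (\<Sum>x\<leftarrow>xs. fst x * \<phi> (g \<otimes> snd x))"
proof -
  define a where "a = \<phi> g0 / 2"
  have a: "a > 0" "a < \<phi> g0" using \<phi> by (auto simp: a_def)
  define U where "U s = {g. \<phi> (g \<otimes> s) > a}" for s
  have "open (U s)" for s
    unfolding U_def using Cc_nonnegD(2)[OF Cc_nonneg_translate[OF \<phi>(1)]]
    by (intro open_Collect_less continuous_intros) auto
  moreover have "K \<subseteq> (\<Union>s\<in>UNIV. U s)"
  proof
    fix g assume "g \<in> K"
    have "g \<in> U (inv g \<otimes> g0)" using a by (simp add: U_def)
    then show "g \<in> (\<Union>s\<in>UNIV. U s)" by blast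
  qed
  ultimately obtain S where S: "finite S" "K \<subseteq> (\<Union>s\<in>S. U s)"
    using compactE_image[OF K, of UNIV U] by metis
  obtain l where l: "set l = S" using finite_list[OF S(1)] by blast
  define xs where "xs = map (\<lambda>s. (1 / a, s)) l"
  have "1 \<le> (\<Sum>x\<leftarrow>xs. fst x * \<phi> (g \<otimes> snd x))" if "g \<in> K" for g
  proof -
    have "\<exists>s\<in>set l. \<phi> (g \<otimes> s) > a" using S(2) that unfolding U_def l by blast
    then obtain s where s: "s \<in> set l" "\<phi> (g \<otimes> s) > a" by blast
    have "1 \<le> 1 / a * \<phi> (g \<otimes> s)" using s a by (simp add: field_simps)
    also have "\<dots> \<le> (\<Sum>x\<leftarrow>xs. fst x * \<phi> (g \<otimes> snd x))"
      using s(1) a Cc_nonnegD(1)[OF \<phi>(1)] unfolding xs_def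
      by (intro member_le_sum_list) (auto simp: image_iff)
    finally show ?thesis .
  qed
  moreover have "0 \<le> fst x" if "x \<in> set xs" for x using that a by (auto simp: xs_def)
  ultimately show ?thesis using that by blast
qed

lemma covers_exists:
  assumes f: "f \<in> Cc_nonneg" and \<phi>: "\<phi> \<in> Cc_nonneg" "\<phi> g0 > 0"
  shows "\<exists>xs. covers f \<phi> xs"
proof -
  obtain K where K: "compact K" "\<And>x. x \<notin> K \<Longrightarrow> f x = 0"
    using Cc_nonnegD(3)[OF f] unfolding Cc_def by blast
  obtain B where B: "B > 0" "\<And>x. \<bar>f x\<bar> \<le> B" by (rule Cc_bounded[OF Cc_nonnegD(3)[OF f]]) blast
  obtain xs where xs: "\<And>x. x \<in> set xs \<Longrightarrow> 0 \<le> fst x" "\<And>g. g \<in> K \<Longrightarrow> 1 \<le> (\<Sum>x\<leftarrow>xs. fst x * \<phi> (g \<otimes> snd x))"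
    by (rule cover_compact[OF K(1) \<phi>]) blast
  have eq: "(\<Sum>x\<leftarrow>map (\<lambda>x. (B * fst x, snd x)) xs. fst x * \<phi> (g \<otimes> snd x)) = B * (\<Sum>x\<leftarrow>xs. fst x * \<phi> (g \<otimes> snd x))" for g
    by (simp add: comp_def sum_list_const_mult mult.assoc)
  have "f g \<le> B * (\<Sum>x\<leftarrow>xs. fst x * \<phi> (g \<otimes> snd x))" for g
  proof (cases "g \<in> K")
    case True
    have "f g \<le> B * 1" using B(2)[of g] by simp
    also have "\<dots> \<le> B * (\<Sum>x\<leftarrow>xs. fst x * \<phi> (g \<otimes> snd x))" using xs(2)[OF True] B(1) by (intro mult_left_mono) auto
    finally show ?thesis .
  next
    case False
    have "0 \<le> (\<Sum>x\<leftarrow>xs. fst x * \<phi> (g \<otimes> snd x))"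
      using xs(1) Cc_nonnegD(1)[OF \<phi>(1)] by (intro sum_list_nonneg) auto
    then show ?thesis using K(2)[OF False] B(1) by simp
  qed
  then have "covers f \<phi> (map (\<lambda>x. (B * fst x, snd x)) xs)"
    unfolding covers_def eq using xs(1) B(1) by auto
  then show ?thesis by blast
qed

lemma ratio_le: "covers f \<phi> xs \<Longrightarrow> ratio f \<phi> \<le> weight xs"
  unfolding ratio_def by (rule cInf_lower) (auto intro!: bdd_belowI[of _ 0] weight_nonneg)

lemma ratio_greatest:
  assumes f: "f \<in> Cc_nonneg" and \<phi>: "\<phi> \<in> Cc_nonneg" "\<phi> g0 > 0"
    and "\<And>xs. covers f \<phi> xs \<Longrightarrow> y \<le> weight xs"
  shows "y \<le> ratio f \<phi>"
  unfolding ratio_def using covers_exists[OF f \<phi>] assms(4) by (intro cInf_greatest) auto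

lemma ratio_nonneg: "f \<in> Cc_nonneg \<Longrightarrow> \<phi> \<in> Cc_nonneg \<Longrightarrow> \<phi> g0 > 0 \<Longrightarrow> 0 \<le> ratio f \<phi>"
  by (rule ratio_greatest) (auto intro: weight_nonneg)

lemma ratio_add:
  assumes f1: "f1 \<in> Cc_nonneg" and f2: "f2 \<in> Cc_nonneg" and \<phi>: "\<phi> \<in> Cc_nonneg" "\<phi> g0 > 0"
  shows "ratio (\<lambda>g. f1 g + f2 g) \<phi> \<le> ratio f1 \<phi> + ratio f2 \<phi>"
proof -
  have "ratio (\<lambda>g. f1 g + f2 g) \<phi> - ratio f2 \<phi> \<le> ratio f1 \<phi>"
  proof (rule ratio_greatest[OF f1 \<phi>])
    fix xs assume xs: "covers f1 \<phi> xs"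
    have "ratio (\<lambda>g. f1 g + f2 g) \<phi> - weight xs \<le> ratio f2 \<phi>"
    proof (rule ratio_greatest[OF f2 \<phi>])
      fix ys assume "covers f2 \<phi> ys"
      then have "covers (\<lambda>g. f1 g + f2 g) \<phi> (xs @ ys)"
        using xs unfolding covers_def by (auto intro: add_mono)
      from ratio_le[OF this] show "ratio (\<lambda>g. f1 g + f2 g) \<phi> - weight xs \<le> weight ys" by simp
    qed
    then show "ratio (\<lambda>g. f1 g + f2 g) \<phi> - ratio f2 \<phi> \<le> weight xs" by simp
  qed
  then show ?thesis by simp
qed

lemma ratio_scale_le:
  assumes f: "f \<in> Cc_nonneg" and \<phi>: "\<phi> \<in> Cc_nonneg" "\<phi> g0 > 0" and r: "r > 0"
  shows "ratio (\<lambda>g. r * f g) \<phi> \<le> r * ratio f \<phi>"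
proof -
  have "ratio (\<lambda>g. r * f g) \<phi> / r \<le> ratio f \<phi>"
  proof (rule ratio_greatest[OF f \<phi>])
    fix xs assume xs: "covers f \<phi> xs"
    have eq: "(\<Sum>x\<leftarrow>map (\<lambda>x. (r * fst x, snd x)) xs. fst x * \<phi> (g \<otimes> snd x)) = r * (\<Sum>x\<leftarrow>xs. fst x * \<phi> (g \<otimes> snd x))" for g
      by (simp add: comp_def sum_list_const_mult mult.assoc)
    have "covers (\<lambda>g. r * f g) \<phi> (map (\<lambda>x. (r * fst x, snd x)) xs)"
      using xs r unfolding covers_def eq by (auto intro: mult_left_mono)
    from ratio_le[OF this] show "ratio (\<lambda>g. r * f g) \<phi> / r \<le> weight xs"
      using r by (simp add: comp_def sum_list_const_mult field_simps)
  qed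
  then show ?thesis using r by (simp add: field_simps)
qed

lemma ratio_scale:
  assumes f: "f \<in> Cc_nonneg" and \<phi>: "\<phi> \<in> Cc_nonneg" "\<phi> g0 > 0" and r: "r > 0"
  shows "ratio (\<lambda>g. r * f g) \<phi> = r * ratio f \<phi>"
proof (rule antisym[OF ratio_scale_le[OF assms]])
  have "ratio (\<lambda>g. inverse r * (r * f g)) \<phi> \<le> inverse r * ratio (\<lambda>g. r * f g) \<phi>"
    using r by (intro ratio_scale_le[OF Cc_nonneg_scale[OF f] \<phi>]) auto
  then show "r * ratio f \<phi> \<le> ratio (\<lambda>g. r * f g) \<phi>" using r by (simp add: field_simps)
qed

text \<open>A right translation of \<open>f\<close> is absorbed by the points of a cover, since
  \<open>(g h) s = g (h s)\<close>. Right invariance of the limit functional has its origin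
  here.\<close>

lemma ratio_translate_le:
  assumes f: "f \<in> Cc_nonneg" and \<phi>: "\<phi> \<in> Cc_nonneg" "\<phi> g0 > 0"
  shows "ratio (\<lambda>g. f (g \<otimes> h)) \<phi> \<le> ratio f \<phi>"
proof (rule ratio_greatest[OF f \<phi>])
  fix xs assume "covers f \<phi> xs"
  then have "covers (\<lambda>g. f (g \<otimes> h)) \<phi> (map (\<lambda>x. (fst x, h \<otimes> snd x)) xs)"
    unfolding covers_def by (auto simp: comp_def mult_assoc[symmetric])
  from ratio_le[OF this] show "ratio (\<lambda>g. f (g \<otimes> h)) \<phi> \<le> weight xs" by (simp add: comp_def)
qed

lemma ratio_translate:
  assumes f: "f \<in> Cc_nonneg" and \<phi>: "\<phi> \<in> Cc_nonneg" "\<phi> g0 > 0"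
  shows "ratio (\<lambda>g. f (g \<otimes> h)) \<phi> = ratio f \<phi>"
proof (rule antisym[OF ratio_translate_le[OF assms]])
  show "ratio f \<phi> \<le> ratio (\<lambda>g. f (g \<otimes> h)) \<phi>"
    using ratio_translate_le[OF Cc_nonneg_translate[OF f, of h] \<phi>, of "inv h"] by (simp add: mult_assoc)
qed

text \<open>Covers compose: replacing each translate of \<open>\<psi>\<close> by a translated cover
  of \<open>\<psi>\<close> multiplies the weights. This confines the normalised ratios to intervals
  independent of \<open>\<phi>\<close>.\<close>

lemma ratio_trans:
  assumes f: "f \<in> Cc_nonneg" and \<psi>: "\<psi> \<in> Cc_nonneg" "\<psi> g1 > 0" and \<phi>: "\<phi> \<in> Cc_nonneg" "\<phi> g0 > 0"
  shows "ratio f \<phi> \<le> ratio f \<psi> * ratio \<psi> \<phi>"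
proof -
  have 1: "ratio f \<phi> \<le> weight xs * weight ys" if xs: "covers f \<psi> xs" and ys: "covers \<psi> \<phi> ys" for xs ys
  proof -
    define zs where "zs = concat (map (\<lambda>x. map (\<lambda>y. (fst x * fst y, snd x \<otimes> snd y)) ys) xs)"
    have sum_zs: "(\<Sum>z\<leftarrow>zs. fst z * F (snd z)) = (\<Sum>x\<leftarrow>xs. fst x * (\<Sum>y\<leftarrow>ys. fst y * F (snd x \<otimes> snd y)))" for F
      unfolding zs_def by (induction xs) (simp_all add: comp_def sum_list_const_mult mult.assoc)
    have "covers f \<phi> zs"
      unfolding covers_def
    proof (intro conjI allI ballI)
      fix z assume "z \<in> set zs"
      then show "0 \<le> fst z" using xs ys by (fastforce simp: zs_def covers_def intro!: mult_nonneg_nonneg)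
    next
      fix g
      have "f g \<le> (\<Sum>x\<leftarrow>xs. fst x * \<psi> (g \<otimes> snd x))" using xs by (simp add: covers_def)
      also have "\<dots> \<le> (\<Sum>x\<leftarrow>xs. fst x * (\<Sum>y\<leftarrow>ys. fst y * \<phi> (g \<otimes> snd x \<otimes> snd y)))"
        using xs ys unfolding covers_def by (intro sum_list_mono mult_left_mono) auto
      also have "\<dots> = (\<Sum>z\<leftarrow>zs. fst z * \<phi> (g \<otimes> snd z))"
        using sum_zs[of "\<lambda>s. \<phi> (g \<otimes> s)"] by (simp add: mult_assoc)
      finally show "f g \<le> (\<Sum>z\<leftarrow>zs. fst z * \<phi> (g \<otimes> snd z))" .
    qed
    then have "ratio f \<phi> \<le> weight zs" by (rule ratio_le)
    also have "weight zs = (\<Sum>x\<leftarrow>xs. fst x * weight ys)"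
      using sum_zs[of "\<lambda>_. 1"] by simp
    also have "\<dots> = weight xs * weight ys" by (simp add: sum_list_mult_const)
    finally show ?thesis .
  qed
  have pos: "0 \<le> ratio \<psi> \<phi>" by (rule ratio_nonneg[OF \<psi>(1) \<phi>])
  have 2: "ratio f \<phi> \<le> weight xs * ratio \<psi> \<phi>" if xs: "covers f \<psi> xs" for xs
  \<comment> \<open>Passing to the infimum over \<open>ys\<close> divides by the weight of
    \<open>xs\<close>, so weight 0 is treated apart; the same happens below for
    \<open>ratio \<psi> \<phi>\<close>.\<close>
  proof (cases "weight xs = 0")
    case True
    obtain ys where "covers \<psi> \<phi> ys" using covers_exists[OF \<psi>(1) \<phi>] by blast
    then show ?thesis using 1[OF xs] True by fastforce
  next
    case False
    then have w: "weight xs > 0" using weight_nonneg[OF xs] by simp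
    have "ratio f \<phi> / weight xs \<le> ratio \<psi> \<phi>"
      by (rule ratio_greatest[OF \<psi>(1) \<phi>]) (use 1[OF xs] w in \<open>simp add: field_simps\<close>)
    then show ?thesis using w by (simp add: field_simps)
  qed
  show ?thesis
  proof (cases "ratio \<psi> \<phi> = 0")
    case True
    obtain xs where "covers f \<psi> xs" using covers_exists[OF f \<psi>] by blast
    then show ?thesis using 2 True by fastforce
  next
    case False
    then have w: "ratio \<psi> \<phi> > 0" using pos by simp
    have "ratio f \<phi> / ratio \<psi> \<phi> \<le> ratio f \<psi>"
      by (rule ratio_greatest[OF f \<psi>]) (use 2 w in \<open>simp add: field_simps\<close>)
    then show ?thesis using w by (simp add: field_simps)
  qed
qed

text \<open>At \<open>g1\<close> the translates of \<open>\<phi>\<close> are at most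
  \<open>B\<close>, so a cover of \<open>f\<close> has weight at least
  \<open>f g1 / B\<close>.\<close>

lemma ratio_pos:
  assumes f: "f \<in> Cc_nonneg" "f g1 > 0" and \<phi>: "\<phi> \<in> Cc_nonneg" "\<phi> g0 > 0"
  shows "ratio f \<phi> > 0"
proof -
  obtain B where B: "B > 0" "\<And>x. \<bar>\<phi> x\<bar> \<le> B" by (rule Cc_bounded[OF Cc_nonnegD(3)[OF \<phi>(1)]]) blast
  have "f g1 / B \<le> ratio f \<phi>"
  proof (rule ratio_greatest[OF f(1) \<phi>])
    fix xs assume xs: "covers f \<phi> xs"
    have "f g1 \<le> (\<Sum>x\<leftarrow>xs. fst x * \<phi> (g1 \<otimes> snd x))" using xs by (simp add: covers_def)
    also have "\<dots> \<le> (\<Sum>x\<leftarrow>xs. fst x * B)"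
      using xs B(2) unfolding covers_def by (intro sum_list_mono mult_left_mono) (auto simp: abs_le_iff)
    also have "\<dots> = weight xs * B" by (simp add: sum_list_mult_const)
    finally show "f g1 / B \<le> weight xs" using B(1) by (simp add: field_simps)
  qed
  moreover have "f g1 / B > 0" using f(2) B(1) by simp
  ultimately show ?thesis by linarith
qed

text \<open>With \<open>v\<close> confined to a compact neighbourhood of the unit, all
  \<open>a\<close> for which \<open>a\<close> or \<open>v a\<close> meets the support of
  \<open>h\<close> lie in the compact set \<open>K'\<close>. On \<open>K'\<close> the tube lemma
  applies, and off \<open>K'\<close> both values vanish.\<close>

lemma left_uniformly_continuous:
  assumes h: "h \<in> Cc" and e: "e > 0"
  shows "\<exists>V. open V \<and> \<one> \<in> V \<and> (\<forall>v\<in>V. \<forall>a. \<bar>h (v \<otimes> a) - h a\<bar> \<le> e)"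
proof -
  obtain K where K: "compact K" "\<And>x. x \<notin> K \<Longrightarrow> h x = 0" using h unfolding Cc_def by blast
  obtain \<phi> where \<phi>: "\<phi> \<in> Cc_nonneg" "\<phi> \<one> > 0" using bump_at_one[of UNIV] by auto
  obtain C where C: "compact C" "\<And>x. x \<notin> C \<Longrightarrow> \<phi> x = 0"
    using Cc_nonnegD(3)[OF \<phi>(1)] unfolding Cc_def by blast
  define W where "W = {g. \<phi> g > 0}"
  have W: "open W" "\<one> \<in> W"
    unfolding W_def using Cc_nonnegD(2)[OF \<phi>(1)] \<phi>(2) by (auto intro!: open_Collect_less continuous_intros)
  have WC: "W \<subseteq> C"
  proof
    fix x assume "x \<in> W"
    then have "\<phi> x \<noteq> 0" by (simp add: W_def)
    then show "x \<in> C" using C(2) by blast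
  qed
  define K' where "K' = (\<lambda>(v, k). inv v \<otimes> k) ` (C \<times> K) \<union> K"
  have "continuous_on (C \<times> K) (\<lambda>(v, k). inv v \<otimes> k)"
    unfolding case_prod_unfold by (intro continuous_mult continuous_inv continuous_intros)
  then have K': "compact K'"
    unfolding K'_def by (intro compact_Un K compact_continuous_image compact_Times C)
  have "continuous_on (UNIV \<times> K') (\<lambda>z. h (fst z \<otimes> snd z))"
    by (rule continuous_on_compose2[of UNIV h])
      (use h in \<open>auto simp: Cc_def intro!: continuous_mult continuous_intros\<close>)
  from continuous_on_prod_compactE[OF this K' UNIV_I[of \<one>] e]
  obtain X0 where X0: "\<one> \<in> X0" "open X0"
    "\<forall>x\<in>X0 \<inter> UNIV. \<forall>t\<in>K'. dist (h (fst (x, t) \<otimes> snd (x, t))) (h (fst (\<one>, t) \<otimes> snd (\<one>, t))) \<le> e"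
    by blast
  have "\<bar>h (v \<otimes> a) - h a\<bar> \<le> e" if v: "v \<in> X0 \<inter> W" for v a
  proof (cases "a \<in> K'")
    case True
    then show ?thesis using X0(3) v by (auto simp: dist_real_def)
  next
    case False
    have "v \<otimes> a \<notin> K"
    proof
      assume "v \<otimes> a \<in> K"
      then have "(\<lambda>(v, k). inv v \<otimes> k) (v, v \<otimes> a) \<in> K'" using v WC unfolding K'_def by blast
      then show False using False by simp
    qed
    moreover have "a \<notin> K" using False by (simp add: K'_def)
    ultimately show ?thesis using K(2) e by simp
  qed
  then show ?thesis using X0 W by (intro exI[of _ "X0 \<inter> W"]) auto
qed

lemma Cc_nonneg_dominating:
  fixes K :: "'g set"
  assumes "compact K"
  obtains f where "f \<in> Cc_nonneg" "\<And>g. g \<in> K \<Longrightarrow> 1 \<le> f g"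
proof -
  obtain \<phi> where \<phi>: "\<phi> \<in> Cc_nonneg" "\<phi> \<one> > 0" using bump_at_one[of UNIV] by auto
  obtain xs where xs: "\<And>x. x \<in> set xs \<Longrightarrow> 0 \<le> fst x" "\<And>g. g \<in> K \<Longrightarrow> 1 \<le> (\<Sum>x\<leftarrow>xs. fst x * \<phi> (g \<otimes> snd x))"
    by (rule cover_compact[OF assms \<phi>]) blast
  have "(\<lambda>g. \<Sum>x\<leftarrow>xs. fst x * \<phi> (g \<otimes> snd x)) \<in> Cc_nonneg"
    using xs(1)
    by (induction xs) (auto intro!: Cc_nonneg_zero Cc_nonneg_add Cc_nonneg_scale Cc_nonneg_translate \<phi>)
  then show ?thesis using that xs(2) by blast
qed

text \<open>Subadditivity is exact; the converse holds only up to an error that vanishes with the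
  support of \<open>\<phi>\<close>. A cover of a slight enlargement \<open>F\<close> of
  \<open>f1 + f2\<close> is split in the proportions \<open>f1 / F\<close> and
  \<open>f2 / F\<close>, which are nearly constant on each small translate and add up to at most
  1.\<close>

lemma ratio_almost_additive:
  assumes f1: "f1 \<in> Cc_nonneg" and f2: "f2 \<in> Cc_nonneg" and f0: "f0 \<in> Cc_nonneg" "f0 g0 > 0" and e: "e > 0"
  shows "\<exists>V. open V \<and> \<one> \<in> V \<and> (\<forall>\<phi>\<in>Cc_nonneg. \<phi> \<one> > 0 \<longrightarrow> (\<forall>g. g \<notin> V \<longrightarrow> \<phi> g = 0) \<longrightarrow>
     ratio f1 \<phi> / ratio f0 \<phi> + ratio f2 \<phi> / ratio f0 \<phi> \<le> ratio (\<lambda>g. f1 g + f2 g) \<phi> / ratio f0 \<phi> + e)"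
proof -
  obtain K1 where K1: "compact K1" "\<And>x. x \<notin> K1 \<Longrightarrow> f1 x = 0"
    using Cc_nonnegD(3)[OF f1] unfolding Cc_def by blast
  obtain K2 where K2: "compact K2" "\<And>x. x \<notin> K2 \<Longrightarrow> f2 x = 0"
    using Cc_nonnegD(3)[OF f2] unfolding Cc_def by blast
  define K where "K = K1 \<union> K2"
  have K: "compact K" "\<And>x. x \<notin> K \<Longrightarrow> f1 x = 0" "\<And>x. x \<notin> K \<Longrightarrow> f2 x = 0"
    using K1 K2 by (auto simp: K_def)
  obtain f' where f': "f' \<in> Cc_nonneg" "\<And>g. g \<in> K \<Longrightarrow> 1 \<le> f' g"
    by (rule Cc_nonneg_dominating[OF K(1)]) blast
  define f12 where "f12 g = f1 g + f2 g" for g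
  have f12: "f12 \<in> Cc_nonneg" unfolding f12_def[abs_def] by (rule Cc_nonneg_add[OF f1 f2])
  define k k' where "k = ratio f12 f0" and "k' = ratio f' f0"
  have k: "k \<ge> 0" "k' \<ge> 0" unfolding k_def k'_def using ratio_nonneg[OF f12 f0] ratio_nonneg[OF f'(1) f0] by simp_all
  \<comment> \<open>The final error is \<open>\<delta> * (2 a + (1 + 2 \<delta>) a')\<close> with
    \<open>a \<le> k\<close> and \<open>a' \<le> k'\<close>. Since \<open>\<delta> \<le> 1\<close>,
    it is at most \<open>\<delta> * (2 k + 3 k')\<close>.\<close>
  define \<delta> where "\<delta> = min 1 (e / (2 * k + 3 * k' + 1))"
  have \<delta>: "\<delta> > 0" "\<delta> \<le> 1" "\<delta> * (2 * k + 3 * k') \<le> e"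
  proof -
    show "\<delta> > 0" "\<delta> \<le> 1" using e k by (auto simp: \<delta>_def)
    have "\<delta> * (2 * k + 3 * k') \<le> e / (2 * k + 3 * k' + 1) * (2 * k + 3 * k' + 1)"
      using k e by (intro mult_mono) (auto simp: \<delta>_def)
    then show "\<delta> * (2 * k + 3 * k') \<le> e" using k by simp
  qed
  \<comment> \<open>The summand with \<open>f'\<close> makes \<open>F\<close> positive on all of
    \<open>K\<close>, so that the proportions are continuous with support in
    \<open>K\<close>.\<close>
  define F where "F g = f12 g + \<delta> * f' g" for g
  have F: "F \<in> Cc_nonneg" unfolding F_def[abs_def] using \<delta> by (intro Cc_nonneg_add Cc_nonneg_scale f12 f') auto
  have FK: "F g > 0" if "g \<in> K" for g
    using f'(2)[OF that] \<delta>(1) Cc_nonnegD(1)[OF f12, of g] unfolding F_def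
    by (intro add_nonneg_pos mult_pos_pos) auto
  have quot: "(\<lambda>g. f g / F g) \<in> Cc" if f: "f \<in> Cc_nonneg" "\<And>x. x \<notin> K \<Longrightarrow> f x = 0" for f
  proof -
    have o: "open {g. F g > 0}" using Cc_nonnegD(2)[OF F] by (intro open_Collect_less continuous_intros) auto
    have o': "open (- K)" using K(1) compact_imp_closed by blast
    have "continuous_on {g. F g > 0} (\<lambda>g. f g / F g)"
      using continuous_on_subset[OF Cc_nonnegD(2)[OF F] subset_UNIV] continuous_on_subset[OF Cc_nonnegD(2)[OF f(1)] subset_UNIV]
      by (intro continuous_intros) auto
    moreover have "continuous_on (- K) (\<lambda>g. f g / F g)"
      by (rule continuous_on_eq[OF continuous_on_const[of _ 0]]) (use f(2) in auto)
    ultimately have "continuous_on ({g. F g > 0} \<union> - K) (\<lambda>g. f g / F g)"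
      by (rule continuous_on_open_Un[OF o o'])
    moreover have "{g. F g > 0} \<union> - K = UNIV" using FK by blast
    ultimately show ?thesis using K(1) f(2) unfolding Cc_def by auto
  qed
  obtain V1 where V1: "open V1" "\<one> \<in> V1" "\<And>v a. v \<in> V1 \<Longrightarrow> \<bar>f1 (v \<otimes> a) / F (v \<otimes> a) - f1 a / F a\<bar> \<le> \<delta>"
    using left_uniformly_continuous[OF quot[OF f1 K(2)] \<delta>(1)] by blast
  obtain V2 where V2: "open V2" "\<one> \<in> V2" "\<And>v a. v \<in> V2 \<Longrightarrow> \<bar>f2 (v \<otimes> a) / F (v \<otimes> a) - f2 a / F a\<bar> \<le> \<delta>"
    using left_uniformly_continuous[OF quot[OF f2 K(3)] \<delta>(1)] by blast
  have main: "ratio f1 \<phi> / ratio f0 \<phi> + ratio f2 \<phi> / ratio f0 \<phi> \<le> ratio f12 \<phi> / ratio f0 \<phi> + e"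
    if \<phi>: "\<phi> \<in> Cc_nonneg" "\<phi> \<one> > 0" and V: "\<And>g. g \<notin> V1 \<inter> V2 \<Longrightarrow> \<phi> g = 0" for \<phi>
  proof -
    have sub: "ratio f \<phi> \<le> (\<Sum>x\<leftarrow>xs. fst x * (f (inv (snd x)) / F (inv (snd x)) + \<delta>))"
      if xs: "covers F \<phi> xs" and f: "f \<in> Cc_nonneg" "\<And>x. x \<notin> K \<Longrightarrow> f x = 0"
        and u: "\<And>v a. v \<in> V1 \<inter> V2 \<Longrightarrow> \<bar>f (v \<otimes> a) / F (v \<otimes> a) - f a / F a\<bar> \<le> \<delta>" for f xs
    proof -
      \<comment> \<open>If \<open>\<phi> (g \<otimes> s)\<close> is nonzero, then
        \<open>v = g \<otimes> s\<close> is near the unit and \<open>g = v \<otimes> inv s\<close>.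
        The proportion at \<open>g\<close> thus differs from that at \<open>inv s\<close> by at most
        \<open>\<delta>\<close>.\<close>
      let ?ys = "map (\<lambda>x. (fst x * (f (inv (snd x)) / F (inv (snd x)) + \<delta>), snd x)) xs"
      have hn: "0 \<le> f a / F a" for a using Cc_nonnegD(1)[OF f(1)] Cc_nonnegD(1)[OF F] by simp
      have xn: "0 \<le> fst x" if "x \<in> set xs" for x using xs that by (simp add: covers_def)
      have "covers f \<phi> ?ys"
        unfolding covers_def
      proof (intro conjI allI ballI)
        fix y assume "y \<in> set ?ys"
        then show "0 \<le> fst y" using xn hn \<delta>(1) by (auto intro!: mult_nonneg_nonneg add_nonneg_nonneg)
      next
        fix g
        have "f g = f g / F g * F g" using f(2)[of g] FK[of g] by (cases "g \<in> K") auto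
        also have "\<dots> \<le> f g / F g * (\<Sum>x\<leftarrow>xs. fst x * \<phi> (g \<otimes> snd x))"
          using xs hn by (intro mult_left_mono) (auto simp: covers_def)
        also have "\<dots> = (\<Sum>x\<leftarrow>xs. f g / F g * (fst x * \<phi> (g \<otimes> snd x)))" by (rule sum_list_const_mult[symmetric])
        also have "\<dots> \<le> (\<Sum>x\<leftarrow>xs. (fst x * (f (inv (snd x)) / F (inv (snd x)) + \<delta>)) * \<phi> (g \<otimes> snd x))"
        proof (rule sum_list_mono)
          fix x assume x: "x \<in> set xs"
          show "f g / F g * (fst x * \<phi> (g \<otimes> snd x)) \<le> (fst x * (f (inv (snd x)) / F (inv (snd x)) + \<delta>)) * \<phi> (g \<otimes> snd x)"
          proof (cases "g \<otimes> snd x \<in> V1 \<inter> V2")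
            case True
            from u[OF True, of "inv (snd x)"] have "f g / F g \<le> f (inv (snd x)) / F (inv (snd x)) + \<delta>"
              by (simp add: mult_assoc abs_le_iff)
            from mult_right_mono[OF this, of "fst x * \<phi> (g \<otimes> snd x)"] show ?thesis
              using xn[OF x] Cc_nonnegD(1)[OF \<phi>(1)] by (simp add: mult_ac)
          next
            case False
            then show ?thesis using V by simp
          qed
        qed
        also have "\<dots> = (\<Sum>x\<leftarrow>?ys. fst x * \<phi> (g \<otimes> snd x))" by (simp add: comp_def)
        finally show "f g \<le> (\<Sum>x\<leftarrow>?ys. fst x * \<phi> (g \<otimes> snd x))" .
      qed
      from ratio_le[OF this] show ?thesis by (simp add: comp_def)
    qed
    have "(ratio f1 \<phi> + ratio f2 \<phi>) / (1 + 2 * \<delta>) \<le> ratio F \<phi>"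
    proof (rule ratio_greatest[OF F \<phi>])
      fix xs assume xs: "covers F \<phi> xs"
      have "ratio f1 \<phi> + ratio f2 \<phi> \<le> (\<Sum>x\<leftarrow>xs. fst x * (f1 (inv (snd x)) / F (inv (snd x)) + \<delta>))
          + (\<Sum>x\<leftarrow>xs. fst x * (f2 (inv (snd x)) / F (inv (snd x)) + \<delta>))"
        by (intro add_mono sub[OF xs f1 K(2)] sub[OF xs f2 K(3)] V1(3) V2(3)) auto
      also have "\<dots> = (\<Sum>x\<leftarrow>xs. fst x * (f12 (inv (snd x)) / F (inv (snd x)) + 2 * \<delta>))"
        unfolding sum_list_addf[symmetric] by (simp add: f12_def add_divide_distrib algebra_simps)
      also have "\<dots> \<le> (\<Sum>x\<leftarrow>xs. fst x * (1 + 2 * \<delta>))"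
      proof (rule sum_list_mono)
        fix x assume x: "x \<in> set xs"
        have "f12 a / F a \<le> 1" for a
          using Cc_nonnegD(1)[OF f12, of a] Cc_nonnegD(1)[OF f'(1), of a] \<delta>(1)
          by (auto simp: F_def divide_le_eq_1)
        then show "fst x * (f12 (inv (snd x)) / F (inv (snd x)) + 2 * \<delta>) \<le> fst x * (1 + 2 * \<delta>)"
          using xs x by (intro mult_left_mono) (auto simp: covers_def)
      qed
      also have "\<dots> = weight xs * (1 + 2 * \<delta>)" by (simp add: sum_list_mult_const)
      finally show "(ratio f1 \<phi> + ratio f2 \<phi>) / (1 + 2 * \<delta>) \<le> weight xs"
        using \<delta>(1) by (simp add: field_simps)
    qed
    then have "ratio f1 \<phi> + ratio f2 \<phi> \<le> (1 + 2 * \<delta>) * ratio F \<phi>" using \<delta>(1) by (simp add: field_simps)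
    also have "\<dots> \<le> (1 + 2 * \<delta>) * (ratio f12 \<phi> + \<delta> * ratio f' \<phi>)"
      using ratio_add[OF f12 Cc_nonneg_scale[OF f'(1) less_imp_le[OF \<delta>(1)]] \<phi>] ratio_scale[OF f'(1) \<phi> \<delta>(1)] \<delta>(1)
      by (intro mult_left_mono) (auto simp: F_def[abs_def])
    finally have 1: "ratio f1 \<phi> + ratio f2 \<phi> \<le> (1 + 2 * \<delta>) * (ratio f12 \<phi> + \<delta> * ratio f' \<phi>)" .
    have p0: "ratio f0 \<phi> > 0" by (rule ratio_pos[OF f0 \<phi>])
    define a a' where "a = ratio f12 \<phi> / ratio f0 \<phi>" and "a' = ratio f' \<phi> / ratio f0 \<phi>"
    have a: "a \<le> k" "a' \<le> k'" "a' \<ge> 0"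
      using ratio_trans[OF f12 f0 \<phi>] ratio_trans[OF f'(1) f0 \<phi>] ratio_nonneg[OF f'(1) \<phi>] p0
      by (auto simp: a_def a'_def k_def k'_def field_simps)
    have "ratio f1 \<phi> / ratio f0 \<phi> + ratio f2 \<phi> / ratio f0 \<phi> = (ratio f1 \<phi> + ratio f2 \<phi>) / ratio f0 \<phi>"
      by (simp add: add_divide_distrib)
    also have "\<dots> \<le> ((1 + 2 * \<delta>) * (ratio f12 \<phi> + \<delta> * ratio f' \<phi>)) / ratio f0 \<phi>"
      using 1 p0 by (intro divide_right_mono) auto
    also have "\<dots> = (1 + 2 * \<delta>) * (a + \<delta> * a')" by (simp add: a_def a'_def flip: add_divide_distrib)
    also have "\<dots> = a + \<delta> * (2 * a + (1 + 2 * \<delta>) * a')" by (simp add: algebra_simps)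
    also have "\<dots> \<le> a + \<delta> * (2 * k + 3 * k')"
      using a \<delta>(1,2) k by (intro add_left_mono mult_left_mono add_mono mult_mono) auto
    also have "\<dots> \<le> a + e" using \<delta>(3) by simp
    finally show ?thesis by (simp add: a_def)
  qed
  show ?thesis
    using V1 V2 main unfolding f12_def[abs_def] by (intro exI[of _ "V1 \<inter> V2"]) auto
qed

end

context bump_group
begin

text \<open>A cluster point, in a product of compact intervals, of the normalised covering ratios for bump
  functions whose supports shrink to the unit.\<close>

lemma invariant_functional_nonneg:
  obtains L :: "('g \<Rightarrow> real) \<Rightarrow> real"
  where "\<And>f1 f2. f1 \<in> Cc_nonneg \<Longrightarrow> f2 \<in> Cc_nonneg \<Longrightarrow> L (\<lambda>g. f1 g + f2 g) = L f1 + L f2"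
    and "\<And>f r. f \<in> Cc_nonneg \<Longrightarrow> r \<ge> 0 \<Longrightarrow> L (\<lambda>g. r * f g) = r * L f"
    and "\<And>f h. f \<in> Cc_nonneg \<Longrightarrow> L (\<lambda>g. f (g \<otimes> h)) = L f"
    and "\<And>f. f \<in> Cc_nonneg \<Longrightarrow> L f \<ge> 0"
    and "\<And>f g. f \<in> Cc_nonneg \<Longrightarrow> f g > 0 \<Longrightarrow> L f > 0"
proof -
  obtain f0 where f0: "f0 \<in> Cc_nonneg" "f0 \<one> > 0" using bump_at_one[of UNIV] by auto
  define I where "I \<phi> f = (if f \<in> Cc_nonneg then ratio f \<phi> / ratio f0 \<phi> else 0)" for \<phi> f
  define X where "X V = {I \<phi> | \<phi>. \<phi> \<in> Cc_nonneg \<and> \<phi> \<one> > 0 \<and> (\<forall>g. g \<notin> V \<longrightarrow> \<phi> g = 0)}" for V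
  \<comment> \<open>The interval comes from \<open>ratio_trans\<close>; the point 0 matches the
    default value of \<open>I\<close> off \<open>Cc_nonneg\<close>.\<close>
  define Box where "Box = PiE UNIV (\<lambda>f. if f \<in> Cc_nonneg then {0..ratio f f0} else {0})"
  have I: "I \<phi> f = ratio f \<phi> / ratio f0 \<phi>" if "f \<in> Cc_nonneg" for \<phi> f using that by (simp add: I_def)
  have p0: "ratio f0 \<phi> > 0" if "\<phi> \<in> Cc_nonneg" "\<phi> \<one> > 0" for \<phi> by (rule ratio_pos[OF f0 that])
  have XBox: "X V \<subseteq> Box" for V
  proof
    fix L assume "L \<in> X V"
    then obtain \<phi> where \<phi>: "L = I \<phi>" "\<phi> \<in> Cc_nonneg" "\<phi> \<one> > 0" by (auto simp: X_def)
    have "0 \<le> I \<phi> f \<and> I \<phi> f \<le> ratio f f0" if f: "f \<in> Cc_nonneg" for f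
      using ratio_nonneg[OF f \<phi>(2,3)] ratio_trans[OF f f0 \<phi>(2,3)] p0[OF \<phi>(2,3)]
      by (simp add: I[OF f] field_simps)
    then show "L \<in> Box" by (simp add: \<phi>(1) Box_def PiE_UNIV_domain I_def)
  qed
  have "compact Box" unfolding Box_def by (rule compact_PiE_UNIV) auto
  then have "Box \<inter> (\<Inter>V\<in>{V. open V \<and> \<one> \<in> V}. closure (X V)) \<noteq> {}"
  proof (rule compact_imp_fip_image)
    fix I' assume I': "finite I'" "I' \<subseteq> {V. open V \<and> \<one> \<in> V}"
    then have "open (\<Inter>I')" "\<one> \<in> \<Inter>I'" by (auto intro: open_Inter)
    then obtain \<phi> where "\<phi> \<in> Cc_nonneg" "\<phi> \<one> > 0" "\<forall>g. g \<notin> \<Inter>I' \<longrightarrow> \<phi> g = 0"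
      using bump_at_one by blast
    then have "I \<phi> \<in> X (\<Inter>I')" unfolding X_def by blast
    moreover have "X (\<Inter>I') \<subseteq> closure (X V)" if "V \<in> I'" for V
    proof -
      have "X (\<Inter>I') \<subseteq> X V" using that unfolding X_def by blast
      then show ?thesis using closure_subset by blast
    qed
    ultimately have "I \<phi> \<in> Box \<inter> (\<Inter>V\<in>I'. closure (X V))" using XBox by blast
    then show "Box \<inter> (\<Inter>V\<in>I'. closure (X V)) \<noteq> {}" by blast
  qed simp
  then have "\<exists>L. L \<in> Box \<inter> (\<Inter>V\<in>{V. open V \<and> \<one> \<in> V}. closure (X V))"
    unfolding ex_in_conv .
  then obtain L where "L \<in> Box \<inter> (\<Inter>V\<in>{V. open V \<and> \<one> \<in> V}. closure (X V))" ..
  then have L: "L \<in> Box" "L \<in> (\<Inter>V\<in>{V. open V \<and> \<one> \<in> V}. closure (X V))"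
    by (rule IntD1, rule IntD2)
  have proj: "continuous_on UNIV (\<lambda>L :: ('g \<Rightarrow> real) \<Rightarrow> real. L f)" for f
    by (rule continuous_on_product_coordinates)
  \<comment> \<open>A continuous inequality that holds at \<open>I \<phi>\<close> for all
    \<open>\<phi>\<close> supported in one neighbourhood of the unit defines a closed set, so it
    passes to the cluster point \<open>L\<close>.\<close>
  have le: "F L \<le> (0::real)"
    if "continuous_on UNIV F" "open V" "\<one> \<in> V"
      and "\<And>\<phi>. \<phi> \<in> Cc_nonneg \<Longrightarrow> \<phi> \<one> > 0 \<Longrightarrow> (\<And>g. g \<notin> V \<Longrightarrow> \<phi> g = 0) \<Longrightarrow> F (I \<phi>) \<le> 0" for F V
  proof -
    have "closed {L. F L \<le> 0}" by (intro closed_Collect_le that continuous_intros)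
    moreover have "X V \<subseteq> {L. F L \<le> 0}" using that(4) unfolding X_def by blast
    ultimately have "closure (X V) \<subseteq> {L. F L \<le> 0}" by (rule closure_minimal[rotated])
    then show ?thesis using L(2) that(2,3) by blast
  qed
  have trans: "L (\<lambda>g. f (g \<otimes> h)) = L f" if f: "f \<in> Cc_nonneg" for f h
  proof -
    have eq: "I \<phi> (\<lambda>g. f (g \<otimes> h)) = I \<phi> f" if "\<phi> \<in> Cc_nonneg" "\<phi> \<one> > 0" for \<phi>
      by (simp add: I[OF f] I[OF Cc_nonneg_translate[OF f]] ratio_translate[OF f that])
    have "L (\<lambda>g. f (g \<otimes> h)) - L f \<le> 0" "L f - L (\<lambda>g. f (g \<otimes> h)) \<le> 0"
      by (rule le[of _ UNIV]; use eq in \<open>auto intro!: continuous_intros proj\<close>)+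
    then show ?thesis by simp
  qed
  have scale: "L (\<lambda>g. r * f g) = r * L f" if f: "f \<in> Cc_nonneg" and r: "r > 0" for f r
  proof -
    have eq: "I \<phi> (\<lambda>g. r * f g) = r * I \<phi> f" if "\<phi> \<in> Cc_nonneg" "\<phi> \<one> > 0" for \<phi>
      using r by (simp add: I[OF f] I[OF Cc_nonneg_scale[OF f]] ratio_scale[OF f that r])
    have "L (\<lambda>g. r * f g) - r * L f \<le> 0" "r * L f - L (\<lambda>g. r * f g) \<le> 0"
      by (rule le[of _ UNIV]; use eq in \<open>auto intro!: continuous_intros proj\<close>)+
    then show ?thesis by simp
  qed
  have add: "L (\<lambda>g. f1 g + f2 g) = L f1 + L f2" if f: "f1 \<in> Cc_nonneg" "f2 \<in> Cc_nonneg" for f1 f2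
  proof (rule antisym)
    have "I \<phi> (\<lambda>g. f1 g + f2 g) \<le> I \<phi> f1 + I \<phi> f2" if "\<phi> \<in> Cc_nonneg" "\<phi> \<one> > 0" for \<phi>
      using ratio_add[OF f that] p0[OF that]
      by (simp add: I[OF f(1)] I[OF f(2)] I[OF Cc_nonneg_add[OF f]] divide_right_mono flip: add_divide_distrib)
    then have "L (\<lambda>g. f1 g + f2 g) - (L f1 + L f2) \<le> 0"
      by (intro le[of "\<lambda>L. L (\<lambda>g. f1 g + f2 g) - (L f1 + L f2)" UNIV])
        (auto intro!: continuous_intros proj)
    then show "L (\<lambda>g. f1 g + f2 g) \<le> L f1 + L f2" by simp
    show "L f1 + L f2 \<le> L (\<lambda>g. f1 g + f2 g)"
    proof (rule field_le_epsilon)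
      fix e :: real assume e: "e > 0"
      obtain V where V: "open V" "\<one> \<in> V"
        "\<forall>\<phi>\<in>Cc_nonneg. \<phi> \<one> > 0 \<longrightarrow> (\<forall>g. g \<notin> V \<longrightarrow> \<phi> g = 0) \<longrightarrow>
           ratio f1 \<phi> / ratio f0 \<phi> + ratio f2 \<phi> / ratio f0 \<phi> \<le> ratio (\<lambda>g. f1 g + f2 g) \<phi> / ratio f0 \<phi> + e"
        using ratio_almost_additive[OF f f0 e] by (elim exE conjE) (rule that)
      have "(L f1 + L f2) - (L (\<lambda>g. f1 g + f2 g) + e) \<le> 0"
      proof (rule le[of "\<lambda>L. (L f1 + L f2) - (L (\<lambda>g. f1 g + f2 g) + e)" V])
        show "continuous_on UNIV (\<lambda>L. (L f1 + L f2) - (L (\<lambda>g. f1 g + f2 g) + e))"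
          by (intro continuous_intros proj)
        show "(I \<phi> f1 + I \<phi> f2) - (I \<phi> (\<lambda>g. f1 g + f2 g) + e) \<le> 0"
          if "\<phi> \<in> Cc_nonneg" "\<phi> \<one> > 0" "\<And>g. g \<notin> V \<Longrightarrow> \<phi> g = 0" for \<phi>
          using V(3)[rule_format, OF that] by (simp add: I[OF f(1)] I[OF f(2)] I[OF Cc_nonneg_add[OF f]])
      qed (use V in auto)
      then show "L f1 + L f2 \<le> L (\<lambda>g. f1 g + f2 g) + e" by simp
    qed
  qed
  have nonneg: "L f \<ge> 0" if f: "f \<in> Cc_nonneg" for f
  proof -
    have "L f \<in> (if f \<in> Cc_nonneg then {0..ratio f f0} else {0})"
      using L(1) unfolding Box_def PiE_UNIV_domain by blast
    then show ?thesis using f by simp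
  qed
  have pos: "L f > 0" if f: "f \<in> Cc_nonneg" "f g > 0" for f g
  proof -
    \<comment> \<open>\<open>ratio_trans\<close> through \<open>f\<close> gives
      \<open>ratio f0 \<phi> \<le> ratio f0 f * ratio f \<phi>\<close>, so the normalised ratio of
      \<open>f\<close> is at least \<open>r\<close> for every \<open>\<phi>\<close>.\<close>
    define r where "r = 1 / ratio f0 f"
    have q: "ratio f0 f > 0" by (rule ratio_pos[OF f0 f])
    have "r \<le> I \<phi> f" if "\<phi> \<in> Cc_nonneg" "\<phi> \<one> > 0" for \<phi>
      using ratio_trans[OF f0(1) f that] p0[OF that] q by (simp add: I[OF f(1)] r_def field_simps)
    then have "r - L f \<le> 0"
      by (intro le[of "\<lambda>L. r - L f" UNIV]) (auto intro!: continuous_intros proj)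
    moreover have "r > 0" using q by (simp add: r_def)
    ultimately show ?thesis by linarith
  qed
  have "L (\<lambda>g. 0) = 0" using add[OF Cc_nonneg_zero Cc_nonneg_zero] by simp
  then have scale': "L (\<lambda>g. r * f g) = r * L f" if "f \<in> Cc_nonneg" "r \<ge> 0" for f r
    using scale[OF that(1), of r] that(2) by (cases "r = 0") auto
  show ?thesis by (rule that[OF add scale' trans nonneg pos])
qed

text \<open>The extension from nonnegative functions by positive and negative parts. The last clause
  says that \<open>J\<close> is sup-norm bounded on functions supported in a fixed compact set,
  which is what \<open>compact_functional\<close> asks for.\<close>

theorem invariant_functional:
  obtains J :: "('g \<Rightarrow> real) \<Rightarrow> real"
  where "\<And>f g r s. f \<in> Cc \<Longrightarrow> g \<in> Cc \<Longrightarrow> J (\<lambda>x. r * f x + s * g x) = r * J f + s * J g"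
    and "\<And>f h. f \<in> Cc \<Longrightarrow> J (\<lambda>g. f (g \<otimes> h)) = J f"
    and "\<And>f g. f \<in> Cc_nonneg \<Longrightarrow> f g > 0 \<Longrightarrow> J f > 0"
    and "\<And>K. compact K \<Longrightarrow> K \<noteq> {} \<Longrightarrow> \<exists>M\<ge>0. \<forall>f\<in>Cc. (\<forall>x. x \<notin> K \<longrightarrow> f x = 0) \<longrightarrow>
       (\<forall>B. (\<forall>x\<in>K. \<bar>f x\<bar> \<le> B) \<longrightarrow> \<bar>J f\<bar> \<le> M * B)"
proof (rule invariant_functional_nonneg)
  fix L :: "('g \<Rightarrow> real) \<Rightarrow> real"
  assume add: "\<And>f1 f2. f1 \<in> Cc_nonneg \<Longrightarrow> f2 \<in> Cc_nonneg \<Longrightarrow> L (\<lambda>g. f1 g + f2 g) = L f1 + L f2"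
    and scale: "\<And>f r. f \<in> Cc_nonneg \<Longrightarrow> r \<ge> 0 \<Longrightarrow> L (\<lambda>g. r * f g) = r * L f"
    and trans: "\<And>f h. f \<in> Cc_nonneg \<Longrightarrow> L (\<lambda>g. f (g \<otimes> h)) = L f"
    and nonneg: "\<And>f. f \<in> Cc_nonneg \<Longrightarrow> L f \<ge> 0"
    and pos: "\<And>f g. f \<in> Cc_nonneg \<Longrightarrow> f g > 0 \<Longrightarrow> L f > 0"
  define P where "P f = (\<lambda>x. max (f x) (0::real))" for f :: "'g \<Rightarrow> real"
  define N where "N f = (\<lambda>x. max (- f x) (0::real))" for f :: "'g \<Rightarrow> real"
  define J where "J f = L (P f) - L (N f)" for f
  have neg: "(\<lambda>x. - f x) \<in> Cc" if "f \<in> Cc" for f :: "'g \<Rightarrow> real"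
    using Cc_lincomb[OF that that, of "-1" 0] by simp
  have P: "P f \<in> Cc_nonneg" if "f \<in> Cc" for f unfolding P_def by (rule Cc_max_0[OF that])
  have N: "N f \<in> Cc_nonneg" if "f \<in> Cc" for f unfolding N_def by (rule Cc_max_0[OF neg[OF that]])
  have PN: "f x = P f x - N f x" for f x by (simp add: P_def N_def max_def)
  \<comment> \<open>Every decomposition into nonnegative functions gives the same value; linearity
    follows by choosing convenient ones.\<close>
  have J: "J f = L a - L d" if f: "f \<in> Cc" and ad: "a \<in> Cc_nonneg" "d \<in> Cc_nonneg" "\<And>x. f x = a x - d x" for f a d
  proof -
    have "P f x + d x = N f x + a x" for x using PN[of f x] ad(3)[of x] by simp
    then have "L (\<lambda>x. P f x + d x) = L (\<lambda>x. N f x + a x)" by simp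
    then show ?thesis by (simp add: add P N f ad J_def)
  qed
  have Jadd: "J (\<lambda>x. f x + g x) = J f + J g" if f: "f \<in> Cc" and g: "g \<in> Cc" for f g
  proof -
    have "J (\<lambda>x. f x + g x) = L (\<lambda>x. P f x + P g x) - L (\<lambda>x. N f x + N g x)"
    proof (rule J)
      show "(\<lambda>x. f x + g x) \<in> Cc" using Cc_lincomb[OF f g, of 1 1] by simp
      show "f x + g x = P f x + P g x - (N f x + N g x)" for x using PN[of f x] PN[of g x] by simp
    qed (intro Cc_nonneg_add P N f g)+
    then show ?thesis by (simp add: add P N f g J_def)
  qed
  have Jscale: "J (\<lambda>x. r * f x) = r * J f" if f: "f \<in> Cc" for f r
  proof (cases "r \<ge> 0")
    case True
    have "J (\<lambda>x. r * f x) = L (\<lambda>x. r * P f x) - L (\<lambda>x. r * N f x)"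
    proof (rule J)
      show "(\<lambda>x. r * f x) \<in> Cc" using Cc_lincomb[OF f f, of r 0] by simp
      show "r * f x = r * P f x - r * N f x" for x
        by (subst PN[of f x]) (simp add: right_diff_distrib)
    qed (intro Cc_nonneg_scale P N f True)+
    then show ?thesis using True by (simp add: scale P N f J_def right_diff_distrib)
  next
    case False
    then have r: "- r \<ge> 0" by simp
    have "J (\<lambda>x. r * f x) = L (\<lambda>x. - r * N f x) - L (\<lambda>x. - r * P f x)"
    proof (rule J)
      show "(\<lambda>x. r * f x) \<in> Cc" using Cc_lincomb[OF f f, of r 0] by simp
      show "r * f x = - r * N f x - - r * P f x" for x
        by (subst PN[of f x]) (simp add: right_diff_distrib)
    qed (intro Cc_nonneg_scale P N f r)+
    then show ?thesis using scale[OF P[OF f] r] scale[OF N[OF f] r] by (simp add: J_def algebra_simps)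
  qed
  have Jlin: "J (\<lambda>x. r * f x + s * g x) = r * J f + s * J g" if f: "f \<in> Cc" and g: "g \<in> Cc" for f g r s
  proof -
    have "(\<lambda>x. r * f x) \<in> Cc" "(\<lambda>x. s * g x) \<in> Cc"
      using Cc_lincomb[OF f f, of r 0] Cc_lincomb[OF g g, of s 0] by simp_all
    then show ?thesis by (simp add: Jadd Jscale f g)
  qed
  have Jtrans: "J (\<lambda>g. f (g \<otimes> h)) = J f" if f: "f \<in> Cc" for f h
    using trans[OF P[OF f], of h] trans[OF N[OF f], of h] by (simp add: J_def P_def N_def)
  have L0: "L (\<lambda>_. 0) = 0" using scale[OF Cc_nonneg_zero, of 0] by simp
  have Jpos: "J f > 0" if f: "f \<in> Cc_nonneg" "f g > 0" for f g
    using J[OF Cc_nonnegD(3)[OF f(1)] f(1) Cc_nonneg_zero] pos[OF f] L0 by simp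
  have mono: "L f \<le> L g" if f: "f \<in> Cc_nonneg" and g: "g \<in> Cc_nonneg" and le: "\<And>x. f x \<le> g x" for f g
  proof -
    have d: "(\<lambda>x. g x - f x) \<in> Cc_nonneg"
      using Cc_lincomb[OF Cc_nonnegD(3)[OF g] Cc_nonnegD(3)[OF f], of 1 "-1"] le by (simp add: Cc_nonneg_def)
    have "L (\<lambda>x. f x + (g x - f x)) = L f + L (\<lambda>x. g x - f x)" by (rule add[OF f d])
    then show ?thesis using nonneg[OF d] by simp
  qed
  have Jbd: "\<exists>M\<ge>0. \<forall>f\<in>Cc. (\<forall>x. x \<notin> K \<longrightarrow> f x = 0) \<longrightarrow> (\<forall>B. (\<forall>x\<in>K. \<bar>f x\<bar> \<le> B) \<longrightarrow> \<bar>J f\<bar> \<le> M * B)"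
    if K: "compact K" "K \<noteq> {}" for K
  proof -
    obtain f' where f': "f' \<in> Cc_nonneg" "\<And>g. g \<in> K \<Longrightarrow> 1 \<le> f' g"
      by (rule Cc_nonneg_dominating[OF K(1)]) blast
    have "\<bar>J f\<bar> \<le> L f' * B" if f: "f \<in> Cc" "\<forall>x. x \<notin> K \<longrightarrow> f x = 0" "\<forall>x\<in>K. \<bar>f x\<bar> \<le> B" for f B
    proof -
      \<comment> \<open>Here a point of \<open>K\<close> is used: over an empty \<open>K\<close> a
        negative \<open>B\<close> would be admissible.\<close>
      have B: "B \<ge> 0" using f(3) K(2) by (meson abs_ge_zero ex_in_conv order_trans)
      have bd: "\<bar>f x\<bar> \<le> B * f' x" for x
      proof (cases "x \<in> K")
        case True
        have "B * 1 \<le> B * f' x" using f'(2)[OF True] B by (rule mult_left_mono)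
        then show ?thesis using f(3) True by force
      next
        case False
        then show ?thesis using f(2) B Cc_nonnegD(1)[OF f'(1), of x] by simp
      qed
      have "P f x \<le> B * f' x" "N f x \<le> B * f' x" for x
        using bd[of x] by (auto simp: P_def N_def)
      then have "L (P f) \<le> L (\<lambda>x. B * f' x)" "L (N f) \<le> L (\<lambda>x. B * f' x)"
        by (intro mono P N f Cc_nonneg_scale f' B; simp)+
      then show ?thesis
        using scale[OF f'(1) B] nonneg[OF P[OF f(1)]] nonneg[OF N[OF f(1)]] by (simp add: J_def mult.commute)
    qed
    then show ?thesis using nonneg[OF f'(1)] by blast
  qed
  show thesis by (rule that[OF Jlin Jtrans Jpos Jbd])
qed

end

section \<open>Smooth maps between manifolds\<close>

text \<open>What the source of a smooth map must provide for pulling back smooth functions. It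
  passes to product atlases and holds for the real line, so orbit maps and curves are covered
  without fixing a basis of the product model space.\<close>

definition open_charts :: "('m::topological_space, 'e::real_normed_vector) atlas \<Rightarrow> bool" where
  "open_charts A \<longleftrightarrow> (\<forall>(U, \<phi>)\<in>A. inj_on \<phi> U \<and> open U \<and> (\<forall>W. open W \<longrightarrow> open (\<phi> ` (U \<inter> W))))"

lemma (in manifold) open_charts: "open_charts A"
  unfolding open_charts_def
proof (intro ballI, clarify, intro conjI allI impI)
  fix U \<phi> assume U: "(U, \<phi>) \<in> A"
  show "inj_on \<phi> U" by (rule chart_inj[OF U])
  show "open U" by (rule chart_homeo(1)[OF U])
  show "open (\<phi> ` (U \<inter> W))" if "open W" for W
    using that chart_homeo(1)[OF U] by (intro chart_open_image[OF U]) auto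
qed

lemma open_charts_real: "open_charts real_atlas"
  by (simp add: open_charts_def real_atlas_def)

lemma open_charts_prod:
  fixes A :: "('m::topological_space, 'e::real_normed_vector) atlas"
    and B :: "('n::topological_space, 'f::real_normed_vector) atlas"
  assumes A: "open_charts A" and B: "open_charts B"
  shows "open_charts (prod_atlas A B)"
  unfolding open_charts_def
proof (intro ballI, clarify, intro conjI allI impI)
  fix S \<Phi> assume "(S, \<Phi>) \<in> prod_atlas A B"
  then obtain U \<phi> V \<psi> where U: "(U, \<phi>) \<in> A" and V: "(V, \<psi>) \<in> B" and S: "S = U \<times> V" "\<Phi> = map_prod \<phi> \<psi>"
    unfolding prod_atlas_def by auto
  have U': "inj_on \<phi> U" "open U" "\<And>W. open W \<Longrightarrow> open (\<phi> ` (U \<inter> W))"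
    using A U unfolding open_charts_def by blast+
  have V': "inj_on \<psi> V" "open V" "\<And>W. open W \<Longrightarrow> open (\<psi> ` (V \<inter> W))"
    using B V unfolding open_charts_def by blast+
  show "inj_on \<Phi> S" unfolding S by (rule map_prod_inj_on[OF U'(1) V'(1)])
  show "open S" unfolding S by (rule open_Times[OF U'(2) V'(2)])
  fix W :: "('m \<times> 'n) set" assume W: "open W"
  show "open (\<Phi> ` (S \<inter> W))"
    unfolding open_subopen[of "\<Phi> ` (S \<inter> W)"]
  proof (intro ballI)
    fix z assume "z \<in> \<Phi> ` (S \<inter> W)"
    then obtain p q where pq: "p \<in> U" "q \<in> V" "(p, q) \<in> W" "z = (\<phi> p, \<psi> q)" by (auto simp: S)
    obtain P Q where PQ: "open P" "open Q" "(p, q) \<in> P \<times> Q" "P \<times> Q \<subseteq> W"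
      by (rule open_prod_elim[OF W pq(3)]) blast
    have "open (\<phi> ` (U \<inter> P) \<times> \<psi> ` (V \<inter> Q))" by (intro open_Times U' V' PQ)
    moreover have "z \<in> \<phi> ` (U \<inter> P) \<times> \<psi> ` (V \<inter> Q)" using pq PQ by blast
    moreover have "\<phi> ` (U \<inter> P) \<times> \<psi> ` (V \<inter> Q) \<subseteq> \<Phi> ` (S \<inter> W)"
    proof clarify
      fix p' q' assume "p' \<in> U" "p' \<in> P" "q' \<in> V" "q' \<in> Q"
      then have "(p', q') \<in> S \<inter> W" using PQ(4) by (auto simp: S)
      then have "\<Phi> (p', q') \<in> \<Phi> ` (S \<inter> W)" by blast
      then show "(\<phi> p', \<psi> q') \<in> \<Phi> ` (S \<inter> W)" by (simp add: S)
    qed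
    ultimately show "\<exists>T. open T \<and> z \<in> T \<and> T \<subseteq> \<Phi> ` (S \<inter> W)" by blast
  qed
qed

lemma (in manifold) C_inf_compose:
  assumes F: "smooth_map B A F" and B: "open_charts B" and f: "f \<in> C_inf A"
  shows "(\<lambda>x. f (F x)) \<in> C_inf B"
  unfolding C_inf_def
proof (intro CollectI ballI, clarify)
  fix U \<phi> assume U: "(U, \<phi>) \<in> B"
  have U': "inj_on \<phi> U" "\<And>W. open W \<Longrightarrow> open (\<phi> ` (U \<inter> W))"
    using B U unfolding open_charts_def by blast+
  show "smooth_on (\<phi> ` U) ((\<lambda>x. f (F x)) \<circ> inv_into U \<phi>)"
  proof (rule smooth_on_local)
    fix y assume "y \<in> \<phi> ` U"
    then obtain p where p: "p \<in> U" "y = \<phi> p" by blast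
    obtain V \<psi> where V: "(V, \<psi>) \<in> A" "F p \<in> V" by (rule chart_exists)
    let ?T = "\<phi> ` (U \<inter> F -` V)"
    have cF: "continuous_on UNIV F" using F unfolding smooth_map_def by blast
    have "open (F -` V)" using chart_homeo(1)[OF V(1)] cF by (simp add: continuous_on_open_vimage)
    then have T: "open ?T" by (rule U'(2))
    have g: "smooth_on ?T (\<psi> \<circ> F \<circ> inv_into U \<phi>)"
      using F U V(1) unfolding smooth_map_def by blast
    have "smooth_on ?T (\<lambda>x. (f \<circ> inv_into V \<psi>) ((\<psi> \<circ> F \<circ> inv_into U \<phi>) x))"
    proof (rule smooth_on_compose[OF T chart_homeo(2)[OF V(1)] g _ C_infD[OF f V(1)]])
      show "(\<psi> \<circ> F \<circ> inv_into U \<phi>) ` ?T \<subseteq> \<psi> ` V"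
        using U'(1) by auto
    qed
    then have "smooth_on ?T ((\<lambda>x. f (F x)) \<circ> inv_into U \<phi>)"
    proof (rule smooth_on_cong[OF T, rotated])
      fix x assume "x \<in> ?T"
      then obtain r where r: "r \<in> U" "F r \<in> V" "x = \<phi> r" by blast
      then show "(f \<circ> inv_into V \<psi>) ((\<psi> \<circ> F \<circ> inv_into U \<phi>) x) = ((\<lambda>x. f (F x)) \<circ> inv_into U \<phi>) x"
        using chart_inv[OF V(1) r(2)] U'(1) by simp
    qed
    then show "\<exists>T. open T \<and> y \<in> T \<and> smooth_on T ((\<lambda>x. f (F x)) \<circ> inv_into U \<phi>)"
      using T p V(2) by blast
  qed
qed

lemma prod_chart_inv:
  assumes "inj_on \<phi> U" "inj_on \<psi> V" "p \<in> U" "q \<in> V"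
  shows "inv_into (U \<times> V) (map_prod \<phi> \<psi>) (\<phi> p, \<psi> q) = (p, q)"
  using inv_into_f_f[OF map_prod_inj_on[OF assms(1,2)], of "(p, q)"] assms(3,4) by simp

lemma C_inf_prodD:
  assumes f: "f \<in> C_inf (prod_atlas A B)" and U: "(U, \<phi>) \<in> A" and V: "(V, \<psi>) \<in> B"
    and i: "inj_on \<phi> U" "inj_on \<psi> V" and o: "open (\<phi> ` U)" "open (\<psi> ` V)"
  shows "smooth_on (\<phi> ` U \<times> \<psi> ` V) (\<lambda>z. f (inv_into U \<phi> (fst z), inv_into V \<psi> (snd z)))"
proof -
  have "(U \<times> V, map_prod \<phi> \<psi>) \<in> prod_atlas A B" using U V unfolding prod_atlas_def by force
  then have "smooth_on (map_prod \<phi> \<psi> ` (U \<times> V)) (f \<circ> inv_into (U \<times> V) (map_prod \<phi> \<psi>))"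
    using f unfolding C_inf_def by blast
  then have "smooth_on (\<phi> ` U \<times> \<psi> ` V) (f \<circ> inv_into (U \<times> V) (map_prod \<phi> \<psi>))"
    by (simp add: map_prod_surj_on)
  then show ?thesis
    by (rule smooth_on_cong[OF open_Times[OF o], rotated]) (use i prod_chart_inv[OF i] in auto)
qed

text \<open>In charts a slice is the affine insertion
  \<open>x \<mapsto> (x, 0) + (0, \<psi> y)\<close>, hence the use of
  \<open>smooth_on_affine\<close>.\<close>

lemma (in manifold) C_inf_slice_fst:
  assumes f: "f \<in> C_inf (prod_atlas A B)" and V: "(V, \<psi>) \<in> B" "y \<in> V" "inj_on \<psi> V" "open (\<psi> ` V)"
  shows "(\<lambda>x. f (x, y)) \<in> C_inf A"
  unfolding C_inf_def
proof (intro CollectI ballI, clarify)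
  fix U \<phi> assume U: "(U, \<phi>) \<in> A"
  have "smooth_on (\<phi> ` U) (\<lambda>x. (\<lambda>z. f (inv_into U \<phi> (fst z), inv_into V \<psi> (snd z))) ((x, 0) + (0, \<psi> y)))"
    by (rule smooth_on_affine[OF open_Times[OF chart_homeo(2)[OF U] V(4)] chart_homeo(2)[OF U] _ _
        C_inf_prodD[OF f U V(1) chart_inj[OF U] V(3) chart_homeo(2)[OF U] V(4)]])
      (use V(2) in \<open>auto intro!: bounded_linear_Pair bounded_linear_ident bounded_linear_zero\<close>)
  then show "smooth_on (\<phi> ` U) ((\<lambda>x. f (x, y)) \<circ> inv_into U \<phi>)"
    using V(2,3) by (simp add: comp_def)
qed

lemma (in manifold) C_inf_slice_snd:
  assumes f: "f \<in> C_inf (prod_atlas B A)" and V: "(V, \<psi>) \<in> B" "y \<in> V" "inj_on \<psi> V" "open (\<psi> ` V)"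
  shows "(\<lambda>x. f (y, x)) \<in> C_inf A"
  unfolding C_inf_def
proof (intro CollectI ballI, clarify)
  fix U \<phi> assume U: "(U, \<phi>) \<in> A"
  have "smooth_on (\<phi> ` U) (\<lambda>x. (\<lambda>z. f (inv_into V \<psi> (fst z), inv_into U \<phi> (snd z))) ((0, x) + (\<psi> y, 0)))"
    by (rule smooth_on_affine[OF open_Times[OF V(4) chart_homeo(2)[OF U]] chart_homeo(2)[OF U] _ _
        C_inf_prodD[OF f V(1) U V(3) chart_inj[OF U] V(4) chart_homeo(2)[OF U]]])
      (use V(2) in \<open>auto intro!: bounded_linear_Pair bounded_linear_ident bounded_linear_zero\<close>)
  then show "smooth_on (\<phi> ` U) ((\<lambda>x. f (y, x)) \<circ> inv_into U \<phi>)"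
    using V(2,3) by (simp add: comp_def)
qed

lemma (in manifold) C_inf_curve:
  assumes "smooth_map real_atlas A \<gamma>" "f \<in> C_inf A"
  shows "((\<lambda>t. f (\<gamma> t)) has_real_derivative deriv (\<lambda>t. f (\<gamma> t)) t) (at t)"
proof -
  have "(\<lambda>t. f (\<gamma> t)) \<in> C_inf real_atlas"
    by (rule C_inf_compose[OF assms(1) open_charts_real assms(2)])
  then have "smooth_on UNIV (\<lambda>t. f (\<gamma> t))"
    unfolding C_inf_def real_atlas_def by (simp add: comp_def inv_id[unfolded id_def] id_def)
  then have "(\<lambda>t. f (\<gamma> t)) differentiable (at t)"
    by (rule smooth_on_imp_differentiable) simp
  then show ?thesis by (simp add: DERIV_deriv_iff_real_differentiable)
qed

text \<open>In a chart of the group the derivatives in \<open>z\<close> are the joint derivatives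
  along \<open>(0, v)\<close>, so they inherit joint continuity. Since \<open>S\<close> is open,
  they also vanish for parameters outside \<open>K\<close>, which keeps them admissible.\<close>

lemma param_C_k_joint_smooth:
  fixes A :: "('g::t2_space, 'e::real_normed_vector) atlas" and F :: "'g \<Rightarrow> 'f::real_normed_vector \<Rightarrow> real"
  assumes A: "manifold bA nA cA A" and cf: "compact_functional K (\<lambda>f. f \<in> Cc \<and> (\<forall>g. g \<notin> K \<longrightarrow> f g = 0)) I M"
    and S: "open S"
    and F: "\<And>U \<phi>. (U, \<phi>) \<in> A \<Longrightarrow> C_k k (\<phi> ` U \<times> S) (\<lambda>z. F (inv_into U \<phi> (fst z)) (snd z))"
    and F0: "\<And>g z. g \<notin> K \<Longrightarrow> z \<in> S \<Longrightarrow> F g z = 0"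
  shows "compact_functional.param_C_k K (\<lambda>f. f \<in> Cc \<and> (\<forall>g. g \<notin> K \<longrightarrow> f g = 0)) k S F"
proof -
  interpret manifold bA nA cA A by (rule A)
  interpret cf: compact_functional K "\<lambda>f. f \<in> Cc \<and> (\<forall>g. g \<notin> K \<longrightarrow> f g = 0)" I M by (rule cf)
  have PC0: "cf.param_C_k 0 S F"
    if F: "\<And>U \<phi>. (U, \<phi>) \<in> A \<Longrightarrow> continuous_on (\<phi> ` U \<times> S) (\<lambda>z. F (inv_into U \<phi> (fst z)) (snd z))"
      and F0: "\<And>g z. g \<notin> K \<Longrightarrow> z \<in> S \<Longrightarrow> F g z = 0" for F
  proof -
    have "isCont (\<lambda>z. F (fst z) (snd z)) (g, z)" if z: "z \<in> S" for g z
    proof -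
      obtain U \<phi> where U: "(U, \<phi>) \<in> A" "g \<in> U" by (rule chart_exists)
      have "continuous_on (U \<times> S) (\<lambda>z. (\<lambda>z. F (inv_into U \<phi> (fst z)) (snd z)) (\<phi> (fst z), snd z))"
      proof (rule continuous_on_compose2[OF F[OF U(1)]])
        have "continuous_on (U \<times> S) (\<lambda>z. \<phi> (fst z))"
          by (rule continuous_on_compose2[OF chart_continuous[OF U(1)]]) (auto intro!: continuous_intros)
        then show "continuous_on (U \<times> S) (\<lambda>z. (\<phi> (fst z), snd z))"
          by (intro continuous_on_Pair continuous_intros)
      qed auto
      then have "continuous_on (U \<times> S) (\<lambda>z. F (fst z) (snd z))"
        by (rule continuous_on_eq) (auto simp: chart_inv[OF U(1)])
      moreover have "open (U \<times> S)" by (rule open_Times[OF chart_homeo(1)[OF U(1)] S])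
      moreover have "(g, z) \<in> U \<times> S" using U z by simp
      ultimately show ?thesis using continuous_on_eq_continuous_at by blast
    qed
    then have c: "continuous_on (UNIV \<times> S) (\<lambda>z. F (fst z) (snd z))"
      by (intro continuous_at_imp_continuous_on) auto
    have "continuous_on (K \<times> S) (\<lambda>(g, z). F g z)"
      using continuous_on_subset[OF c, of "K \<times> S"] by (simp add: case_prod_unfold Sigma_mono)
    moreover have "(\<lambda>g. F g z) \<in> Cc" if z: "z \<in> S" for z
    proof -
      have "continuous_on UNIV (\<lambda>g. (\<lambda>z. F (fst z) (snd z)) (g, z))"
        by (rule continuous_on_compose2[OF c]) (use z in \<open>auto intro!: continuous_intros\<close>)
      then have "continuous_on UNIV (\<lambda>g. F g z)" by simp
      then show ?thesis using cf.K_compact F0[OF _ z] unfolding Cc_def by blast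
    qed
    ultimately show ?thesis using F0 by simp
  qed
  show "cf.param_C_k k S F"
    using F F0
  proof (induction k arbitrary: F)
    case 0
    show ?case by (rule PC0) (use 0 in simp_all)
  next
    case (Suc k)
    have chart: "((F g) has_derivative (\<lambda>v. frechet_derivative (\<lambda>z. F (inv_into U \<phi> (fst z)) (snd z)) (at (\<phi> g, z)) (0, v))) (at z)"
      if U: "(U, \<phi>) \<in> A" "g \<in> U" and z: "z \<in> S" for U \<phi> g z
    proof -
      let ?H = "\<lambda>z. F (inv_into U \<phi> (fst z)) (snd z)"
      have "(?H has_derivative frechet_derivative ?H (at (\<phi> g, z))) (at (\<phi> g, z))"
        using C_k_differentiable[OF Suc.prems(1)[OF U(1)], of "(\<phi> g, z)"] U z frechet_derivative_works by blast
      moreover have "((\<lambda>z. (\<phi> g, z)) has_derivative (\<lambda>v. (0, v))) (at z)"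
        by (auto intro!: derivative_eq_intros)
      ultimately have "((\<lambda>z. ?H (\<phi> g, z)) has_derivative (\<lambda>v. frechet_derivative ?H (at (\<phi> g, z)) (0, v))) (at z)"
        by (rule has_derivative_compose[rotated])
      moreover have "(\<lambda>z. ?H (\<phi> g, z)) = F g" by (simp add: chart_inv[OF U])
      ultimately show ?thesis by (simp only:)
    qed
    have "cf.param_C_k 0 S F"
      by (rule PC0[OF C_k_continuous[OF Suc.prems(1)] Suc.prems(2)])
    moreover have "F g differentiable (at z)" if "z \<in> S" for g z
    proof -
      obtain U \<phi> where U: "(U, \<phi>) \<in> A" "g \<in> U" by (rule chart_exists)
      show ?thesis using chart[OF U that] unfolding differentiable_def by blast
    qed
    moreover have "cf.param_C_k k S (\<lambda>g z. frechet_derivative (F g) (at z) v)" for v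
    proof (rule Suc.IH)
      fix U \<phi> assume U: "(U, \<phi>) \<in> A"
      let ?H = "\<lambda>z. F (inv_into U \<phi> (fst z)) (snd z)"
      have "C_k k (\<phi> ` U \<times> S) (\<lambda>z. frechet_derivative ?H (at z) (0, v))"
        by (rule C_k_deriv[OF Suc.prems(1)[OF U]])
      then show "C_k k (\<phi> ` U \<times> S) (\<lambda>z. frechet_derivative (F (inv_into U \<phi> (fst z))) (at (snd z)) v)"
      proof (rule C_k_cong[OF open_Times[OF chart_homeo(2)[OF U] S], rotated])
        fix z assume "z \<in> \<phi> ` U \<times> S"
        then obtain g y where gy: "g \<in> U" "y \<in> S" "z = (\<phi> g, y)" by auto
        have "frechet_derivative (F g) (at y) v = frechet_derivative ?H (at (\<phi> g, y)) (0, v)"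
          using frechet_derivative_at[OF chart[OF U gy(1,2)]] by (rule fun_cong[symmetric])
        then show "frechet_derivative ?H (at z) (0, v) = frechet_derivative (F (inv_into U \<phi> (fst z))) (at (snd z)) v"
          using gy chart_inv[OF U gy(1)] by simp
      qed
    next
      fix g z assume gz: "g \<notin> K" "z \<in> S"
      have "(F g has_derivative (\<lambda>v. 0)) (at z)"
        by (rule has_derivative_transform_within_open[OF has_derivative_const[of 0] S gz(2)])
          (simp add: Suc.prems(2)[OF gz(1)])
      then show "frechet_derivative (F g) (at z) v = 0"
        using frechet_derivative_at by metis
    qed
    ultimately show ?case by simp
  qed
qed

section \<open>Hamiltonian actions\<close>

locale hamiltonian_space =
  S: symplectic bM nM cM AM \<omega> + GM: manifold bG nG cG AG
  for bM nM cM and AM :: "('m::t2_space, 'f::real_normed_vector) atlas" and \<omega>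
    and bG nG cG and AG :: "('g::t2_space, 'e::real_normed_vector) atlas" +
  fixes G :: "'g monoid" (structure) and act :: "'g \<Rightarrow> 'm \<Rightarrow> 'm" and \<mu> :: "'m \<Rightarrow> 'g tvec \<Rightarrow> real"
  assumes lie: "lie_group G AG" and action: "smooth_action G AG AM act" and proper: "proper_action act"
    and sympl: "symplectic_action G AM \<omega> act" and moment: "moment_map G AG AM \<omega> act \<mu>"
begin

sublocale BG: bump_group G
proof (intro bump_group.intro bump_group_axioms.intro)
  show "Group.group G" "carrier G = UNIV" using lie by (auto simp: lie_group_def)
  show "continuous_on UNIV (\<lambda>(g, h). g \<otimes> h)" "continuous_on UNIV (\<lambda>g. inv g)"
    using lie by (auto simp: lie_group_def smooth_map_def)
  fix V :: "'g set" assume V: "open V" "\<one> \<in> V"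
  show "\<exists>\<phi>\<in>Cc_nonneg. \<phi> \<one> > 0 \<and> (\<forall>g. g \<notin> V \<longrightarrow> \<phi> g = 0)"
  proof (rule GM.bump_function[OF V])
    fix \<theta> K
    assume \<theta>: "\<theta> \<in> C_inf AG" "\<And>q. \<theta> q \<ge> 0" "\<theta> \<one> > 0" "compact K" "K \<subseteq> V" "\<And>q. q \<notin> K \<Longrightarrow> \<theta> q = 0"
    have "\<theta> \<in> Cc_nonneg"
      unfolding Cc_nonneg_def Cc_def using GM.C_inf_continuous[OF \<theta>(1)] \<theta> by blast
    then show ?thesis using \<theta> by blast
  qed
qed

lemma act_mult: "act (g \<otimes> h) x = act g (act h x)"
proof -
  interpret group_action G UNIV act using action by (simp add: smooth_action_def)
  show ?thesis by (rule composition_rule) simp_all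
qed

lemma act_one [simp]: "act \<one> x = x"
proof -
  interpret group_action G UNIV act using action by (simp add: smooth_action_def)
  show ?thesis using fun_cong[OF id_eq_one, of x] by simp
qed

lemma act_inv [simp]: "act (inv g) (act g x) = x" "act g (act (inv g) x) = x"
  by (simp_all flip: act_mult)

lemma act_joint:
  assumes "\<psi> \<in> C_inf AM"
  shows "(\<lambda>z. \<psi> (act (fst z) (snd z))) \<in> C_inf (prod_atlas AG AM)"
proof -
  have "smooth_map (prod_atlas AG AM) AM (\<lambda>(g, x). act g x)" using action by (simp add: smooth_action_def)
  from S.C_inf_compose[OF this open_charts_prod[OF GM.open_charts S.open_charts] assms]
  show ?thesis by (simp add: case_prod_unfold)
qed

lemma C_inf_act: "\<psi> \<in> C_inf AM \<Longrightarrow> (\<lambda>x. \<psi> (act g x)) \<in> C_inf AM"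
proof -
  assume \<psi>: "\<psi> \<in> C_inf AM"
  obtain U \<phi> where U: "(U, \<phi>) \<in> AG" "g \<in> U" by (rule GM.chart_exists)
  show ?thesis
    using S.C_inf_slice_snd[OF act_joint[OF \<psi>] U GM.chart_inj[OF U(1)] GM.chart_homeo(2)[OF U(1)]] by simp
qed

lemma C_inf_orbit_map: "\<psi> \<in> C_inf AM \<Longrightarrow> (\<lambda>g. \<psi> (act g x)) \<in> C_inf AG"
proof -
  assume \<psi>: "\<psi> \<in> C_inf AM"
  obtain U \<phi> where U: "(U, \<phi>) \<in> AM" "x \<in> U" by (rule S.chart_exists)
  show ?thesis
    using GM.C_inf_slice_fst[OF act_joint[OF \<psi>] U S.chart_inj[OF U(1)] S.chart_homeo(2)[OF U(1)]] by simp
qed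

text \<open>\<open>velocity\<close> has the default value 0 on nonsmooth functions, so a conjugated
  function must be known to be smooth before \<open>Ad\<close> of a velocity can be computed on
  it.\<close>

lemma C_inf_conjugate:
  assumes f: "f \<in> C_inf AG"
  shows "(\<lambda>h. f (k \<otimes> h \<otimes> l)) \<in> C_inf AG"
proof -
  have "smooth_map (prod_atlas AG AG) AG (\<lambda>(g, h). g \<otimes> h)" using lie by (simp add: lie_group_def)
  from GM.C_inf_compose[OF this open_charts_prod[OF GM.open_charts GM.open_charts]]
  have j: "(\<lambda>z. f (fst z \<otimes> snd z)) \<in> C_inf (prod_atlas AG AG)" if "f \<in> C_inf AG" for f
    using that by (simp add: case_prod_unfold)
  have r: "(\<lambda>h. f (h \<otimes> l)) \<in> C_inf AG" if f: "f \<in> C_inf AG" for f l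
  proof -
    obtain U \<phi> where U: "(U, \<phi>) \<in> AG" "l \<in> U" by (rule GM.chart_exists)
    show ?thesis
      using GM.C_inf_slice_fst[OF j[OF f] U GM.chart_inj[OF U(1)] GM.chart_homeo(2)[OF U(1)]] by simp
  qed
  have l: "(\<lambda>h. f (k \<otimes> h)) \<in> C_inf AG" if f: "f \<in> C_inf AG" for f k
  proof -
    obtain U \<phi> where U: "(U, \<phi>) \<in> AG" "k \<in> U" by (rule GM.chart_exists)
    show ?thesis
      using GM.C_inf_slice_snd[OF j[OF f] U GM.chart_inj[OF U(1)] GM.chart_homeo(2)[OF U(1)]] by simp
  qed
  show ?thesis using l[OF r[OF f]] by simp
qed

lemma one_parameter_zero: "one_parameter_subgroup G AG \<gamma> \<Longrightarrow> \<gamma> 0 = \<one>"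
proof -
  assume "one_parameter_subgroup G AG \<gamma>"
  then have "\<gamma> 0 = \<gamma> 0 \<otimes> \<gamma> 0" unfolding one_parameter_subgroup_def by (metis add_0)
  then show ?thesis by (metis BG.inv_mult_cancel(1) BG.l_inv BG.closed_simps)
qed

lemma fundamental_field_velocity:
  assumes "f \<in> C_inf AM"
  shows "fundamental_field AM act (velocity AG \<gamma>) p f = deriv (\<lambda>t. f (act (\<gamma> t) p)) 0"
  using assms C_inf_orbit_map[OF assms, of p]
  by (simp add: fundamental_field_def push_forward_def velocity_def comp_def)

lemma fundamental_field_tangent:
  assumes \<gamma>: "one_parameter_subgroup G AG \<gamma>"
  shows "fundamental_field AM act (velocity AG \<gamma>) p \<in> tangent_space AM p"
proof (rule S.tangentI)
  have sm: "smooth_map real_atlas AG \<gamma>" using \<gamma> by (simp add: one_parameter_subgroup_def)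
  have d: "((\<lambda>t. f (act (\<gamma> t) p)) has_real_derivative deriv (\<lambda>t. f (act (\<gamma> t) p)) 0) (at 0)"
    if "f \<in> C_inf AM" for f
    using GM.C_inf_curve[OF sm C_inf_orbit_map[OF that]] .
  fix f g :: "'m \<Rightarrow> real" and r s :: real
  assume f: "f \<in> C_inf AM" and g: "g \<in> C_inf AM"
  show "fundamental_field AM act (velocity AG \<gamma>) p (\<lambda>x. r * f x + s * g x)
      = r * fundamental_field AM act (velocity AG \<gamma>) p f + s * fundamental_field AM act (velocity AG \<gamma>) p g"
    unfolding fundamental_field_velocity[OF f] fundamental_field_velocity[OF g]
      fundamental_field_velocity[OF S.C_inf_lincomb[OF f g]]
    by (intro DERIV_imp_deriv DERIV_add DERIV_cmult d f g)
  have "((\<lambda>t. f (act (\<gamma> t) p) * g (act (\<gamma> t) p)) has_real_derivative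
      deriv (\<lambda>t. f (act (\<gamma> t) p)) 0 * g (act (\<gamma> 0) p) + deriv (\<lambda>t. g (act (\<gamma> t) p)) 0 * f (act (\<gamma> 0) p)) (at 0)"
    by (intro DERIV_mult d f g)
  from DERIV_imp_deriv[OF this]
  show "fundamental_field AM act (velocity AG \<gamma>) p (\<lambda>x. f x * g x)
      = f p * fundamental_field AM act (velocity AG \<gamma>) p g + g p * fundamental_field AM act (velocity AG \<gamma>) p f"
    unfolding fundamental_field_velocity[OF f] fundamental_field_velocity[OF g]
      fundamental_field_velocity[OF S.C_inf_mult[OF f g]]
    by (simp add: one_parameter_zero[OF \<gamma>])
next
  fix f :: "'m \<Rightarrow> real" assume "f \<notin> C_inf AM"
  then show "fundamental_field AM act (velocity AG \<gamma>) p f = 0"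
    by (simp add: fundamental_field_def push_forward_def)
qed

lemma lie_alg_subset: "lie_alg G AG H \<subseteq> lie_alg G AG (carrier G)"
  unfolding lie_alg_def BG.carrier_UNIV by blast

lemma moment_smooth: "X \<in> lie_alg G AG H \<Longrightarrow> (\<lambda>p. \<mu> p X) \<in> C_inf AM"
  using moment lie_alg_subset unfolding moment_map_def by blast

text \<open>Noether: the derivative of the component of \<open>X\<close> along the Hamiltonian
  vector \<open>Y\<close> of \<open>g\<close> is \<open>\<omega>(X#, Y) = - X# g\<close>, and
  \<open>g\<close> is constant along the curve \<open>\<gamma> t\<close> acting on
  \<open>p\<close>.\<close>

lemma moment_invariant_ham_field:
  assumes g: "g \<in> inv_functions AM act H" and X: "X \<in> lie_alg G AG H"
  shows "ham_field AM \<omega> g p (\<lambda>q. \<mu> q X) = 0"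
proof -
  obtain \<gamma> where \<gamma>: "X = velocity AG \<gamma>" "one_parameter_subgroup G AG \<gamma>" "range \<gamma> \<subseteq> H"
    using X unfolding lie_alg_def by blast
  have gC: "g \<in> C_inf AM" using g by (simp add: inv_functions_def)
  let ?X = "fundamental_field AM act X p" and ?Y = "ham_field AM \<omega> g p"
  have Xt: "?X \<in> tangent_space AM p" unfolding \<gamma>(1) by (rule fundamental_field_tangent[OF \<gamma>(2)])
  have Yt: "?Y \<in> tangent_space AM p" by (rule S.ham_field_props(1)[OF gC])
  have "X \<in> lie_alg G AG (carrier G)" using X lie_alg_subset by blast
  then have "?Y (\<lambda>q. \<mu> q X) = \<omega> p ?X ?Y"
    using moment Yt unfolding moment_map_def by blast
  also have "\<dots> = - \<omega> p ?Y ?X" by (rule S.omega_skew[OF Xt Yt])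
  also have "\<dots> = - ?X g" using S.ham_field_props(2)[OF gC Xt] by simp
  also have "?X g = deriv (\<lambda>t. g p) 0"
    unfolding \<gamma>(1) fundamental_field_velocity[OF gC]
    using g \<gamma>(3) by (simp add: inv_functions_def subset_iff)
  finally show ?thesis by simp
qed

text \<open>The bracket is the derivative of \<open>f\<close> along the Hamiltonian field of
  \<open>g\<close>, which is tangent to the common level sets of the moment components of
  \<open>H\<close>. In a chart these components form the family \<open>MM\<close> of
  \<open>derivative_zero_on_level_set\<close>.\<close>

lemma poisson_zero_on_level:
  assumes f: "f \<in> C_inf AM" and g: "g \<in> inv_functions AM act H"
    and f0: "\<And>y. (\<And>X. X \<in> lie_alg G AG H \<Longrightarrow> \<mu> y X = \<mu> x X) \<Longrightarrow> f y = f x"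
  shows "poisson AM \<omega> f g x = 0"
proof -
  have gC: "g \<in> C_inf AM" using g by (simp add: inv_functions_def)
  show ?thesis
  proof (rule S.ham_field_chart[OF gC, of x])
    fix U \<phi> V Y
    assume U: "(U, \<phi>) \<in> AM" and V: "open V" "x \<in> V" "V \<subseteq> U" and Y: "continuous_on (\<phi> ` V) Y"
      and ham: "\<And>q f. q \<in> V \<Longrightarrow> f \<in> C_inf AM \<Longrightarrow> ham_field AM \<omega> g q f = S.chart_deriv U \<phi> q f (Y (\<phi> q))"
    have o: "open (\<phi> ` V)" by (rule S.chart_open_image[OF U V(1,3)])
    have inv: "inv_into U \<phi> (\<phi> q) = q" if "q \<in> V" for q using S.chart_inv[OF U] V(3) that by blast
    have xU: "x \<in> U" using V by blast
    define MM where "MM = {(\<lambda>q. \<mu> q X) \<circ> inv_into U \<phi> | X. X \<in> lie_alg G AG H}"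
    have "S.chart_deriv U \<phi> x f (Y (\<phi> x)) = 0"
    proof (rule S.derivative_zero_on_level_set[OF o imageI[OF V(2)] Y])
      fix m assume "m \<in> MM"
      then obtain X where X: "X \<in> lie_alg G AG H" "m = (\<lambda>q. \<mu> q X) \<circ> inv_into U \<phi>" unfolding MM_def by blast
      show "smooth_on (\<phi> ` V) m"
        unfolding X(2) by (rule smooth_on_subset[OF image_mono[OF V(3)] S.C_infD[OF moment_smooth[OF X(1)] U]])
      fix y assume "y \<in> \<phi> ` V"
      then obtain q where q: "q \<in> V" "y = \<phi> q" by blast
      have "S.chart_deriv U \<phi> q (\<lambda>q. \<mu> q X) (Y (\<phi> q)) = 0"
        using ham[OF q(1) moment_smooth[OF X(1)]] moment_invariant_ham_field[OF g X(1)] by simp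
      then show "frechet_derivative m (at y) (Y y) = 0"
        unfolding q(2) X(2) S.chart_deriv_def .
    next
      show "((f \<circ> inv_into U \<phi>) has_derivative S.chart_deriv U \<phi> x f) (at (\<phi> x))"
        by (rule S.chart_deriv[OF U xU f])
    next
      fix y assume "y \<in> \<phi> ` V" and m: "\<And>m. m \<in> MM \<Longrightarrow> m y = m (\<phi> x)"
      then obtain q where q: "q \<in> V" "y = \<phi> q" by blast
      have "\<mu> q X = \<mu> x X" if X: "X \<in> lie_alg G AG H" for X
      proof -
        have "(\<lambda>q. \<mu> q X) \<circ> inv_into U \<phi> \<in> MM" using X unfolding MM_def by blast
        from m[OF this] show ?thesis using inv q V(2) by simp
      qed
      then have "f q = f x" by (rule f0)
      then show "(f \<circ> inv_into U \<phi>) y = (f \<circ> inv_into U \<phi>) (\<phi> x)" using inv q V(2) by simp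
    qed
    then show ?thesis using S.poisson_eq[OF f gC] ham[OF V(2) f] by simp
  qed
qed

text \<open>The level set over an orbit is a union of fibres of the restricted moment map. Equality
  on the level set thus gives equality on the whole fibre through \<open>x\<close>.\<close>

lemma moment_level_cong:
  assumes "\<And>X. X \<in> lie_alg G AG H \<Longrightarrow> \<mu> y X = \<mu> x X" "x \<in> moment_level G AG \<mu> H \<alpha>"
  shows "y \<in> moment_level G AG \<mu> H \<alpha>"
proof -
  have "dual_restrict G AG H (\<mu> y) = dual_restrict G AG H (\<mu> x)"
    using assms(1) by (auto simp: dual_restrict_def)
  then show ?thesis using assms(2) by (simp add: moment_level_def)
qed

lemma poisson_level_cong_left:
  assumes f: "f \<in> C_inf AM" "f' \<in> C_inf AM" and g: "g \<in> inv_functions AM act H"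
    and eq: "\<And>y. y \<in> moment_level G AG \<mu> H \<alpha> \<Longrightarrow> f y = f' y" and x: "x \<in> moment_level G AG \<mu> H \<alpha>"
  shows "poisson AM \<omega> f g x = poisson AM \<omega> f' g x"
proof -
  have gC: "g \<in> C_inf AM" using g by (simp add: inv_functions_def)
  let ?d = "\<lambda>y. 1 * f y + (- 1) * f' y"
  have d: "?d \<in> C_inf AM" by (rule S.C_inf_lincomb[OF f])
  have "poisson AM \<omega> ?d g x = 0"
    by (rule poisson_zero_on_level[OF d g]) (use eq moment_level_cong[OF _ x] x in auto)
  moreover have "poisson AM \<omega> ?d g x = 1 * poisson AM \<omega> f g x + (- 1) * poisson AM \<omega> f' g x"
    unfolding S.poisson_eq[OF d gC] S.poisson_eq[OF f(1) gC] S.poisson_eq[OF f(2) gC]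
    by (rule S.tangentD_lin[OF S.ham_field_props(1)[OF gC] f])
  ultimately show ?thesis by simp
qed

text \<open>One argument is replaced at a time, with the bracket turned round in between. The
  Hamiltonian field that is followed belongs first to \<open>g\<close> and then to
  \<open>f'\<close>, so both must be \<open>H\<close>-invariant.\<close>

lemma poisson_level_cong:
  assumes f: "f \<in> inv_functions AM act H" "f' \<in> inv_functions AM act H"
    and g: "g \<in> inv_functions AM act H" "g' \<in> inv_functions AM act H"
    and eq: "\<And>y. y \<in> moment_level G AG \<mu> H \<alpha> \<Longrightarrow> f y = f' y" "\<And>y. y \<in> moment_level G AG \<mu> H \<alpha> \<Longrightarrow> g y = g' y"
    and x: "x \<in> moment_level G AG \<mu> H \<alpha>"
  shows "poisson AM \<omega> f g x = poisson AM \<omega> f' g' x"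
proof -
  have C: "f \<in> C_inf AM" "f' \<in> C_inf AM" "g \<in> C_inf AM" "g' \<in> C_inf AM"
    using f g by (auto simp: inv_functions_def)
  have "poisson AM \<omega> f g x = poisson AM \<omega> f' g x"
    by (rule poisson_level_cong_left[OF C(1,2) g(1) eq(1) x])
  also have "\<dots> = - poisson AM \<omega> g f' x" by (rule S.poisson_skew[OF C(2,3)])
  also have "poisson AM \<omega> g f' x = poisson AM \<omega> g' f' x"
    by (rule poisson_level_cong_left[OF C(3,4) f(2) eq(2) x])
  also have "- poisson AM \<omega> g' f' x = poisson AM \<omega> f' g' x" using S.poisson_skew[OF C(2,4)] by simp
  finally show ?thesis .
qed

lemma push_forward_tangent:
  assumes v: "v \<in> tangent_space AM p"
  shows "push_forward AM (act h) v \<in> tangent_space AM (act h p)"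
proof (rule S.tangentI)
  fix f g :: "'m \<Rightarrow> real" and r s :: real
  assume f: "f \<in> C_inf AM" and g: "g \<in> C_inf AM"
  show "push_forward AM (act h) v (\<lambda>x. r * f x + s * g x) = r * push_forward AM (act h) v f + s * push_forward AM (act h) v g"
    using S.tangentD_lin[OF v C_inf_act[OF f, of h] C_inf_act[OF g, of h], of r s] f g S.C_inf_lincomb[OF f g, of r s]
    by (simp add: push_forward_def comp_def)
  show "push_forward AM (act h) v (\<lambda>x. f x * g x)
      = f (act h p) * push_forward AM (act h) v g + g (act h p) * push_forward AM (act h) v f"
    using S.tangentD_mult[OF v C_inf_act[OF f, of h] C_inf_act[OF g, of h]] f g S.C_inf_mult[OF f g]
    by (simp add: push_forward_def comp_def)
qed (simp add: push_forward_def)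

lemma push_forward_inverse:
  assumes w: "w \<in> tangent_space AM p"
  shows "push_forward AM (act h) (push_forward AM (act (inv h)) w) = w"
proof
  fix f show "push_forward AM (act h) (push_forward AM (act (inv h)) w) f = w f"
    using S.tangentD_nonsmooth[OF w, of f] C_inf_act[of f h]
    by (cases "f \<in> C_inf AM") (simp_all add: push_forward_def comp_def)
qed

text \<open>The pushed-forward vector satisfies the equation that determines the Hamiltonian vector
  at \<open>act h p\<close>, since the action preserves both \<open>f\<close> and
  \<open>\<omega>\<close>.\<close>

lemma ham_field_equivariant:
  assumes f: "f \<in> C_inf AM" and inv: "\<And>x. f (act h x) = f x"
  shows "ham_field AM \<omega> f (act h p) = push_forward AM (act h) (ham_field AM \<omega> f p)"
proof (rule S.ham_field_unique)
  have X: "ham_field AM \<omega> f p \<in> tangent_space AM p" by (rule S.ham_field_props(1)[OF f])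
  show "push_forward AM (act h) (ham_field AM \<omega> f p) \<in> tangent_space AM (act h p)"
    by (rule push_forward_tangent[OF X])
  fix w' assume w': "w' \<in> tangent_space AM (act h p)"
  define w where "w = push_forward AM (act (inv h)) w'"
  have w: "w \<in> tangent_space AM p"
    using push_forward_tangent[OF w', of "inv h"] by (simp add: w_def)
  have hw: "push_forward AM (act h) w = w'"
    unfolding w_def by (rule push_forward_inverse[OF w'])
  have "w' f = w f" unfolding hw[symmetric] by (simp add: push_forward_def f comp_def inv)
  also have "\<dots> = \<omega> p (ham_field AM \<omega> f p) w" by (rule S.ham_field_props(2)[OF f w])
  also have "\<dots> = \<omega> (act h p) (push_forward AM (act h) (ham_field AM \<omega> f p)) (push_forward AM (act h) w)"
    using sympl X w unfolding symplectic_action_def by simp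
  finally show "w' f = \<omega> (act h p) (push_forward AM (act h) (ham_field AM \<omega> f p)) w'" by (simp only: hw)
qed

lemma poisson_inv_functions:
  assumes f: "f \<in> inv_functions AM act H" and g: "g \<in> inv_functions AM act H"
  shows "poisson AM \<omega> f g \<in> inv_functions AM act H"
proof -
  have C: "f \<in> C_inf AM" "g \<in> C_inf AM" using f g by (auto simp: inv_functions_def)
  have "poisson AM \<omega> f g (act h p) = poisson AM \<omega> f g p" if h: "h \<in> H" for h p
  proof -
    have "f (act h x) = f x" "g (act h x) = g x" for x using f g h by (auto simp: inv_functions_def)
    then show ?thesis
      unfolding poisson_def ham_field_equivariant[OF C(1)] ham_field_equivariant[OF C(2)]
      using sympl S.ham_field_props(1)[OF C(1)] S.ham_field_props(1)[OF C(2)]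
      by (simp add: symplectic_action_def ham_field_equivariant C)
  qed
  then show ?thesis using S.poisson_C_inf[OF C] by (simp add: inv_functions_def)
qed

lemma Ad_commuting:
  assumes X: "X \<in> lie_alg G AG H" and k: "\<And>h. h \<in> H \<Longrightarrow> k \<otimes> h = h \<otimes> k"
  shows "Ad G AG k X = X"
proof -
  obtain \<gamma> where \<gamma>: "X = velocity AG \<gamma>" "range \<gamma> \<subseteq> H" using X unfolding lie_alg_def by blast
  have c: "k \<otimes> \<gamma> t \<otimes> inv k = \<gamma> t" for t
    using k[of "\<gamma> t"] \<gamma>(2) by (simp add: BG.mult_assoc subset_iff)
  show ?thesis
    unfolding \<gamma>(1) Ad_def
    by (auto simp: push_forward_def velocity_def comp_def C_inf_conjugate c)
qed

text \<open>Invariance of one moment component under the other factor: by equivariance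
  \<open>k\<close> acts through \<open>Ad\<close>, and conjugation by \<open>k\<close> fixes every
  curve in \<open>H\<close>.\<close>

lemma moment_commuting:
  assumes X: "X \<in> lie_alg G AG H" and k: "\<And>h. h \<in> H \<Longrightarrow> k \<otimes> h = h \<otimes> k"
  shows "\<mu> (act k x) X = \<mu> x X"
proof -
  have "inv k \<otimes> h = h \<otimes> inv k" if "h \<in> H" for h
  proof -
    have "inv k \<otimes> h = inv k \<otimes> (h \<otimes> (k \<otimes> inv k))" by simp
    also have "\<dots> = inv k \<otimes> ((k \<otimes> h) \<otimes> inv k)" by (simp only: k[OF that] BG.mult_assoc)
    also have "\<dots> = h \<otimes> inv k" by (simp add: BG.mult_assoc)
    finally show ?thesis .
  qed
  then have "Ad G AG (inv k) X = X" by (rule Ad_commuting[OF X])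
  moreover have "X \<in> lie_alg G AG (carrier G)" using X lie_alg_subset by blast
  ultimately show ?thesis using moment by (simp add: moment_map_def coadjoint_def)
qed

lemma moment_level_commuting:
  assumes "\<And>h. h \<in> H \<Longrightarrow> k \<otimes> h = h \<otimes> k" "x \<in> moment_level G AG \<mu> H \<alpha>"
  shows "act k x \<in> moment_level G AG \<mu> H \<alpha>"
  by (rule moment_level_cong[OF moment_commuting assms(2)]) (use assms(1) in auto)

lemma in_own_moment_level:
  assumes "\<one> \<in> H"
  shows "x \<in> moment_level G AG \<mu> H (dual_restrict G AG H (\<mu> x))"
proof -
  have "Ad G AG (inv \<one>) X = X" if "X \<in> lie_alg G AG H" for X
    by (rule Ad_commuting[OF that]) simp
  then have "coadjoint G AG H \<one> (dual_restrict G AG H (\<mu> x)) = dual_restrict G AG H (\<mu> x)"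
    by (auto simp: coadjoint_def dual_restrict_def)
  then show ?thesis using assms unfolding moment_level_def coadjoint_orbit_def by force
qed

end

section \<open>Reduced spaces\<close>

context hamiltonian_space
begin

lemma sub_orbit_eq: "sub_orbit G act H x = (\<lambda>h. act h x) ` H"
  by (auto simp: orbit_def)

lemma inv_functions_sub_orbit:
  "f \<in> inv_functions AM act H \<Longrightarrow> y \<in> sub_orbit G act H x \<Longrightarrow> f y = f x"
  by (auto simp: sub_orbit_eq inv_functions_def)

lemma image_sub_orbit:
  assumes "\<And>h. h \<in> H \<Longrightarrow> k \<otimes> h = h \<otimes> k"
  shows "act k ` sub_orbit G act H x = sub_orbit G act H (act k x)"
proof -
  have "act k ` sub_orbit G act H x = (\<lambda>h. act (k \<otimes> h) x) ` H"
    by (simp add: sub_orbit_eq image_image act_mult)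
  also have "\<dots> = (\<lambda>h. act (h \<otimes> k) x) ` H" using assms by (intro image_cong) auto
  finally show ?thesis by (simp add: sub_orbit_eq act_mult)
qed

lemma sub_orbit_refl: "\<one> \<in> H \<Longrightarrow> x \<in> sub_orbit G act H x"
  by (force simp: sub_orbit_eq)

text \<open>Resolves the definite description. The candidate \<open>c\<close> evaluates the bracket
  at an arbitrary point of each orbit, which is legitimate as the bracket is
  \<open>H\<close>-invariant; \<open>poisson_level_cong\<close> makes it independent of the
  representatives, and extensionality makes it unique.\<close>

lemma reduced_bracket_eq:
  assumes H: "\<one> \<in> H" and f: "represents G AG AM act \<mu> H \<alpha> f a" and g: "represents G AG AM act \<mu> H \<alpha> g b"
    and x: "x \<in> moment_level G AG \<mu> H \<alpha>"
  shows "reduced_bracket G AG AM \<omega> act \<mu> H \<alpha> a b (sub_orbit G act H x) = poisson AM \<omega> f g x"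
proof -
  let ?N = "moment_level G AG \<mu> H \<alpha>" and ?q = "sub_orbit G act H"
  let ?R = "represents G AG AM act \<mu> H \<alpha>"
  define c where "c = restrict (\<lambda>P. poisson AM \<omega> f g (SOME y. y \<in> P)) (?q ` ?N)"
  have fg: "f \<in> inv_functions AM act H" "g \<in> inv_functions AM act H"
    using f g by (auto simp: represents_def)
  have c: "c (?q y) = poisson AM \<omega> f g y" if "y \<in> ?N" for y
  proof -
    have "(SOME z. z \<in> ?q y) \<in> ?q y" using sub_orbit_refl[OF H] by (rule someI)
    then show ?thesis
      using that inv_functions_sub_orbit[OF poisson_inv_functions[OF fg]] by (simp add: c_def)
  qed
  have "reduced_bracket G AG AM \<omega> act \<mu> H \<alpha> a b = c"
    unfolding reduced_bracket_def
  proof (rule the_equality)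
    show "c \<in> extensional (topspace (reduced_space G AG act \<mu> H \<alpha>)) \<and>
        (\<forall>f' g'. ?R f' a \<longrightarrow> ?R g' b \<longrightarrow> ?R (poisson AM \<omega> f' g') c)"
    proof (intro conjI allI impI)
      show "c \<in> extensional (topspace (reduced_space G AG act \<mu> H \<alpha>))"
        unfolding topspace_reduced_space c_def by simp
      fix f' g' assume f': "?R f' a" and g': "?R g' b"
      have fg': "f' \<in> inv_functions AM act H" "g' \<in> inv_functions AM act H"
        using f' g' by (auto simp: represents_def)
      have "c (?q y) = poisson AM \<omega> f' g' y" if y: "y \<in> ?N" for y
        unfolding c[OF y]
      proof (rule poisson_level_cong[OF fg(1) fg'(1) fg(2) fg'(2) _ _ y])
        show "f z = f' z" if "z \<in> ?N" for z using f f' that unfolding represents_def by metis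
        show "g z = g' z" if "z \<in> ?N" for z using g g' that unfolding represents_def by metis
      qed
      then show "?R (poisson AM \<omega> f' g') c"
        using poisson_inv_functions[OF fg'] by (simp add: represents_def)
    qed
  next
    fix d
    assume d: "d \<in> extensional (topspace (reduced_space G AG act \<mu> H \<alpha>)) \<and>
        (\<forall>f' g'. ?R f' a \<longrightarrow> ?R g' b \<longrightarrow> ?R (poisson AM \<omega> f' g') d)"
    then have "?R (poisson AM \<omega> f g) d" using f g by blast
    then have "d (?q y) = poisson AM \<omega> f g y" if "y \<in> ?N" for y using that by (simp add: represents_def)
    then show "d = c"
      using d c unfolding topspace_reduced_space
      by (intro extensionalityI[of d "?q ` ?N" c]) (auto simp: c_def)
  qed
  then show ?thesis using c[OF x] by simp
qed

section \<open>Averaging over the group\<close>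

lemma compact_transporter:
  assumes "compact C" "compact D"
  shows "compact {g. \<exists>y\<in>C. act g y \<in> D}"
proof -
  \<comment> \<open>The transporter is the projection to the group of the preimage of
    \<open>C \<times> D\<close> under the map whose properness is assumed.\<close>
  have "compactin euclidean {x \<in> topspace euclidean. (\<lambda>(g, x). (x, act g x)) x \<in> C \<times> D}"
    using proper assms unfolding proper_action_def
    by (intro compactin_proper_map_preimage) (auto intro: compact_Times)
  then have "compact {x. (\<lambda>(g, x). (x, act g x)) x \<in> C \<times> D}" by simp
  then have "compact (fst ` {x. (\<lambda>(g, x). (x, act g x)) x \<in> C \<times> D})"
    by (rule compact_continuous_image[rotated]) (intro continuous_intros)
  moreover have "fst ` {x. (\<lambda>(g, x). (x, act g x)) x \<in> C \<times> D} = {g. \<exists>y\<in>C. act g y \<in> D}"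
    by (force simp: image_iff)
  ultimately show ?thesis by simp
qed

lemma Cc_orbit_map:
  assumes \<psi>: "\<psi> \<in> C_inf AM" and D: "compact D" "\<And>x. x \<notin> D \<Longrightarrow> \<psi> x = 0"
  shows "(\<lambda>g. \<psi> (act g y)) \<in> Cc"
proof -
  have "compact {g. \<exists>z\<in>{y}. act g z \<in> D}" by (rule compact_transporter[OF _ D(1)]) simp
  moreover have "\<psi> (act g y) = 0" if "g \<notin> {g. \<exists>z\<in>{y}. act g z \<in> D}" for g
    using that D(2) by simp
  ultimately show ?thesis
    using GM.C_inf_continuous[OF C_inf_orbit_map[OF \<psi>]] unfolding Cc_def by blast
qed

text \<open>For all \<open>y\<close> in the neighbourhood \<open>W\<close> of \<open>y0\<close> the
  integrand is supported in one compact set of group elements, those that move some point of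
  \<open>C\<close> into \<open>D\<close>. On functions supported there \<open>J\<close> is a
  \<open>compact_functional\<close>, and one may differentiate under it.\<close>

lemma average_smooth:
  fixes J :: "('g \<Rightarrow> real) \<Rightarrow> real"
  assumes lin: "\<And>f g r s. f \<in> Cc \<Longrightarrow> g \<in> Cc \<Longrightarrow> J (\<lambda>x. r * f x + s * g x) = r * J f + s * J g"
    and bd: "\<And>K. compact K \<Longrightarrow> K \<noteq> {} \<Longrightarrow> \<exists>M\<ge>0. \<forall>f\<in>Cc. (\<forall>x. x \<notin> K \<longrightarrow> f x = 0) \<longrightarrow>
       (\<forall>B. (\<forall>x\<in>K. \<bar>f x\<bar> \<le> B) \<longrightarrow> \<bar>J f\<bar> \<le> M * B)"
    and \<psi>: "\<psi> \<in> C_inf AM" and D: "compact D" "\<And>x. x \<notin> D \<Longrightarrow> \<psi> x = 0"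
  shows "(\<lambda>y. J (\<lambda>g. \<psi> (act g y))) \<in> C_inf AM"
proof (rule S.C_inf_localI)
  fix y0
  obtain V \<phi> where V: "(V, \<phi>) \<in> AM" "y0 \<in> V" by (rule S.chart_exists)
  obtain \<theta> C where \<theta>: "\<theta> \<in> C_inf AM" "\<And>q. \<theta> q \<ge> 0" "\<theta> y0 > 0" "compact C" "C \<subseteq> V" "\<And>q. q \<notin> C \<Longrightarrow> \<theta> q = 0"
    by (rule S.bump_function[OF S.chart_homeo(1)[OF V(1)] V(2)]) blast
  define W where "W = {q. \<theta> q > 0}"
  have W: "open W" unfolding W_def
    using S.C_inf_continuous[OF \<theta>(1)] by (intro open_Collect_less continuous_intros) auto
  have WC: "W \<subseteq> C"
  proof
    fix q assume "q \<in> W"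
    then have "\<theta> q \<noteq> 0" by (simp add: W_def)
    then show "q \<in> C" using \<theta>(6) by blast
  qed
  have WV: "W \<subseteq> V" using WC \<theta>(5) by blast
  define S where "S = \<phi> ` W"
  have S: "open S" unfolding S_def by (rule S.chart_open_image[OF V(1) W WV])
  have inv: "inv_into V \<phi> (\<phi> q) = q" if "q \<in> W" for q using S.chart_inv[OF V(1)] WV that by blast
  \<comment> \<open>The transporter may be empty; the unit is added because the bound on
    \<open>J\<close> is stated for nonempty sets.\<close>
  define K where "K = insert \<one> {g. \<exists>y\<in>C. act g y \<in> D}"
  have K: "compact K" "K \<noteq> {}" unfolding K_def using compact_transporter[OF \<theta>(4) D(1)] by auto
  obtain M where M: "M \<ge> 0" "\<forall>f\<in>Cc. (\<forall>x. x \<notin> K \<longrightarrow> f x = 0) \<longrightarrow> (\<forall>B. (\<forall>x\<in>K. \<bar>f x\<bar> \<le> B) \<longrightarrow> \<bar>J f\<bar> \<le> M * B)"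
    using bd[OF K] by blast
  have cf: "compact_functional K (\<lambda>f. f \<in> Cc \<and> (\<forall>g. g \<notin> K \<longrightarrow> f g = 0)) J M"
  proof
    fix f and B :: real
    assume f: "f \<in> Cc \<and> (\<forall>g. g \<notin> K \<longrightarrow> f g = 0)" and B: "\<And>t. t \<in> K \<Longrightarrow> \<bar>f t\<bar> \<le> B"
    show "\<bar>J f\<bar> \<le> M * B" using M(2) f B by blast
  qed (use K M lin in \<open>auto intro: Cc_lincomb\<close>)
  interpret pf: param_functional K "\<lambda>f. f \<in> Cc \<and> (\<forall>g. g \<notin> K \<longrightarrow> f g = 0)" J M bM nM cM
    by (intro param_functional.intro cf S.findim_axioms)
  define F where "F g z = \<psi> (act g (inv_into V \<phi> z))" for g z
  have "C_k k S (\<lambda>z. J (\<lambda>g. F g z))" for k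
  proof (rule pf.C_k_functional[OF _ S], rule param_C_k_joint_smooth[OF GM.manifold_axioms cf S])
    fix U \<eta> assume U: "(U, \<eta>) \<in> AG"
    have "smooth_on (\<eta> ` U \<times> \<phi> ` V) (\<lambda>z. \<psi> (act (inv_into U \<eta> (fst z)) (inv_into V \<phi> (snd z))))"
      using C_inf_prodD[OF act_joint[OF \<psi>] U V(1) GM.chart_inj[OF U] S.chart_inj[OF V(1)]
          GM.chart_homeo(2)[OF U] S.chart_homeo(2)[OF V(1)]] by simp
    then have "smooth_on (\<eta> ` U \<times> S) (\<lambda>z. F (inv_into U \<eta> (fst z)) (snd z))"
      unfolding F_def by (rule smooth_on_subset[rotated]) (use WV in \<open>auto simp: S_def\<close>)
    then show "C_k k (\<eta> ` U \<times> S) (\<lambda>z. F (inv_into U \<eta> (fst z)) (snd z))"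
      by (simp add: smooth_on_def)
  next
    fix g z assume g: "g \<notin> K" and "z \<in> S"
    then obtain q where q: "q \<in> W" "z = \<phi> q" unfolding S_def by blast
    have "act g q \<notin> D" using g q(1) WC unfolding K_def by blast
    then show "F g z = 0" unfolding F_def q(2) inv[OF q(1)] by (rule D(2))
  qed
  then have "smooth_on (\<phi> ` W) ((\<lambda>y. J (\<lambda>g. \<psi> (act g y))) \<circ> inv_into V \<phi>)"
    by (simp add: smooth_on_def S_def F_def comp_def)
  moreover have "y0 \<in> W" using \<theta>(3) by (simp add: W_def)
  ultimately show "\<exists>U \<phi> V. (U, \<phi>) \<in> AM \<and> open V \<and> y0 \<in> V \<and> V \<subseteq> U \<and>
      smooth_on (\<phi> ` V) ((\<lambda>y. J (\<lambda>g. \<psi> (act g y))) \<circ> inv_into U \<phi>)"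
    using V(1) W WV by blast
qed

lemma average_invariant:
  fixes J :: "('g \<Rightarrow> real) \<Rightarrow> real"
  assumes "\<And>f h. f \<in> Cc \<Longrightarrow> J (\<lambda>g. f (g \<otimes> h)) = J f"
    and "\<psi> \<in> C_inf AM" "compact D" "\<And>x. x \<notin> D \<Longrightarrow> \<psi> x = 0"
  shows "J (\<lambda>g. \<psi> (act g (act h y))) = J (\<lambda>g. \<psi> (act g y))"
  using assms(1)[OF Cc_orbit_map[OF assms(2-4), of y], of h] by (simp add: act_mult)

text \<open>On an invariant set, \<open>f\<close> is the quotient of two invariant functions near \<open>x\<close>: the averages
  over \<open>G\<close> of \<open>f\<close> times a bump function at \<open>x\<close>, and of the bump function itself.\<close>

lemma quotient_of_averages:
  assumes fs: "finite T" "\<And>f. f \<in> T \<Longrightarrow> f \<in> C_inf AM"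
    and N: "\<And>f g y. f \<in> T \<Longrightarrow> y \<in> N \<Longrightarrow> f (act g y) = f y"
  obtains E A where "E \<in> inv_functions AM act (carrier G)" "E x > 0"
    "\<And>f. f \<in> T \<Longrightarrow> A f \<in> inv_functions AM act (carrier G)"
    "\<And>f y. f \<in> T \<Longrightarrow> y \<in> N \<Longrightarrow> A f y = f y * E y"
proof (rule BG.invariant_functional)
  fix J :: "('g \<Rightarrow> real) \<Rightarrow> real"
  assume lin: "\<And>f g r s. f \<in> Cc \<Longrightarrow> g \<in> Cc \<Longrightarrow> J (\<lambda>x. r * f x + s * g x) = r * J f + s * J g"
    and trans: "\<And>f h. f \<in> Cc \<Longrightarrow> J (\<lambda>g. f (g \<otimes> h)) = J f"
    and pos: "\<And>f g. f \<in> Cc_nonneg \<Longrightarrow> f g > 0 \<Longrightarrow> J f > 0"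
    and bd: "\<And>K. compact K \<Longrightarrow> K \<noteq> {} \<Longrightarrow> \<exists>M\<ge>0. \<forall>f\<in>Cc. (\<forall>x. x \<notin> K \<longrightarrow> f x = 0) \<longrightarrow>
       (\<forall>B. (\<forall>x\<in>K. \<bar>f x\<bar> \<le> B) \<longrightarrow> \<bar>J f\<bar> \<le> M * B)"
  obtain \<theta> D where \<theta>: "\<theta> \<in> C_inf AM" "\<And>q. \<theta> q \<ge> 0" "\<theta> x > 0" "compact D" "D \<subseteq> UNIV" "\<And>q. q \<notin> D \<Longrightarrow> \<theta> q = 0"
    by (rule S.bump_function[OF open_UNIV UNIV_I[of x]]) blast
  define av where "av \<psi> y = J (\<lambda>g. \<psi> (act g y))" for \<psi> y
  have av: "av \<psi> \<in> inv_functions AM act (carrier G)"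
    if \<psi>: "\<psi> \<in> C_inf AM" "\<And>x. x \<notin> D \<Longrightarrow> \<psi> x = 0" for \<psi>
  proof -
    have "av \<psi> \<in> C_inf AM"
      unfolding av_def[abs_def] by (rule average_smooth[OF lin bd \<psi>(1) \<theta>(4) \<psi>(2)])
    moreover have "av \<psi> (act h y) = av \<psi> y" for h y
      unfolding av_def by (rule average_invariant[where D = D, OF _ \<psi>(1) \<theta>(4) \<psi>(2)]) (rule trans)
    ultimately show ?thesis by (simp add: inv_functions_def)
  qed
  have E: "av \<theta> \<in> inv_functions AM act (carrier G)" by (rule av[OF \<theta>(1,6)])
  have Ex: "av \<theta> x > 0"
    unfolding av_def
  proof (rule pos)
    show "(\<lambda>g. \<theta> (act g x)) \<in> Cc_nonneg"
      using Cc_orbit_map[OF \<theta>(1,4,6)] \<theta>(2) by (simp add: Cc_nonneg_def)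
    show "\<theta> (act \<one> x) > 0" using \<theta>(3) by simp
  qed
  have A: "av (\<lambda>y. f y * \<theta> y) \<in> inv_functions AM act (carrier G)" if "f \<in> T" for f
    by (rule av[OF S.C_inf_mult[OF fs(2)[OF that] \<theta>(1)]]) (simp add: \<theta>(6))
  have AE: "av (\<lambda>y. f y * \<theta> y) y = f y * av \<theta> y" if f: "f \<in> T" and y: "y \<in> N" for f y
  proof -
    have c: "(\<lambda>g. \<theta> (act g y)) \<in> Cc" by (rule Cc_orbit_map[OF \<theta>(1,4,6)])
    \<comment> \<open>The orbit of \<open>y\<close> sees the constant \<open>f y\<close>, which
      leaves the functional as a factor. The zero summand fits the two-term form of
      linearity.\<close>
    have "av (\<lambda>y. f y * \<theta> y) y = J (\<lambda>g. f y * \<theta> (act g y) + 0 * \<theta> (act g y))"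
      by (simp add: av_def N[OF f y])
    also have "\<dots> = f y * J (\<lambda>g. \<theta> (act g y)) + 0 * J (\<lambda>g. \<theta> (act g y))" by (rule lin[OF c c])
    finally show ?thesis by (simp add: av_def)
  qed
  show thesis by (rule that[of "av \<theta>" "\<lambda>f. av (\<lambda>y. f y * \<theta> y)", OF E Ex A AE])
qed

text \<open>Stated for any two commuting subsets whose products exhaust the group, so that both
  equivalences of the theorem are instances with the factors exchanged.\<close>

lemma multiplicity_free_iff_reduced:
  assumes H: "\<one> \<in> H" and comm: "\<And>h k. h \<in> H \<Longrightarrow> k \<in> K \<Longrightarrow> k \<otimes> h = h \<otimes> k"
    and prod: "\<And>g. \<exists>h\<in>H. \<exists>k\<in>K. g = h \<otimes> k"
  shows "multiplicity_free G AM \<omega> act \<longleftrightarrow>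
    (\<forall>\<alpha>\<in>lie_dual G AG (carrier G). reduced_multiplicity_free G AG AM \<omega> act \<mu> H (dual_restrict G AG H \<alpha>) K)"
proof
  let ?red = "\<lambda>\<alpha>. reduced_multiplicity_free G AG AM \<omega> act \<mu> H \<alpha> K"
  assume mf: "multiplicity_free G AM \<omega> act"
  have "?red \<alpha>" for \<alpha>
    unfolding reduced_multiplicity_free_def topspace_reduced_space
  proof (intro ballI)
    let ?N = "moment_level G AG \<mu> H \<alpha>" and ?q = "sub_orbit G act H"
    fix a b P
    assume a: "a \<in> reduced_inv_functions G AG AM act \<mu> H \<alpha> K" and b: "b \<in> reduced_inv_functions G AG AM act \<mu> H \<alpha> K"
      and "P \<in> ?q ` ?N"
    then obtain x where x: "x \<in> ?N" "P = ?q x" by blast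
    \<comment> \<open>Invariance of \<open>a\<close> under \<open>K\<close> is a condition on orbits
      inside the level set, so the representative inherits \<open>G\<close>-invariance there and
      nothing is known about it elsewhere.\<close>
    have inv_on_N: "f (act g y) = f y"
      if a: "a \<in> reduced_inv_functions G AG AM act \<mu> H \<alpha> K" and f: "represents G AG AM act \<mu> H \<alpha> f a"
        and y: "y \<in> ?N" for a f g y
    proof -
      obtain h k where hk: "h \<in> H" "k \<in> K" "g = h \<otimes> k" using prod by blast
      have ky: "act k y \<in> ?N" by (rule moment_level_commuting[OF _ y]) (use comm hk in blast)
      have "act k ` ?q y = ?q (act k y)" by (rule image_sub_orbit) (rule comm[OF _ hk(2)])
      moreover have "a (act k ` ?q y) = a (?q y)"
        using a hk(2) y unfolding reduced_inv_functions_def topspace_reduced_space by blast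
      ultimately have "f (act k y) = f y" using f y ky unfolding represents_def by metis
      moreover have "f (act h (act k y)) = f (act k y)"
        using f hk(1) unfolding represents_def inv_functions_def by blast
      ultimately show ?thesis unfolding hk(3) act_mult by simp
    qed
    obtain f where f: "represents G AG AM act \<mu> H \<alpha> f a"
      using a unfolding reduced_inv_functions_def reduced_functions_def by blast
    obtain g where g: "represents G AG AM act \<mu> H \<alpha> g b"
      using b unfolding reduced_inv_functions_def reduced_functions_def by blast
    have fg: "f \<in> inv_functions AM act H" "g \<in> inv_functions AM act H"
      using f g by (auto simp: represents_def)
    have C: "f \<in> C_inf AM" "g \<in> C_inf AM" using fg by (auto simp: inv_functions_def)
    obtain E A where E: "E \<in> inv_functions AM act (carrier G)" "E x > 0"
      and A: "\<And>u. u \<in> {f, g} \<Longrightarrow> A u \<in> inv_functions AM act (carrier G)"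
      and AE: "\<And>u y. u \<in> {f, g} \<Longrightarrow> y \<in> ?N \<Longrightarrow> A u y = u y * E y"
    proof (rule quotient_of_averages[of "{f, g}" ?N x])
      show "u (act k y) = u y" if "u \<in> {f, g}" "y \<in> ?N" for u k y
        using that inv_on_N[OF a f] inv_on_N[OF b g] by auto
    qed (use C in auto)
    have sub: "u \<in> inv_functions AM act H" if "u \<in> inv_functions AM act (carrier G)" for u
      using that by (auto simp: inv_functions_def)
    have EH: "E \<in> inv_functions AM act H" by (rule sub[OF E(1)])
    have EC: "E \<in> C_inf AM" using E by (simp add: inv_functions_def)
    have uE: "(\<lambda>y. u y * E y) \<in> inv_functions AM act H" if "u \<in> inv_functions AM act H" for u
      using that EH S.C_inf_mult by (auto simp: inv_functions_def)
    have Az: "poisson AM \<omega> (A f) (A g) x = 0" "poisson AM \<omega> (A f) E x = 0" "poisson AM \<omega> (A g) E x = 0"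
      using mf A E unfolding multiplicity_free_def by auto
    \<comment> \<open>On the level set \<open>A u\<close> is \<open>u\<close> times
      \<open>E\<close>, and at \<open>x\<close> the bracket of \<open>H\<close>-invariant functions
      depends only on their values there. The vanishing bracket of invariants thus becomes a bracket
      of products.\<close>
    have 1: "poisson AM \<omega> (A f) (A g) x = poisson AM \<omega> (\<lambda>y. f y * E y) (\<lambda>y. g y * E y) x"
      by (rule poisson_level_cong[OF sub uE[OF fg(1)] sub uE[OF fg(2)] _ _ x(1)]) (use A AE in auto)
    have E0: "poisson AM \<omega> E E x = 0" using S.poisson_skew[OF EC EC, of x] by simp
    have zE: "poisson AM \<omega> u E x = 0" if u: "u \<in> {f, g}" for u
    proof -
      have uH: "u \<in> inv_functions AM act H" "u \<in> C_inf AM" using u fg C by auto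
      have "poisson AM \<omega> (A u) E x = poisson AM \<omega> (\<lambda>y. u y * E y) E x"
        by (rule poisson_level_cong[OF sub[OF A[OF u]] uE[OF uH(1)] EH EH _ _ x(1)]) (use AE[OF u] in auto)
      also have "\<dots> = E x * poisson AM \<omega> u E x"
        using S.poisson_mult_left[OF uH(2) EC EC] E0 by simp
      finally show ?thesis using Az(2,3) u E(2) by auto
    qed
    have fE: "(\<lambda>y. f y * E y) \<in> C_inf AM" "(\<lambda>y. g y * E y) \<in> C_inf AM" using C EC by (auto intro: S.C_inf_mult)
    have "poisson AM \<omega> f (\<lambda>y. g y * E y) x = E x * poisson AM \<omega> f g x"
    proof -
      have "poisson AM \<omega> (\<lambda>y. g y * E y) f x = g x * poisson AM \<omega> E f x + E x * poisson AM \<omega> g f x"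
        by (rule S.poisson_mult_left[OF C(2) EC C(1)])
      moreover have "poisson AM \<omega> E f x = 0" using zE[of f] S.poisson_skew[OF EC C(1), of x] by simp
      ultimately show ?thesis
        using S.poisson_skew[OF C(1) fE(2), of x] S.poisson_skew[OF C(2,1), of x] by simp
    qed
    moreover have "poisson AM \<omega> E (\<lambda>y. g y * E y) x = 0"
    proof -
      have "poisson AM \<omega> (\<lambda>y. g y * E y) E x = g x * poisson AM \<omega> E E x + E x * poisson AM \<omega> g E x"
        by (rule S.poisson_mult_left[OF C(2) EC EC])
      then show ?thesis using E0 zE[of g] S.poisson_skew[OF EC fE(2), of x] by simp
    qed
    \<comment> \<open>Leibniz in both arguments: every term other than \<open>E x * E x\<close>
      times the bracket of \<open>f\<close> and \<open>g\<close> contains a bracket with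
      \<open>E\<close>, and these vanish at \<open>x\<close>.\<close>
    ultimately have "poisson AM \<omega> (\<lambda>y. f y * E y) (\<lambda>y. g y * E y) x = E x * (E x * poisson AM \<omega> f g x)"
      using S.poisson_mult_left[OF C(1) EC fE(2), of x] by simp
    then have "poisson AM \<omega> f g x = 0" using 1 Az(1) E(2) by simp
    then show "reduced_bracket G AG AM \<omega> act \<mu> H \<alpha> a b P = 0"
      unfolding x(2) reduced_bracket_eq[OF H f g x(1)] .
  qed
  then show "\<forall>\<alpha>\<in>lie_dual G AG (carrier G). ?red (dual_restrict G AG H \<alpha>)" by blast
next
  let ?red = "\<lambda>\<alpha>. reduced_multiplicity_free G AG AM \<omega> act \<mu> H \<alpha> K"
  assume red: "\<forall>\<alpha>\<in>lie_dual G AG (carrier G). ?red (dual_restrict G AG H \<alpha>)"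
  show "multiplicity_free G AM \<omega> act"
    unfolding multiplicity_free_def
  proof (intro ballI ext)
    fix f g x
    assume f: "f \<in> inv_functions AM act (carrier G)" and g: "g \<in> inv_functions AM act (carrier G)"
    \<comment> \<open>The moment value of the given point itself, so that \<open>x\<close> belongs
      to the level set and its orbit is a point of the reduced space.\<close>
    define \<alpha> where "\<alpha> = dual_restrict G AG H (\<mu> x)"
    let ?N = "moment_level G AG \<mu> H \<alpha>" and ?q = "sub_orbit G act H"
    have "\<mu> x \<in> lie_dual G AG (carrier G)" using moment by (simp add: moment_map_def)
    then have redx: "?red \<alpha>" using red by (simp add: \<alpha>_def)
    have x: "x \<in> ?N" unfolding \<alpha>_def by (rule in_own_moment_level[OF H])
    define desc where "desc u = restrict (\<lambda>P. u (SOME y. y \<in> P)) (?q ` ?N)" for u :: "'m \<Rightarrow> real"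
    have sub: "u \<in> inv_functions AM act H" if "u \<in> inv_functions AM act (carrier G)" for u
      using that by (auto simp: inv_functions_def)
    have desc: "desc u (?q y) = u y" if u: "u \<in> inv_functions AM act (carrier G)" and y: "y \<in> ?N" for u y
    proof -
      have "(SOME z. z \<in> ?q y) \<in> ?q y" using sub_orbit_refl[OF H] by (rule someI)
      then show ?thesis using y inv_functions_sub_orbit[OF sub[OF u]] by (simp add: desc_def)
    qed
    have rep: "represents G AG AM act \<mu> H \<alpha> u (desc u)" if u: "u \<in> inv_functions AM act (carrier G)" for u
      using sub[OF u] desc[OF u] by (simp add: represents_def)
    have "desc u \<in> reduced_inv_functions G AG AM act \<mu> H \<alpha> K" if u: "u \<in> inv_functions AM act (carrier G)" for u
      unfolding reduced_inv_functions_def reduced_functions_def topspace_reduced_space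
    proof (intro CollectI conjI ballI)
      show "desc u \<in> extensional (?q ` ?N)" by (simp add: desc_def)
      show "\<exists>f. represents G AG AM act \<mu> H \<alpha> f (desc u)" using rep[OF u] by blast
      fix k P assume k: "k \<in> K" and "P \<in> ?q ` ?N"
      then obtain y where y: "y \<in> ?N" "P = ?q y" by blast
      have ky: "act k y \<in> ?N" by (rule moment_level_commuting[OF _ y(1)]) (use comm k in blast)
      have "act k ` ?q y = ?q (act k y)" by (rule image_sub_orbit) (rule comm[OF _ k])
      moreover have "u (act k y) = u y" using u by (simp add: inv_functions_def)
      ultimately show "desc u (act k ` P) = desc u P"
        unfolding y(2) by (simp add: desc[OF u ky] desc[OF u y(1)])
    qed
    then have "reduced_bracket G AG AM \<omega> act \<mu> H \<alpha> (desc f) (desc g) (?q x) = 0"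
      using redx f g x unfolding reduced_multiplicity_free_def topspace_reduced_space by blast
    then show "poisson AM \<omega> f g x = 0"
      using reduced_bracket_eq[OF H rep[OF f] rep[OF g] x] by simp
  qed
qed

end

text \<open>In the external product \<open>(\<one>, k)\<close> times \<open>(h, \<one>)\<close> is
  \<open>(h, k)\<close>; the multiplication map is a homomorphism, so \<open>h k\<close> equals
  \<open>k h\<close>.\<close>

lemma internal_product_commute:
  assumes G: "Group.group G" and ip: "internal_product G G1 G2" and h: "h \<in> G1" and k: "k \<in> G2"
  shows "h \<otimes>\<^bsub>G\<^esub> k = k \<otimes>\<^bsub>G\<^esub> h"
proof -
  interpret group G by (rule G)
  have sg: "subgroup G1 G" "subgroup G2 G" using ip by (auto simp: internal_product_def)
  then have c: "h \<in> carrier G" "k \<in> carrier G" "\<one>\<^bsub>G\<^esub> \<in> G1" "\<one>\<^bsub>G\<^esub> \<in> G2"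
    using h k subgroup.mem_carrier[of G1 G h] subgroup.mem_carrier[of G2 G k]
      subgroup.one_closed[of G1 G] subgroup.one_closed[of G2 G] by blast+
  let ?m = "\<lambda>(g, h). g \<otimes>\<^bsub>G\<^esub> h"
  have "?m \<in> hom (G\<lparr>carrier := G1\<rparr> \<times>\<times> G\<lparr>carrier := G2\<rparr>) G"
    using ip by (simp add: internal_product_def iso_def)
  from hom_mult[OF this, of "(\<one>\<^bsub>G\<^esub>, k)" "(h, \<one>\<^bsub>G\<^esub>)"] show ?thesis
    using c h k by simp
qed

lemma internal_product_surj:
  assumes ip: "internal_product G G1 G2" and g: "g \<in> carrier G"
  shows "\<exists>h\<in>G1. \<exists>k\<in>G2. g = h \<otimes>\<^bsub>G\<^esub> k"
proof -
  have "bij_betw (\<lambda>(g, h). g \<otimes>\<^bsub>G\<^esub> h) (G1 \<times> G2) (carrier G)"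
    using ip by (simp add: internal_product_def iso_def)
  then show ?thesis using g unfolding bij_betw_def by force
qed

theorem theorem4p2:
  fixes G :: "'g::{t2_space, second_countable_topology} monoid"
    and AG :: "('g, 'e::real_normed_vector) atlas"
    and AM :: "('m::{t2_space, second_countable_topology}, 'f::real_normed_vector) atlas"
    and \<omega> :: "'m two_form"
    and act :: "'g \<Rightarrow> 'm \<Rightarrow> 'm"
    and \<mu> :: "'m \<Rightarrow> 'g tvec \<Rightarrow> real"
    and G1 G2 :: "'g set"
  assumes "smooth_atlas AM" and "connected (UNIV :: 'm set)" and "symplectic_form AM \<omega>"
    and "lie_group G AG" and "connected (UNIV :: 'g set)"
    and "internal_product G G1 G2"
    and "closed G1" and "connected G1" and "closed G2" and "connected G2"
    and "smooth_action G AG AM act" and "proper_action act"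
    and "symplectic_action G AM \<omega> act" and "moment_map G AG AM \<omega> act \<mu>"
    and "coadjoint_orbits_locally_closed G AG (carrier G)"
    and "coadjoint_orbits_locally_closed G AG G1"
    and "coadjoint_orbits_locally_closed G AG G2"
  shows "(multiplicity_free G AM \<omega> act \<longleftrightarrow>
            (\<forall>\<alpha>\<in>lie_dual G AG (carrier G).
               reduced_multiplicity_free G AG AM \<omega> act \<mu> G1 (dual_restrict G AG G1 \<alpha>) G2)) \<and>
         (multiplicity_free G AM \<omega> act \<longleftrightarrow>
            (\<forall>\<alpha>\<in>lie_dual G AG (carrier G).
               reduced_multiplicity_free G AG AM \<omega> act \<mu> G2 (dual_restrict G AG G2 \<alpha>) G1))"
proof -
  have AG: "smooth_atlas AG" and G: "Group.group G" "carrier G = UNIV"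
    using assms(4) by (auto simp: lie_group_def)
  have "\<exists>B::'f set. finite B \<and> span B = UNIV" using assms(1) unfolding smooth_atlas_def by (rule conjunct1)
  then obtain BM :: "'f set" where BM: "finite BM" "span BM = UNIV" by blast
  obtain bM nM cM where M: "findim (bM :: nat \<Rightarrow> 'f) nM cM"
    using findim_exists[OF BM] by (elim exE)
  have "\<exists>B::'e set. finite B \<and> span B = UNIV" using AG unfolding smooth_atlas_def by (rule conjunct1)
  then obtain BG :: "'e set" where BG: "finite BG" "span BG = UNIV" by blast
  obtain bG nG cG where G': "findim (bG :: nat \<Rightarrow> 'e) nG cG"
    using findim_exists[OF BG] by (elim exE)
  interpret hamiltonian_space bM nM cM AM \<omega> bG nG cG AG G act \<mu>
    using assms AG M G'
    by (intro hamiltonian_space.intro symplectic.intro manifold.intro manifold_axioms.intro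
        symplectic_axioms.intro hamiltonian_space_axioms.intro)
  have one: "\<one>\<^bsub>G\<^esub> \<in> G1" "\<one>\<^bsub>G\<^esub> \<in> G2"
    using assms(6) subgroup.one_closed[of G1 G] subgroup.one_closed[of G2 G]
    by (simp_all add: internal_product_def)
  note comm = internal_product_commute[OF G(1) assms(6)]
  have prod: "\<exists>h\<in>G1. \<exists>k\<in>G2. g = h \<otimes>\<^bsub>G\<^esub> k" for g
    using internal_product_surj[OF assms(6)] G(2) by simp
  have prod': "\<exists>k\<in>G2. \<exists>h\<in>G1. g = k \<otimes>\<^bsub>G\<^esub> h" for g
  proof -
    obtain h k where hk: "h \<in> G1" "k \<in> G2" "g = h \<otimes>\<^bsub>G\<^esub> k" using prod by blast
    then have "g = k \<otimes>\<^bsub>G\<^esub> h" using comm by simp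
    then show ?thesis using hk by blast
  qed
  show ?thesis
  proof
    show "multiplicity_free G AM \<omega> act \<longleftrightarrow>
        (\<forall>\<alpha>\<in>lie_dual G AG (carrier G).
           reduced_multiplicity_free G AG AM \<omega> act \<mu> G1 (dual_restrict G AG G1 \<alpha>) G2)"
      by (rule multiplicity_free_iff_reduced[OF one(1) comm[symmetric] prod])
    show "multiplicity_free G AM \<omega> act \<longleftrightarrow>
        (\<forall>\<alpha>\<in>lie_dual G AG (carrier G).
           reduced_multiplicity_free G AG AM \<omega> act \<mu> G2 (dual_restrict G AG G2 \<alpha>) G1)"
      by (rule multiplicity_free_iff_reduced[OF one(2) comm prod'])
  qed
qed

end
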